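(* Let $p$ be an umbilic of a smooth immersed surface $\Sigma$ in $\mathbb{R}^3$ with principal curvatures $\kappa_1\ge\kappa_2$, let $c:=\kappa_1(p)=\kappa_2(p)$, and assume that there is a constant $\Lambda<0$ such that $$(\kappa_1-c)^2+(\kappa_2-c)^2\le 2\Lambda\,(\kappa_1-c)(\kappa_2-c)$$ holds in a neighborhood of $p$ in $\Sigma$. Then either $\Sigma$ is totally umbilical around $p$ (i.e. in a neighborhood of $p$), or $p$ is an isolated umbilic of non-positive index. In particular, any quasi-CMC surface in $\mathbb{R}^3$ is either totally umbilical, or it has only isolated umbilics of non-positive index.
   Context: Surfaces are $C^\infty$, connected, immersed in $\mathbb{R}^3$ with a chosen unit normal; $H=(\kappa_1+\kappa_2)/2$ and $K=\kappa_1\kappa_2$. An umbilic is a point where $\kappa_1=\kappa_2$. A surface is quasi-CMC if there are constants $c,\mu\in\mathbb{R}$ with $\mu<1$ such that $(H-c)^2\le\mu(H^2-K)$ on the whole surface; equivalently, if there are constants $c\in\mathbb{R}$ and $\Lambda\le -1$ with $(\kappa_1-c)^2+(\kappa_2-c)^2\le 2\Lambda(\kappa_1-c)(\kappa_2-c)$ on the whole surface. Away from umbilics, the two principal directions define two continuous line fields $\mathcal{L}_1,\mathcal{L}_2$. If $p$ is an isolated umbilic, its index is the common rotation index of $\mathcal{L}_1$ and $\mathcal{L}_2$ around $p$: in a local chart, the total variation of the angle of the line field along a small positively oriented circle around $p$, divided by $2\pi$ (a half-integer). *)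

theory Defs
  imports "HOL-Analysis.Analysis"
begin

text \<open>The plane of parameters is the type \<^typ>\<open>complex\<close>, regarded as a real Euclidean plane,
  so that \<^term>\<open>z + of_real r * cis t\<close> runs once, in the positive sense, around the circle with
  centre \<^term>\<open>z\<close> and radius \<^term>\<open>r\<close>.\<close>

text \<open>Meant for open \<open>S\<close> in a Euclidean space.\<close>

primrec Ck_on :: "nat \<Rightarrow> 'a::real_normed_vector set \<Rightarrow> ('a \<Rightarrow> 'b::real_normed_vector) \<Rightarrow> bool" where
  "Ck_on 0 S f \<longleftrightarrow> continuous_on S f"
| "Ck_on (Suc k) S f \<longleftrightarrow>
     (\<forall>x\<in>S. f differentiable (at x)) \<and> (\<forall>v. Ck_on k S (\<lambda>x. frechet_derivative f (at x) v))"

definition smooth_on :: "'a::real_normed_vector set \<Rightarrow> ('a \<Rightarrow> 'b::real_normed_vector) \<Rightarrow> bool" where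
  "smooth_on S f \<longleftrightarrow> (\<forall>k. Ck_on k S f)"


section \<open>Immersed surfaces\<close>

text \<open>An atlas consists of local parametrizations \<open>(U, \<phi>)\<close>, that is, of the inverses of the
  coordinate maps; it need not be maximal. Self-intersections of the image are allowed:
  \<open>imm\<close> need not be injective.\<close>

record 'a surface =
  surf_top :: "'a topology"
  charts :: "(complex set \<times> (complex \<Rightarrow> 'a)) set"
  imm :: "'a \<Rightarrow> real^3"
  nrm :: "'a \<Rightarrow> real^3"

definition smooth_atlas :: "'a topology \<Rightarrow> (complex set \<times> (complex \<Rightarrow> 'a)) set \<Rightarrow> bool" where
  "smooth_atlas X \<A> \<longleftrightarrow>
     (\<forall>(U, \<phi>)\<in>\<A>. open U \<and> embedding_map (top_of_set U) X \<phi> \<and> openin X (\<phi> ` U)) \<and>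
     (\<Union>(U, \<phi>)\<in>\<A>. \<phi> ` U) = topspace X \<and>
     (\<forall>(U, \<phi>)\<in>\<A>. \<forall>(V, \<xi>)\<in>\<A>. smooth_on {z\<in>U. \<phi> z \<in> \<xi> ` V} (inv_into V \<xi> \<circ> \<phi>))"

definition dimm :: "'a surface \<Rightarrow> (complex \<Rightarrow> 'a) \<Rightarrow> complex \<Rightarrow> complex \<Rightarrow> real^3" where
  "dimm \<Sigma> \<phi> z = frechet_derivative (imm \<Sigma> \<circ> \<phi>) (at z)"

definition dnrm :: "'a surface \<Rightarrow> (complex \<Rightarrow> 'a) \<Rightarrow> complex \<Rightarrow> complex \<Rightarrow> real^3" where
  "dnrm \<Sigma> \<phi> z = frechet_derivative (nrm \<Sigma> \<circ> \<phi>) (at z)"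

definition immersed_surface :: "'a surface \<Rightarrow> bool" where
  "immersed_surface \<Sigma> \<longleftrightarrow>
     Hausdorff_space (surf_top \<Sigma>) \<and> second_countable (surf_top \<Sigma>) \<and> connected_space (surf_top \<Sigma>) \<and>
     smooth_atlas (surf_top \<Sigma>) (charts \<Sigma>) \<and>
     (\<forall>(U, \<phi>)\<in>charts \<Sigma>.
        smooth_on U (imm \<Sigma> \<circ> \<phi>) \<and> (\<forall>z\<in>U. inj (dimm \<Sigma> \<phi> z)) \<and>
        smooth_on U (nrm \<Sigma> \<circ> \<phi>) \<and>
        (\<forall>z\<in>U. norm (nrm \<Sigma> (\<phi> z)) = 1 \<and> (\<forall>w. nrm \<Sigma> (\<phi> z) \<bullet> dimm \<Sigma> \<phi> z w = 0)))"


section \<open>Curvatures and umbilics\<close>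

text \<open>The principal curvatures are the eigenvalues of the shape operator, the endomorphism
  of the tangent plane that sends \<^term>\<open>dimm \<Sigma> \<phi> z w\<close> to \<^term>\<open>- dnrm \<Sigma> \<phi> z w\<close>.
  They do not depend on the parametrization around the point.\<close>

definition principal_curvatures :: "'a surface \<Rightarrow> 'a \<Rightarrow> real set" where
  "principal_curvatures \<Sigma> p =
     {k. \<exists>(U, \<phi>)\<in>charts \<Sigma>. \<exists>z\<in>U. \<phi> z = p \<and>
           (\<exists>w. w \<noteq> 0 \<and> - dnrm \<Sigma> \<phi> z w = k *\<^sub>R dimm \<Sigma> \<phi> z w)}"

definition kappa1 :: "'a surface \<Rightarrow> 'a \<Rightarrow> real" where
  "kappa1 \<Sigma> p = Max (principal_curvatures \<Sigma> p)"

definition kappa2 :: "'a surface \<Rightarrow> 'a \<Rightarrow> real" where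
  "kappa2 \<Sigma> p = Min (principal_curvatures \<Sigma> p)"

definition mean_curvature :: "'a surface \<Rightarrow> 'a \<Rightarrow> real" where
  "mean_curvature \<Sigma> p = (kappa1 \<Sigma> p + kappa2 \<Sigma> p) / 2"

definition gauss_curvature :: "'a surface \<Rightarrow> 'a \<Rightarrow> real" where
  "gauss_curvature \<Sigma> p = kappa1 \<Sigma> p * kappa2 \<Sigma> p"

definition umbilic :: "'a surface \<Rightarrow> 'a \<Rightarrow> bool" where
  "umbilic \<Sigma> p \<longleftrightarrow> p \<in> topspace (surf_top \<Sigma>) \<and> kappa1 \<Sigma> p = kappa2 \<Sigma> p"

definition totally_umbilical :: "'a surface \<Rightarrow> bool" where
  "totally_umbilical \<Sigma> \<longleftrightarrow> (\<forall>p\<in>topspace (surf_top \<Sigma>). umbilic \<Sigma> p)"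

definition totally_umbilical_around :: "'a surface \<Rightarrow> 'a \<Rightarrow> bool" where
  "totally_umbilical_around \<Sigma> p \<longleftrightarrow> (\<forall>\<^sub>F q in nhdsin (surf_top \<Sigma>) p. umbilic \<Sigma> q)"

definition isolated_umbilic :: "'a surface \<Rightarrow> 'a \<Rightarrow> bool" where
  "isolated_umbilic \<Sigma> p \<longleftrightarrow>
     umbilic \<Sigma> p \<and> (\<forall>\<^sub>F q in atin (surf_top \<Sigma>) p. \<not> umbilic \<Sigma> q)"

definition quasi_CMC :: "'a surface \<Rightarrow> bool" where
  "quasi_CMC \<Sigma> \<longleftrightarrow>
     (\<exists>c \<mu>. \<mu> < 1 \<and>
        (\<forall>p\<in>topspace (surf_top \<Sigma>).
           (mean_curvature \<Sigma> p - c)\<^sup>2 \<le> \<mu> * ((mean_curvature \<Sigma> p)\<^sup>2 - gauss_curvature \<Sigma> p)))"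


section \<open>The index of an isolated umbilic\<close>

text \<open>The eigenspace, read in a parametrization, of the shape operator for the principal
  curvature function \<open>\<kappa>\<close> (either \<^term>\<open>kappa1 \<Sigma>\<close> or \<^term>\<open>kappa2 \<Sigma>\<close>);
  it is a line exactly away from the umbilics.\<close>

definition principal_line ::
    "'a surface \<Rightarrow> ('a \<Rightarrow> real) \<Rightarrow> (complex \<Rightarrow> 'a) \<Rightarrow> complex \<Rightarrow> complex set" where
  "principal_line \<Sigma> \<kappa> \<phi> z = {w. - dnrm \<Sigma> \<phi> z w = \<kappa> (\<phi> z) *\<^sub>R dimm \<Sigma> \<phi> z w}"

text \<open>Along every small circle around \<open>z\<close> the line field \<open>L\<close> has a continuous angle \<open>\<theta>\<close>,
  whose total (signed) variation is \<open>2 * pi * j\<close>. Since \<open>L\<close> is a field of unoriented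
  lines, \<open>\<theta>\<close> is determined up to multiples of \<^term>\<open>pi\<close>, so \<open>j\<close> is a half-integer.\<close>

definition has_rotation_index :: "(complex \<Rightarrow> complex set) \<Rightarrow> complex \<Rightarrow> real \<Rightarrow> bool" where
  "has_rotation_index L z j \<longleftrightarrow>
     (\<exists>R>0. \<forall>r. 0 < r \<and> r < R \<longrightarrow>
        (\<exists>\<theta>::real \<Rightarrow> real. continuous_on {0..2*pi} \<theta> \<and>
             (\<forall>t\<in>{0..2*pi}. L (z + of_real r * cis t) = span {cis (\<theta> t)}) \<and>
             (\<theta> (2*pi) - \<theta> 0) / (2*pi) = j))"

text \<open>The index is independent of the parametrization (even of its orientation) and is the same
  for both line fields, whence the quantification over all of them.\<close>

definition has_umbilic_index :: "'a surface \<Rightarrow> 'a \<Rightarrow> real \<Rightarrow> bool" where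
  "has_umbilic_index \<Sigma> p j \<longleftrightarrow>
     isolated_umbilic \<Sigma> p \<and>
     (\<forall>(U, \<phi>)\<in>charts \<Sigma>. \<forall>z\<in>U. \<phi> z = p \<longrightarrow>
        (\<forall>\<kappa>\<in>{kappa1 \<Sigma>, kappa2 \<Sigma>}. has_rotation_index (principal_line \<Sigma> \<kappa> \<phi>) z j))"

definition isolated_umbilic_nonpos_index :: "'a surface \<Rightarrow> 'a \<Rightarrow> bool" where
  "isolated_umbilic_nonpos_index \<Sigma> p \<longleftrightarrow>
     isolated_umbilic \<Sigma> p \<and> (\<exists>j\<le>0. has_umbilic_index \<Sigma> p j)"

end

theory Submission imports Defs begin

text \<open>Near an umbilic \<open>p\<close> with \<open>\<kappa>\<^sub>1 = \<kappa>\<^sub>2 = c\<close>, the hypothesis says that \<open>S - c\<close>, where \<open>S\<close> is the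
  shape operator, has eigenvalues of opposite signs and comparable size. As \<open>d(\<nu> + c X) = - (S - c) dX\<close>,
  the projection \<open>f\<close> of \<open>\<nu> + c X\<close> to the tangent plane at \<open>p\<close> is, up to a reflection, a smooth quasiregular map
  of the plane, whose critical points are the umbilics. If \<open>f\<close> is not constant near \<open>p\<close>, it does not
  agree with \<open>f p\<close> to infinite order (strong unique continuation, by energy estimates for \<open>log |f|\<close> and
  \<open>log log (1 / |f|)\<close>), so it has a leading term \<open>r\<^sup>N q(t)\<close> in polar coordinates. Quasiregularity forces \<open>q\<close> to be free of
  zeros and to turn \<open>m \<ge> 1\<close> times, whence \<open>p\<close> is isolated, the partial derivatives of \<open>f\<close> turn \<open>m - 1\<close>
  times around \<open>p\<close>, and the principal line fields, whose angle \<open>df\<close> doubles and reverses, have index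
  \<open>- (m - 1) / 2\<close>. Since \<open>m\<close> is the local degree of \<open>f\<close>, it does not depend on the chart.\<close>


section \<open>Smooth functions and degrees of loops\<close>

text \<open>The surface is only smooth, so an umbilic could a priori have infinite order, and the
  traceless part h of the shape operator could have a leading term with zeros: the hypothesis bounds
  H - c by a multiple k < 1 of |h| and says nothing else about h. The map f, however, obeys the
  closed inequality |df|^2 \<le> K J, which is quadratic and invariant under rotations, and hence is
  inherited by its leading Taylor coefficients. Smoothness thus takes the place of a factorization
  of f through a holomorphic map, once infinite order is excluded. Two energies are needed for that.
  The energy of log |f| diverges at zeros, whereas that of log log (1 / |f|) stays finite; the
  latter can be used without any knowledge of the zero set and produces a zero-free circle, from
  which the estimate for log |f| can start. For the index, the angle of the principal lines is half
  the argument of h, and h turns like a partial derivative of f up to conjugation, because the term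
  H - c is dominated by |h|.\<close>

lemma Ck_on_cong:
  assumes "open S" "\<And>x. x \<in> S \<Longrightarrow> f x = g x" "Ck_on k S f"
  shows "Ck_on k S g"
  using assms
proof (induction k arbitrary: f g)
  case 0
  then show ?case by (simp cong: continuous_on_cong)
next
  case (Suc k)
  have tr: "(g has_derivative D) (at x) \<longleftrightarrow> (f has_derivative D) (at x)" if "x \<in> S" for x D
    using has_derivative_transform_within_open[of f D x UNIV S g]
      has_derivative_transform_within_open[of g D x UNIV S f] Suc.prems that by auto
  have "frechet_derivative f (at x) = frechet_derivative g (at x)" if "x \<in> S" for x
    unfolding frechet_derivative_def using tr[OF that] by simp
  then have "Ck_on k S (\<lambda>x. frechet_derivative g (at x) v)" for v
    using Suc.IH[OF Suc.prems(1), of "\<lambda>x. frechet_derivative f (at x) v"] Suc.prems(3) by simp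
  moreover have "g differentiable at x" if "x \<in> S" for x
    using Suc.prems(3) that tr[OF that] by (simp add: differentiable_def)
  ultimately show ?case by simp
qed

lemma smooth_on_imp_continuous_on: "smooth_on S f \<Longrightarrow> continuous_on S f"
  by (metis Ck_on.simps(1) smooth_on_def)

lemma smooth_on_has_derivative:
  "smooth_on S f \<Longrightarrow> x \<in> S \<Longrightarrow> (f has_derivative frechet_derivative f (at x)) (at x)"
  unfolding smooth_on_def by (metis Ck_on.simps(2) frechet_derivative_works)

lemma smooth_on_frechet_derivative:
  "smooth_on S f \<Longrightarrow> smooth_on S (\<lambda>x. frechet_derivative f (at x) v)"
  unfolding smooth_on_def by (metis Ck_on.simps(2))

lemma smooth_on_add:
  assumes "open S" "smooth_on S f" "smooth_on S g"
  shows "smooth_on S (\<lambda>x. f x + g x)"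
proof -
  have "Ck_on k S f \<Longrightarrow> Ck_on k S g \<Longrightarrow> Ck_on k S (\<lambda>x. f x + g x)" for k
  proof (induction k arbitrary: f g)
    case 0
    then show ?case by (simp add: continuous_on_add)
  next
    case (Suc k)
    have fd: "frechet_derivative (\<lambda>x. f x + g x) (at x)
        = (\<lambda>v. frechet_derivative f (at x) v + frechet_derivative g (at x) v)" if "x \<in> S" for x
    proof (rule frechet_derivative_at[symmetric])
      show "((\<lambda>x. f x + g x) has_derivative
         (\<lambda>v. frechet_derivative f (at x) v + frechet_derivative g (at x) v)) (at x)"
        using Suc.prems that by (auto intro!: has_derivative_add simp: frechet_derivative_works)
    qed
    have "Ck_on k S (\<lambda>x. frechet_derivative f (at x) v + frechet_derivative g (at x) v)" for v
      using Suc.IH Suc.prems by simp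
    then have "Ck_on k S (\<lambda>x. frechet_derivative (\<lambda>x. f x + g x) (at x) v)" for v
      by (rule Ck_on_cong[OF assms(1), rotated]) (simp add: fd)
    then show ?case using Suc.prems by (auto intro: differentiable_add)
  qed
  then show ?thesis using assms unfolding smooth_on_def by blast
qed

lemma smooth_on_bounded_linear_compose:
  assumes "open S" "bounded_linear L" "smooth_on S f"
  shows "smooth_on S (\<lambda>x. L (f x))"
proof -
  have "Ck_on k S f \<Longrightarrow> Ck_on k S (\<lambda>x. L (f x))" for k
  proof (induction k arbitrary: f)
    case 0
    then show ?case using assms(2) by (simp add: bounded_linear.continuous_on)
  next
    case (Suc k)
    have hd: "((\<lambda>x. L (f x)) has_derivative (\<lambda>v. L (frechet_derivative f (at x) v))) (at x)"
      if "x \<in> S" for x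
      using Suc.prems that
      by (intro bounded_linear.has_derivative[OF assms(2)]) (auto simp: frechet_derivative_works)
    have "Ck_on k S (\<lambda>x. L (frechet_derivative f (at x) v))" for v
      using Suc.IH Suc.prems by simp
    then have "Ck_on k S (\<lambda>x. frechet_derivative (\<lambda>x. L (f x)) (at x) v)" for v
      by (rule Ck_on_cong[OF assms(1), rotated]) (simp add: frechet_derivative_at[OF hd, symmetric])
    then show ?case using hd by (auto simp: differentiable_def)
  qed
  then show ?thesis using assms unfolding smooth_on_def by blast
qed

text \<open>The second difference over a square of side \<open>h\<close> is \<open>h\<^sup>2 b\<close> and \<open>h\<^sup>2 b'\<close> at suitable points.\<close>

lemma mixed_partials_real:
  fixes g gx gy a b b' d :: "complex \<Rightarrow> real"
  assumes S: "open S" "z \<in> S"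
    and g: "\<And>w. w \<in> S \<Longrightarrow> (g has_derivative (\<lambda>h. Re h * gx w + Im h * gy w)) (at w)"
    and gx: "\<And>w. w \<in> S \<Longrightarrow> (gx has_derivative (\<lambda>h. Re h * a w + Im h * b w)) (at w)"
    and gy: "\<And>w. w \<in> S \<Longrightarrow> (gy has_derivative (\<lambda>h. Re h * b' w + Im h * d w)) (at w)"
    and cont: "continuous_on S b" "continuous_on S b'"
  shows "b z = b' z"
proof (rule ccontr)
  assume ne: "b z \<noteq> b' z"
  define \<epsilon> where "\<epsilon> = \<bar>b z - b' z\<bar> / 2"
  have \<epsilon>: "\<epsilon> > 0" using ne by (simp add: \<epsilon>_def)
  obtain e where e: "e > 0" "ball z e \<subseteq> S" using S by (meson openE)
  have "isCont b z" "isCont b' z" using cont S by (simp_all add: continuous_on_eq_continuous_at)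
  then obtain d1 d2 where d: "d1 > 0" "\<And>w. dist w z < d1 \<Longrightarrow> \<bar>b w - b z\<bar> < \<epsilon>"
      "d2 > 0" "\<And>w. dist w z < d2 \<Longrightarrow> \<bar>b' w - b' z\<bar> < \<epsilon>"
    using \<epsilon> unfolding continuous_at_eps_delta by (metis dist_real_def)
  \<comment> \<open>The points of the square with side h lie within 2 h of z, hence the
    quarter.\<close>
  define h where "h = min e (min d1 d2) / 4"
  have h: "h > 0" "2 * h < e" "2 * h < d1" "2 * h < d2" using e d by (auto simp: h_def min_def)
  define P where "P s t = z + Complex s t" for s t
  have near: "dist (P s t) z < e \<and> dist (P s t) z < d1 \<and> dist (P s t) z < d2"
    if "0 \<le> s" "s \<le> h" "0 \<le> t" "t \<le> h" for s t
  proof -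
    have "dist (P s t) z \<le> \<bar>s\<bar> + \<bar>t\<bar>"
      using cmod_le[of "Complex s t"] by (simp add: P_def dist_norm)
    then show ?thesis using that h by linarith
  qed
  have inS: "P s t \<in> S" if "0 \<le> s" "s \<le> h" "0 \<le> t" "t \<le> h" for s t
    using near[OF that] e by (auto simp: dist_commute)
  have Ps: "((\<lambda>s. P s t) has_derivative (\<lambda>k. of_real k)) (at s)" for s t
    unfolding P_def Complex_eq by (auto intro!: derivative_eq_intros)
  have Pt: "((\<lambda>t. P s t) has_derivative (\<lambda>k. \<i> * of_real k)) (at t)" for s t
    unfolding P_def Complex_eq by (auto intro!: derivative_eq_intros)
  have Fs: "((\<lambda>s. F (P s t)) has_real_derivative A) (at s)"
    if "(F has_derivative (\<lambda>h. Re h * A + Im h * B)) (at (P s t))" for F :: "complex \<Rightarrow> real" and A B s t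
    using has_derivative_compose[OF Ps that] by (simp add: has_field_derivative_def mult_commute_abs)
  have Ft: "((\<lambda>t. F (P s t)) has_real_derivative B) (at t)"
    if "(F has_derivative (\<lambda>h. Re h * A + Im h * B)) (at (P s t))" for F :: "complex \<Rightarrow> real" and A B s t
    using has_derivative_compose[OF Pt that] by (simp add: has_field_derivative_def mult_commute_abs)
  define \<Delta> where "\<Delta> = g (P h h) - g (P h 0) - g (P 0 h) + g (P 0 0)"
  obtain s where s: "0 < s" "s < h" and 1: "\<Delta> = h * (gx (P s h) - gx (P s 0))"
  proof -
    have "((\<lambda>s. g (P s h) - g (P s 0)) has_real_derivative gx (P s h) - gx (P s 0)) (at s)"
      if "0 \<le> s" "s \<le> h" for s
      using that h by (intro DERIV_diff Fs[OF g] inS) auto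
    from MVT2[OF h(1) this] show ?thesis using that by (auto simp: \<Delta>_def algebra_simps)
  qed
  obtain t where t: "0 < t" "t < h" and 2: "gx (P s h) - gx (P s 0) = h * b (P s t)"
  proof -
    have "((\<lambda>t. gx (P s t)) has_real_derivative b (P s t)) (at t)"
      if "0 \<le> t" "t \<le> h" for t
      using that s by (intro Ft[OF gx] inS) auto
    from MVT2[OF h(1) this] show ?thesis using that by auto
  qed
  obtain t' where t': "0 < t'" "t' < h" and 3: "\<Delta> = h * (gy (P h t') - gy (P 0 t'))"
  proof -
    have "((\<lambda>t. g (P h t) - g (P 0 t)) has_real_derivative gy (P h t) - gy (P 0 t)) (at t)"
      if "0 \<le> t" "t \<le> h" for t
      using that h by (intro DERIV_diff Ft[OF g] inS) auto
    from MVT2[OF h(1) this] show ?thesis using that by (auto simp: \<Delta>_def algebra_simps)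
  qed
  obtain s' where s': "0 < s'" "s' < h" and 4: "gy (P h t') - gy (P 0 t') = h * b' (P s' t')"
  proof -
    have "((\<lambda>s. gy (P s t')) has_real_derivative b' (P s t')) (at s)"
      if "0 \<le> s" "s \<le> h" for s
      using that t' by (intro Fs[OF gy] inS) auto
    from MVT2[OF h(1) this] show ?thesis using that by auto
  qed
  have "b (P s t) = b' (P s' t')" using 1 2 3 4 h by simp
  moreover have "\<bar>b (P s t) - b z\<bar> < \<epsilon>" "\<bar>b' (P s' t') - b' z\<bar> < \<epsilon>"
    using near[of s t] near[of s' t'] s t s' t' d by auto
  ultimately have "\<bar>b z - b' z\<bar> < \<epsilon> + \<epsilon>" by (auto simp: abs_less_iff)
  then show False by (simp add: \<epsilon>_def)
qed

lemma linear_complex_decomp: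
  assumes "linear (D :: complex \<Rightarrow> 'b::real_vector)"
  shows "D h = Re h *\<^sub>R D 1 + Im h *\<^sub>R D \<i>"
proof -
  have "h = Re h *\<^sub>R 1 + Im h *\<^sub>R \<i>" by (simp add: complex_eq_iff)
  then show ?thesis by (metis assms linear_add linear_scale)
qed

lemma smooth_on_linear_derivative:
  "smooth_on S f \<Longrightarrow> z \<in> S \<Longrightarrow> linear (frechet_derivative f (at z))"
  using smooth_on_has_derivative has_derivative_linear by blast

text \<open>Pairing with an arbitrary vector reduces this to the scalar case. The symmetry is used
  twice: for the single \<open>fxy\<close> of \<open>c2_plane\<close>, and for the symmetry of the
  shape operator.\<close>

lemma smooth_on_mixed_partials:
  fixes f :: "complex \<Rightarrow> 'b::real_inner"
  assumes S: "open S" "z \<in> S" and f: "smooth_on S f"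
  shows "frechet_derivative (\<lambda>z. frechet_derivative f (at z) 1) (at z) \<i> =
         frechet_derivative (\<lambda>z. frechet_derivative f (at z) \<i>) (at z) 1"
proof -
  define fx fy where "fx = (\<lambda>z. frechet_derivative f (at z) 1)" "fy = (\<lambda>z. frechet_derivative f (at z) \<i>)"
  have sm: "smooth_on S fx" "smooth_on S fy" unfolding fx_fy_def
    using f by (auto intro: smooth_on_frechet_derivative)
  have D: "((\<lambda>z. F z \<bullet> v) has_derivative
      (\<lambda>h. Re h * (frechet_derivative F (at w) 1 \<bullet> v) + Im h * (frechet_derivative F (at w) \<i> \<bullet> v))) (at w)"
    if "smooth_on S F" "w \<in> S" for F :: "complex \<Rightarrow> 'b" and v w
  proof -
    have "((\<lambda>z. F z \<bullet> v) has_derivative (\<lambda>h. frechet_derivative F (at w) h \<bullet> v)) (at w)"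
      by (rule has_derivative_inner_left[OF smooth_on_has_derivative[OF that]])
    then show ?thesis
      by (subst (asm) linear_complex_decomp[OF smooth_on_linear_derivative[OF that]])
        (simp add: inner_add_left)
  qed
  have "frechet_derivative fx (at z) \<i> \<bullet> v = frechet_derivative fy (at z) 1 \<bullet> v" for v
  proof (rule mixed_partials_real[OF S])
    show "((\<lambda>z. f z \<bullet> v) has_derivative (\<lambda>h. Re h * (fx w \<bullet> v) + Im h * (fy w \<bullet> v))) (at w)"
      if "w \<in> S" for w using D[OF f that, of v] by (simp add: fx_fy_def)
    show "continuous_on S (\<lambda>z. frechet_derivative fx (at z) \<i> \<bullet> v)"
      "continuous_on S (\<lambda>z. frechet_derivative fy (at z) 1 \<bullet> v)"
      by (intro continuous_on_inner continuous_on_const smooth_on_imp_continuous_on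
          smooth_on_frechet_derivative sm)+
  qed (use D sm in auto)
  then show ?thesis unfolding fx_fy_def by (metis inner_commute vector_eq_rdot)
qed

text \<open>Loops are 2 pi-periodic maps on the whole line, and the winding number is read off a
  continuous logarithm q. Continuity, periodicity and absence of zeros of u are thus built into the
  predicate.\<close>

definition has_deg :: "(real \<Rightarrow> complex) \<Rightarrow> int \<Rightarrow> bool" where
  "has_deg u n \<longleftrightarrow> (\<exists>q. continuous_on UNIV q \<and> (\<forall>t. u t = exp (q t)) \<and>
      (\<forall>t. q (t + 2 * pi) = q t + 2 * pi * of_int n * \<i>))"

lemma has_deg_nonzero: "has_deg u n \<Longrightarrow> u t \<noteq> 0"
  by (auto simp: has_deg_def)

lemma has_deg_continuous: "has_deg u n \<Longrightarrow> continuous_on UNIV u"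
  unfolding has_deg_def by (metis (no_types, lifting) continuous_on_cong continuous_on_exp)

lemma has_deg_periodic: "has_deg u n \<Longrightarrow> u (t + 2 * pi) = u t"
proof -
  assume "has_deg u n"
  then obtain q where q: "\<And>t. u t = exp (q t)" "\<And>t. q (t + 2 * pi) = q t + 2 * pi * of_int n * \<i>"
    unfolding has_deg_def by blast
  show ?thesis
    unfolding q(1) exp_eq q(2) by (intro exI[of _ n]) auto
qed

text \<open>The difference p - q takes values in 2 pi i times the integers. Distinct values of this
  kind are at least 1 apart, so on the connected line the difference is constant.\<close>

lemma exp_eq_continuous_const:
  fixes p q :: "real \<Rightarrow> complex"
  assumes "continuous_on UNIV p" "continuous_on UNIV q" "\<And>t. exp (p t) = exp (q t)"
  shows "\<exists>k::int. \<forall>t. p t = q t + 2 * pi * of_int k * \<i>"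
proof -
  have ex: "\<exists>k::int. p t - q t = 2 * pi * of_int k * \<i>" for t
    using assms(3)[of t] unfolding exp_eq by (auto simp: algebra_simps)
  have c: "continuous_on UNIV (\<lambda>t. p t - q t)" using assms by (intro continuous_intros)
  have "(\<lambda>t. p t - q t) constant_on UNIV"
  proof (rule continuous_discrete_range_constant[OF connected_UNIV c])
    fix t :: real
    show "\<exists>e>0. \<forall>y. y \<in> UNIV \<and> p y - q y \<noteq> p t - q t \<longrightarrow> e \<le> norm (p y - q y - (p t - q t))"
    proof (intro exI[of _ 1] conjI allI impI)
      fix y assume ne: "y \<in> UNIV \<and> p y - q y \<noteq> p t - q t"
      obtain k l :: int where kl: "p y - q y = 2 * pi * of_int k * \<i>" "p t - q t = 2 * pi * of_int l * \<i>"
        using ex by blast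
      then have "k \<noteq> l" using ne by auto
      have eq: "p y - q y - (p t - q t) = of_real (2 * pi * of_int (k - l)) * \<i>"
        unfolding kl by (simp add: algebra_simps)
      have "norm (p y - q y - (p t - q t)) = 2 * pi * \<bar>of_int (k - l)\<bar>"
        unfolding eq norm_mult norm_of_real by (simp add: abs_mult)
      moreover have "(1::real) \<le> \<bar>of_int (k - l)\<bar>" using \<open>k \<noteq> l\<close> by linarith
      moreover have "2 * pi \<ge> 1" using pi_ge_two by simp
      ultimately show "1 \<le> norm (p y - q y - (p t - q t))"
        by (metis mult_le_cancel_left1 order_trans zero_le_one mult_mono one_le_numeral mult_1 abs_ge_zero)
    qed simp
  qed
  then obtain C where "\<And>t. p t - q t = C" unfolding constant_on_def by auto
  then show ?thesis using ex by (metis add_diff_cancel_left' diff_add_cancel add.commute)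
qed

lemma has_deg_unique:
  assumes "has_deg u n" "has_deg u m" shows "n = m"
proof -
  obtain p q where pq: "continuous_on UNIV p" "\<And>t. u t = exp (p t)" "\<And>t. p (t + 2 * pi) = p t + 2 * pi * of_int n * \<i>"
    "continuous_on UNIV q" "\<And>t. u t = exp (q t)" "\<And>t. q (t + 2 * pi) = q t + 2 * pi * of_int m * \<i>"
    using assms unfolding has_deg_def by metis
  obtain k :: int where k: "\<And>t. p t = q t + 2 * pi * of_int k * \<i>"
    using exp_eq_continuous_const[OF pq(1) pq(4)] pq(2,5) by metis
  have "2 * pi * of_int n * \<i> = 2 * pi * of_int m * \<i>"
    using pq(3)[of 0] pq(6)[of 0] k[of 0] k[of "0 + 2 * pi"] by auto
  then show ?thesis by simp
qed

text \<open>The line is contractible, so a continuous logarithm exists. Its translate by 2 pi is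
  another logarithm of the same loop, and the constant integer between the two is the
  degree.\<close>

lemma has_deg_exists:
  assumes "continuous_on UNIV u" "\<And>t. u t \<noteq> 0" "\<And>t. u (t + 2 * pi) = u t"
  shows "\<exists>n. has_deg u n"
proof -
  obtain q where q: "continuous_on UNIV q" "\<And>t. u t = exp (q t)"
    using continuous_logarithm_on_contractible[OF assms(1) convex_imp_contractible] assms(2)
    by (metis convex_UNIV UNIV_I)
  have "continuous_on UNIV (\<lambda>t. q (t + 2 * pi))"
    by (intro continuous_on_compose2[OF q(1)] continuous_intros) auto
  then obtain k :: int where "\<And>t. q (t + 2 * pi) = q t + 2 * pi * of_int k * \<i>"
    using exp_eq_continuous_const[of "\<lambda>t. q (t + 2 * pi)" q] q assms(3) by metis
  then show ?thesis using q unfolding has_deg_def by blast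
qed

lemma has_deg_mult:
  assumes "has_deg u n" "has_deg v m" shows "has_deg (\<lambda>t. u t * v t) (n + m)"
proof -
  obtain p q where pq: "continuous_on UNIV p" "\<And>t. u t = exp (p t)" "\<And>t. p (t + 2 * pi) = p t + 2 * pi * of_int n * \<i>"
    "continuous_on UNIV q" "\<And>t. v t = exp (q t)" "\<And>t. q (t + 2 * pi) = q t + 2 * pi * of_int m * \<i>"
    using assms unfolding has_deg_def by metis
  show ?thesis unfolding has_deg_def
    by (intro exI[of _ "\<lambda>t. p t + q t"]) (auto simp: pq(2,5) pq(3,6)[unfolded mult.commute[of 2 pi]] exp_add algebra_simps intro!: continuous_intros pq)
qed

lemma has_deg_cnj:
  assumes "has_deg u n" shows "has_deg (\<lambda>t. cnj (u t)) (- n)"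
proof -
  obtain p where p: "continuous_on UNIV p" "\<And>t. u t = exp (p t)" "\<And>t. p (t + 2 * pi) = p t + 2 * pi * of_int n * \<i>"
    using assms unfolding has_deg_def by metis
  show ?thesis unfolding has_deg_def
    by (intro exI[of _ "\<lambda>t. cnj (p t)"]) (auto simp: p(2,3) exp_cnj intro!: continuous_intros p)
qed

lemma has_deg_cis: "has_deg cis 1"
  unfolding has_deg_def
  by (intro exI[of _ "\<lambda>t. \<i> * of_real t"]) (auto simp: cis_conv_exp algebra_simps intro!: continuous_intros)

lemma has_deg_const: "c \<noteq> 0 \<Longrightarrow> has_deg (\<lambda>t. c) 0"
  unfolding has_deg_def by (intro exI[of _ "\<lambda>t. Ln c"]) auto

text \<open>Off the closed negative half-axis the principal logarithm is continuous, and being a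
  function of v alone it is periodic with v.\<close>

lemma has_deg_quotient:
  assumes "continuous_on UNIV v" "\<And>t. v t \<notin> \<real>\<^sub>\<le>\<^sub>0" "\<And>t. v (t + 2 * pi) = v t"
  shows "has_deg v 0"
  unfolding has_deg_def
proof (intro exI[of _ "\<lambda>t. Ln (v t)"] conjI allI)
  show "continuous_on UNIV (\<lambda>t. Ln (v t))" using assms by (intro continuous_intros)
  show "v t = exp (Ln (v t))" for t using assms(2)[of t] by (metis exp_Ln nonpos_Reals_zero_I)
qed (simp add: assms(3))

text \<open>Here v is u times the quotient, which has degree 0. Only the argument of the quotient is
  restricted, not its size, so Rouche's condition and positive factors become special cases.\<close>

lemma has_deg_near:
  assumes u: "has_deg u n" and v: "continuous_on UNIV v" "\<And>t. v (t + 2 * pi) = v t"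
    and near: "\<And>t. v t / u t \<notin> \<real>\<^sub>\<le>\<^sub>0"
  shows "has_deg v n"
proof -
  have "has_deg (\<lambda>t. v t / u t) 0"
    using near has_deg_nonzero[OF u]
    by (intro has_deg_quotient) (auto simp: v has_deg_periodic[OF u] intro!: continuous_intros v(1) has_deg_continuous[OF u])
  from has_deg_mult[OF u this] show ?thesis using has_deg_nonzero[OF u] by simp
qed

lemma has_deg_Rouche:
  assumes u: "has_deg u n" and v: "continuous_on UNIV v" "\<And>t. v (t + 2 * pi) = v t"
    and near: "\<And>t. norm (v t - u t) < norm (u t)"
  shows "has_deg v n"
proof (rule has_deg_near[OF u v])
  fix t
  have u0: "u t \<noteq> 0" using near[of t] by auto
  have "norm (v t / u t - 1) < 1"
    using near[of t] u0 by (simp add: divide_diff_eq_iff norm_divide)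
  then have "Re (v t / u t) > 0" using abs_Re_le_cmod[of "v t / u t - 1"] by auto
  then show "v t / u t \<notin> \<real>\<^sub>\<le>\<^sub>0" by (auto simp: complex_nonpos_Reals_iff)
qed

lemma has_deg_cong: "has_deg u n \<Longrightarrow> (\<And>t. u t = v t) \<Longrightarrow> has_deg v n"
  unfolding has_deg_def by metis

lemma has_deg_scale_pos:
  assumes "has_deg u n" "continuous_on UNIV v" "\<And>t. v (t + 2 * pi) = v t"
    "\<And>t. v t = of_real (c t) * u t" "\<And>t. c t > 0"
  shows "has_deg v n"
  using assms(1-3)
proof (rule has_deg_near)
  fix t
  have "v t / u t = of_real (c t)" using assms(4) has_deg_nonzero[OF assms(1)] by simp
  then show "v t / u t \<notin> \<real>\<^sub>\<le>\<^sub>0" using assms(5)[of t] by simp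
qed


section \<open>Quasiregular maps: energy and strong unique continuation\<close>

definition polar :: "real \<Rightarrow> real \<Rightarrow> complex" where
  "polar r t = of_real r * cis t"

lemma norm_polar [simp]: "norm (polar r t) = \<bar>r\<bar>"
  by (simp add: polar_def norm_mult)

lemma polar_periodic [simp]: "polar r (t + 2 * pi) = polar r t"
  by (simp add: polar_def cis.ctr)

lemma polar_2pi [simp]: "polar r (2 * pi) = polar r 0"
  using polar_periodic[of r 0] by simp

lemma polar_norm_Arg2pi: "z = polar (norm z) (Arg2pi z)"
  using Arg2pi[of z] by (simp add: polar_def cis_conv_exp is_Arg_def)

lemma has_deg_polar: "r > 0 \<Longrightarrow> has_deg (polar r) 1"
  using has_deg_mult[OF has_deg_const has_deg_cis, of "of_real r"] by (simp add: polar_def[abs_def])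

lemma continuous_on_polar [continuous_intros]:
  "continuous_on S u \<Longrightarrow> continuous_on S v \<Longrightarrow> continuous_on S (\<lambda>x. polar (u x) (v x))"
  unfolding polar_def by (intro continuous_intros)

lemma polar_deriv_r: "((\<lambda>r. polar r t) has_vector_derivative cis t) (at r)"
  unfolding polar_def has_vector_derivative_def
  by (auto intro!: derivative_eq_intros simp: scaleR_conv_of_real)

lemma polar_deriv_t: "((\<lambda>t. polar r t) has_vector_derivative of_real r * (\<i> * cis t)) (at t)"
proof -
  have "(cis has_vector_derivative \<i> * cis t) (at t)"
  proof -
    have "((\<lambda>t. Complex (cos t) (sin t)) has_vector_derivative Complex (- sin t) (cos t)) (at t)"
      unfolding Complex_eq has_vector_derivative_def
      by (auto intro!: derivative_eq_intros simp: scaleR_conv_of_real algebra_simps)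
    moreover have "\<i> * cis t = Complex (- sin t) (cos t)" by (simp add: complex_eq_iff)
    ultimately show ?thesis by (simp add: cis.code[abs_def])
  qed
  then show ?thesis unfolding polar_def
    by (rule has_vector_derivative_mult_right)
qed

lemma has_vector_derivative_ImD:
  "(u has_vector_derivative D) (at x) \<Longrightarrow> ((\<lambda>x. Im (u x)) has_real_derivative Im D) (at x)"
  using bounded_linear.has_vector_derivative[OF bounded_linear_Im]
  by (simp add: has_real_derivative_iff_has_vector_derivative)

lemma partials_polar_r:
  assumes "(F has_derivative (\<lambda>h. Re h *\<^sub>R Fx + Im h *\<^sub>R Fy)) (at (polar r t))"
  shows "((\<lambda>r. F (polar r t)) has_vector_derivative (cos t *\<^sub>R Fx + sin t *\<^sub>R Fy)) (at r)"
  using vector_derivative_diff_chain_within[OF polar_deriv_r has_derivative_at_withinI[OF assms]]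
  by (simp add: o_def)

lemma partials_polar_t:
  assumes "(F has_derivative (\<lambda>h. Re h *\<^sub>R Fx + Im h *\<^sub>R Fy)) (at (polar r t))"
  shows "((\<lambda>t. F (polar r t)) has_vector_derivative r *\<^sub>R ((- sin t) *\<^sub>R Fx + cos t *\<^sub>R Fy)) (at t)"
  using vector_derivative_diff_chain_within[OF polar_deriv_t has_derivative_at_withinI[OF assms]]
  by (simp add: o_def scaleR_diff_right)

section \<open>The energy identity for maps of class C^2 on discs\<close>

locale c2_plane =
  fixes f fx fy fxx fxy fyy :: "complex \<Rightarrow> complex" and R0 :: real
  assumes R0: "R0 > 0"
    and Df: "\<And>z. norm z < R0 \<Longrightarrow> (f has_derivative (\<lambda>h. Re h *\<^sub>R fx z + Im h *\<^sub>R fy z)) (at z)"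
    and Dfx: "\<And>z. norm z < R0 \<Longrightarrow> (fx has_derivative (\<lambda>h. Re h *\<^sub>R fxx z + Im h *\<^sub>R fxy z)) (at z)"
    and Dfy: "\<And>z. norm z < R0 \<Longrightarrow> (fy has_derivative (\<lambda>h. Re h *\<^sub>R fxy z + Im h *\<^sub>R fyy z)) (at z)"
    and c2: "continuous_on (ball 0 R0) fxx" "continuous_on (ball 0 R0) fxy" "continuous_on (ball 0 R0) fyy"
begin

definition "g r t = f (polar r t)"
definition "gr r t = cos t *\<^sub>R fx (polar r t) + sin t *\<^sub>R fy (polar r t)"
definition "gt r t = r *\<^sub>R ((- sin t) *\<^sub>R fx (polar r t) + cos t *\<^sub>R fy (polar r t))"
text \<open>The common value of the two mixed derivatives of \<open>g\<close>: of \<open>gt\<close>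
  in r and of \<open>gr\<close> in t.\<close>

definition "grt r t = ((- sin t) *\<^sub>R fx (polar r t) + cos t *\<^sub>R fy (polar r t)) +
   r *\<^sub>R ((- sin t) *\<^sub>R (cos t *\<^sub>R fxx (polar r t) + sin t *\<^sub>R fxy (polar r t)) +
         cos t *\<^sub>R (cos t *\<^sub>R fxy (polar r t) + sin t *\<^sub>R fyy (polar r t)))"
text \<open>The Jacobian determinant of f, with \<open>fx\<close> and \<open>fy\<close> as
  columns.\<close>

definition "J z = Im (cnj (fx z) * fy z)"

lemma cont_f: "continuous_on (ball 0 R0) f" "continuous_on (ball 0 R0) fx" "continuous_on (ball 0 R0) fy"
  by (auto intro!: continuous_at_imp_continuous_on has_derivative_continuous Df Dfx Dfy)

lemma cont_polar:
  assumes "continuous_on (ball 0 R0) F" "continuous_on S u" "continuous_on S v" "\<And>x. x \<in> S \<Longrightarrow> \<bar>u x\<bar> < R0"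
  shows "continuous_on S (\<lambda>x. F (polar (u x) (v x)))"
  using assms by (intro continuous_on_compose2[OF assms(1)] continuous_intros) auto

lemma cont_g:
  fixes u v :: "'b::t2_space \<Rightarrow> real"
  assumes "continuous_on S u" "continuous_on S v" "\<And>x. x \<in> S \<Longrightarrow> \<bar>u x\<bar> < R0"
  shows "continuous_on S (\<lambda>x. g (u x) (v x))" "continuous_on S (\<lambda>x. gr (u x) (v x))"
    "continuous_on S (\<lambda>x. gt (u x) (v x))" "continuous_on S (\<lambda>x. grt (u x) (v x))"
    "continuous_on S (\<lambda>x. J (polar (u x) (v x)))"
proof -
  note c = cont_polar[OF cont_f(1) assms] cont_polar[OF cont_f(2) assms] cont_polar[OF cont_f(3) assms]
    cont_polar[OF c2(1) assms] cont_polar[OF c2(2) assms] cont_polar[OF c2(3) assms]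
  show "continuous_on S (\<lambda>x. g (u x) (v x))" unfolding g_def by (rule c)
  show "continuous_on S (\<lambda>x. gr (u x) (v x))"
    unfolding gr_def by (intro continuous_intros c assms(1,2))
  show "continuous_on S (\<lambda>x. gt (u x) (v x))"
    unfolding gt_def by (intro continuous_intros c assms(1,2))
  show "continuous_on S (\<lambda>x. grt (u x) (v x))"
    unfolding grt_def by (intro continuous_intros c assms(1,2))
  show "continuous_on S (\<lambda>x. J (polar (u x) (v x)))"
    unfolding J_def by (intro continuous_intros c assms(1,2))
qed

lemma g_periodic [simp]: "g r (2 * pi) = g r 0" "gr r (2 * pi) = gr r 0"
  by (simp_all add: g_def gr_def)

lemma deriv_g:
  assumes "\<bar>r\<bar> < R0"
  shows "((\<lambda>r. g r t) has_vector_derivative gr r t) (at r)"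
    "((\<lambda>t. g r t) has_vector_derivative gt r t) (at t)"
    "((\<lambda>r. gt r t) has_vector_derivative grt r t) (at r)"
    "((\<lambda>t. gr r t) has_vector_derivative grt r t) (at t)"
proof -
  have n: "norm (polar r t) < R0" using assms by simp
  show "((\<lambda>r. g r t) has_vector_derivative gr r t) (at r)"
    unfolding g_def gr_def by (rule partials_polar_r[OF Df[OF n]])
  show "((\<lambda>t. g r t) has_vector_derivative gt r t) (at t)"
    unfolding g_def gt_def by (rule partials_polar_t[OF Df[OF n]])
  note x = partials_polar_r[OF Dfx[OF n]] partials_polar_r[OF Dfy[OF n]]
    partials_polar_t[OF Dfx[OF n]] partials_polar_t[OF Dfy[OF n]]
  show "((\<lambda>r. gt r t) has_vector_derivative grt r t) (at r)"
    unfolding gt_def grt_def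
    by (auto intro!: derivative_eq_intros x simp: algebra_simps)
  show "((\<lambda>t. gr r t) has_vector_derivative grt r t) (at t)"
    unfolding gr_def grt_def
    by (auto intro!: derivative_eq_intros x simp: algebra_simps)
qed

text \<open>The directions at angle t arise from the coordinate directions by a rotation, which has
  determinant 1; the factor r is the polar area element.\<close>

lemma Im_gr_gt: "Im (cnj (gr r t) * gt r t) = r * J (polar r t)"
proof -
  have "Im (cnj (c *\<^sub>R a + s *\<^sub>R b) * (r *\<^sub>R ((- s) *\<^sub>R a + c *\<^sub>R b)))
      = (s\<^sup>2 + c\<^sup>2) * (r * Im (cnj a * b))" for s c and a b :: complex
    by (simp add: algebra_simps power2_eq_square)
  from this[of "cos t" _ "sin t"] show ?thesis unfolding gr_def gt_def J_def by (simp only: sin_cos_squared_add mult_1)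
qed

lemma norm_gr_gt: "norm (gt r t)^2 + r\<^sup>2 * norm (gr r t)^2 = r\<^sup>2 * (norm (fx (polar r t))^2 + norm (fy (polar r t))^2)"
proof -
  have "norm (r *\<^sub>R ((- s) *\<^sub>R a + c *\<^sub>R b))^2 + r\<^sup>2 * norm (c *\<^sub>R a + s *\<^sub>R b)^2
      = (s\<^sup>2 + c\<^sup>2) * (r\<^sup>2 * (norm a^2 + norm b^2))" for s c and a b :: complex
    unfolding cmod_power2 by (simp add: algebra_simps power2_eq_square)
  then show ?thesis unfolding gr_def gt_def by simp
qed

text \<open>With s = x^2 + y^2, the form H(s) (x dy - y dx) has exterior derivative 2 (s H'(s) +
  H(s)) dx dy, and \<open>r * J\<close> is the area factor of f in polar coordinates.\<close>

abbreviation "energy_density H H' r t \<equiv>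
  2 * ((norm (g r t))\<^sup>2 * H' ((norm (g r t))\<^sup>2) + H ((norm (g r t))\<^sup>2)) * (r * J (polar r t))"

definition "A H r = integral {0..2*pi} (\<lambda>t. H (norm (g r t)^2) * Im (cnj (g r t) * gt r t))"

text \<open>Stokes' theorem on discs, for the pullback under \<open>f\<close> of the form
  \<open>H (x\<^sup>2 + y\<^sup>2) (x dy - y dx)\<close>.\<close>

lemma energy_identity:
  fixes H H' :: "real \<Rightarrow> real"
  assumes H: "\<And>t. t \<ge> 0 \<Longrightarrow> (H has_real_derivative H' t) (at t)" and H': "continuous_on {0..} H'"
    and r: "\<bar>r\<bar> < R0"
  shows "(A H has_real_derivative integral {0..2*pi} (energy_density H H' r)) (at r)"
proof -
  define n where "n r t = (Re (g r t))^2 + (Im (g r t))^2" for r t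
  have n: "norm (g r t)^2 = n r t" for r t by (simp add: n_def cmod_power2)
  \<comment> \<open>\<open>Q\<close> and \<open>S\<close> are the components along dt and dr of the
    pulled-back form, so \<open>Qr - St\<close> is the coefficient of its exterior
    derivative.\<close>
  define Q where "Q r t = H (n r t) * (Re (g r t) * Im (gt r t) - Im (g r t) * Re (gt r t))" for r t
  define S where "S t = H (n r t) * (Re (g r t) * Im (gr r t) - Im (g r t) * Re (gr r t))" for t
  define Qr where "Qr r t = H' (n r t) * (2 * Re (g r t) * Re (gr r t) + 2 * Im (g r t) * Im (gr r t)) * (Re (g r t) * Im (gt r t) - Im (g r t) * Re (gt r t))
      + H (n r t) * (Re (gr r t) * Im (gt r t) - Im (gr r t) * Re (gt r t) + (Re (g r t) * Im (grt r t) - Im (g r t) * Re (grt r t)))" for r t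
  define St where "St t = H' (n r t) * (2 * Re (g r t) * Re (gt r t) + 2 * Im (g r t) * Im (gt r t)) * (Re (g r t) * Im (gr r t) - Im (g r t) * Re (gr r t))
      + H (n r t) * (Re (gt r t) * Im (gr r t) - Im (gt r t) * Re (gr r t) + (Re (g r t) * Im (grt r t) - Im (g r t) * Re (grt r t)))" for t
  have Hc: "continuous_on {0..} H"
    using H by (meson DERIV_isCont atLeast_iff continuous_at_imp_continuous_on)
  have A: "A H = (\<lambda>r. integral (cbox 0 (2 * pi)) (Q r))"
    unfolding A_def Q_def n by (simp add: cbox_interval)
  have nr: "((\<lambda>r. n r t) has_real_derivative (2 * Re (g r t) * Re (gr r t) + 2 * Im (g r t) * Im (gr r t))) (at r)"
    if "\<bar>r\<bar> < R0" for r t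
    unfolding n_def by (rule derivative_eq_intros deriv_g(1)[OF that] refl)+ simp
  have nt: "((\<lambda>t. n r t) has_real_derivative (2 * Re (g r t) * Re (gt r t) + 2 * Im (g r t) * Im (gt r t))) (at t)" for t
    unfolding n_def by (rule derivative_eq_intros deriv_g(2)[OF r] refl)+ simp
  have n0: "n r t \<ge> 0" for r t by (simp add: n_def)
  have Qd: "((\<lambda>r. Q r t) has_real_derivative Qr r t) (at r)" if "\<bar>r\<bar> < R0" for r t
    unfolding Q_def Qr_def
    by (rule DERIV_chain2[OF H[OF n0] nr[OF that]] derivative_eq_intros deriv_g(1)[OF that] deriv_g(3)[OF that] refl)+
      (simp add: algebra_simps)
  have Sd: "(S has_real_derivative St t) (at t)" for t
    unfolding S_def St_def
    by (rule DERIV_chain2[OF H[OF n0] nt] derivative_eq_intros deriv_g(2)[OF r] deriv_g(4)[OF r] refl)+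
      (simp add: algebra_simps)
  have cQ: "continuous_on T (\<lambda>x. Q (u x) (v x))" "continuous_on T (\<lambda>x. Qr (u x) (v x))"
    if "continuous_on T u" "continuous_on T v" "\<And>x. x \<in> T \<Longrightarrow> \<bar>u x\<bar> < R0" for T and u v :: "'b::t2_space \<Rightarrow> real"
  proof -
    have 1: "continuous_on T (\<lambda>x. n (u x) (v x))"
      unfolding n_def by (intro continuous_intros cont_g that)
    have 2: "continuous_on T (\<lambda>x. H (n (u x) (v x)))" "continuous_on T (\<lambda>x. H' (n (u x) (v x)))"
      by (rule continuous_on_compose2[OF Hc 1], use n0 in auto, rule continuous_on_compose2[OF H' 1], use n0 in auto)
    show "continuous_on T (\<lambda>x. Q (u x) (v x))" "continuous_on T (\<lambda>x. Qr (u x) (v x))"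
      unfolding Q_def Qr_def by (intro continuous_intros cont_g that 2; simp)+
  qed
  have "((\<lambda>r. integral (cbox 0 (2 * pi)) (Q r)) has_field_derivative integral (cbox 0 (2*pi)) (Qr r)) (at r within {-R0<..<R0})"
  proof (rule leibniz_rule_field_derivative)
    show "((\<lambda>x. Q x t) has_field_derivative Qr x t) (at x within {- R0<..<R0})"
      if "x \<in> {-R0<..<R0}" for x t
      using that by (auto intro!: has_field_derivative_at_within[OF Qd])
    show "Q x integrable_on cbox 0 (2 * pi)" if "x \<in> {-R0<..<R0}" for x
      using that by (intro integrable_continuous cQ continuous_intros) auto
    show "continuous_on ({- R0<..<R0} \<times> cbox 0 (2 * pi)) (\<lambda>(x, t). Qr x t)"
      unfolding case_prod_unfold by (intro cQ continuous_intros) auto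
  qed (use r in auto)
  then have AD: "(A H has_real_derivative integral {0..2*pi} (Qr r)) (at r)"
    unfolding A using r by (subst (asm) at_within_open) auto
  have St0: "(St has_integral 0) {0..2*pi}"
  proof -
    have "(St has_integral S (2*pi) - S 0) {0..2*pi}"
      using Sd by (intro fundamental_theorem_of_calculus)
        (auto simp: has_real_derivative_iff_has_vector_derivative[symmetric] intro: DERIV_subset)
    moreover have "S (2 * pi) = S 0" by (simp add: S_def n_def)
    ultimately show ?thesis by simp
  qed
  \<comment> \<open>The terms with the second derivative \<open>grt\<close> cancel in this
    difference, and \<open>St\<close> may be subtracted freely because it integrates to 0 over the
    closed circle.\<close>
  have "Qr r t - St t = 2 * (n r t * H' (n r t) + H (n r t)) * Im (cnj (gr r t) * gt r t)" for t
    unfolding Qr_def St_def by (simp add: n_def algebra_simps power2_eq_square)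
  moreover have "integral {0..2*pi} (\<lambda>t. Qr r t - St t) = integral {0..2*pi} (Qr r)"
  proof -
    have "Qr r integrable_on {0..2*pi}"
      by (intro integrable_continuous_interval cQ continuous_intros) (use r in auto)
    then have "integral {0..2*pi} (\<lambda>t. Qr r t - St t) = integral {0..2*pi} (Qr r) - integral {0..2*pi} St"
      using St0 by (intro integral_diff) auto
    then show ?thesis using St0 by (simp add: integral_unique)
  qed
  ultimately show ?thesis using AD unfolding n Im_gr_gt by simp
qed

lemma A_0 [simp]: "A H 0 = 0"
  by (simp add: A_def gt_def)

end

text \<open>Cauchy-Schwarz against the constant 1, obtained from the nonnegative variance of u about
  its mean m.\<close>

lemma integral_square_le:
  fixes u :: "real \<Rightarrow> real"
  assumes "continuous_on {0..2*pi} u"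
  shows "(integral {0..2*pi} u)\<^sup>2 \<le> 2 * pi * integral {0..2*pi} (\<lambda>t. (u t)\<^sup>2)"
proof -
  define I where "I = integral {0..2*pi} u"
  define m where "m = I / (2 * pi)"
  have i: "u integrable_on {0..2*pi}" "(\<lambda>t. (u t)\<^sup>2) integrable_on {0..2*pi}"
    by (intro integrable_continuous_interval continuous_intros assms)+
  have "0 \<le> integral {0..2*pi} (\<lambda>t. (u t - m)\<^sup>2)"
    by (intro integral_nonneg integrable_continuous_interval continuous_intros assms) auto
  also have "(\<lambda>t. (u t - m)\<^sup>2) = (\<lambda>t. (u t)\<^sup>2 - 2 * m * u t + m\<^sup>2)"
    by (simp add: power2_diff algebra_simps)
  also have "integral {0..2*pi} \<dots> = integral {0..2*pi} (\<lambda>t. (u t)\<^sup>2) - 2 * m * I + 2 * pi * m\<^sup>2"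
  proof -
    have "((\<lambda>t. (u t)\<^sup>2 - 2 * m * u t + m\<^sup>2) has_integral
        (integral {0..2*pi} (\<lambda>t. (u t)\<^sup>2) - 2 * m * I + (2 * pi - 0) *\<^sub>R m\<^sup>2)) {0..2*pi}"
      unfolding I_def by (intro has_integral_add has_integral_diff has_integral_mult_right
          integrable_integral i has_integral_const_real[of "m\<^sup>2" 0 "2*pi", unfolded content_real_if])
         (use has_integral_const_real[of "m\<^sup>2" 0 "2*pi"] in simp)
    then show ?thesis by (simp add: integral_unique)
  qed
  also have "\<dots> = integral {0..2*pi} (\<lambda>t. (u t)\<^sup>2) - I\<^sup>2 / (2 * pi)"
    by (simp add: m_def power2_eq_square field_simps)
  finally show ?thesis by (simp add: I_def field_simps)
qed

text \<open>A continuously differentiable cutoff that vanishes up to the level a; the maximum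
  principle uses it as the weight H.\<close>

lemma deriv_max_square:
  "((\<lambda>t. (max 0 (t - a))\<^sup>2) has_real_derivative 2 * max 0 (t - a)) (at (t::real))"
proof -
  consider "t < a" | "t > a" | "t = a" by linarith
  then show ?thesis
  proof cases
    case 1
    have "((\<lambda>t. 0) has_real_derivative 2 * max 0 (t - a)) (at t)" using 1 by simp
    then show ?thesis
      by (rule DERIV_cong_ev[THEN iffD1, rotated -1])
        (use 1 in \<open>auto intro!: eventually_mono[OF eventually_nhds_in_open[of "{..<a}"]]\<close>)
  next
    case 2
    have "((\<lambda>t. (t - a)\<^sup>2) has_real_derivative 2 * max 0 (t - a)) (at t)" using 2
      by (auto intro!: derivative_eq_intros)
    then show ?thesis
      by (rule DERIV_cong_ev[THEN iffD1, rotated -1])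
        (use 2 in \<open>auto intro!: eventually_mono[OF eventually_nhds_in_open[of "{a<..}"]]\<close>)
  next
    case 3
    have "((\<lambda>h. (max 0 h)\<^sup>2 / h) \<longlongrightarrow> 0) (at (0::real))"
    proof (rule Lim_null_comparison[where g="\<lambda>h. \<bar>h\<bar>"])
      show "\<forall>\<^sub>F h in at 0. norm ((max 0 h)\<^sup>2 / h) \<le> \<bar>h::real\<bar>"
        by (auto simp: max_def power2_eq_square)
    qed (auto intro!: tendsto_eq_intros)
    then show ?thesis using 3 by (simp add: DERIV_def)
  qed
qed

section \<open>Quasiregular maps: monotone energies and the maximum principle\<close>

locale qr_plane = c2_plane +
  fixes K :: real
  assumes K: "K > 0"
    and qr: "\<And>z. norm z < R0 \<Longrightarrow> (norm (fx z))\<^sup>2 + (norm (fy z))\<^sup>2 \<le> K * J z"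
begin

lemma J_nonneg: "norm z < R0 \<Longrightarrow> 0 \<le> J z"
proof -
  assume "norm z < R0"
  then have "0 \<le> K * J z" by (intro order_trans[OF _ qr]) auto
  then show ?thesis using K by (simp add: zero_le_mult_iff)
qed

lemma gt_bound: "\<bar>r\<bar> < R0 \<Longrightarrow> (norm (gt r t))\<^sup>2 \<le> r\<^sup>2 * (K * J (polar r t))"
proof -
  assume "\<bar>r\<bar> < R0"
  then have "r\<^sup>2 * ((norm (fx (polar r t)))\<^sup>2 + (norm (fy (polar r t)))\<^sup>2) \<le> r\<^sup>2 * (K * J (polar r t))"
    by (intro mult_left_mono qr) auto
  moreover have "0 \<le> r\<^sup>2 * (norm (gr r t))\<^sup>2" by simp
  ultimately show ?thesis using norm_gr_gt[of r t] by linarith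
qed

lemma gr_bound: "\<bar>r\<bar> < R0 \<Longrightarrow> r \<noteq> 0 \<Longrightarrow> (norm (gr r t))\<^sup>2 \<le> K * J (polar r t)"
proof -
  assume r: "\<bar>r\<bar> < R0" "r \<noteq> 0"
  then have "r\<^sup>2 * ((norm (fx (polar r t)))\<^sup>2 + (norm (fy (polar r t)))\<^sup>2) \<le> r\<^sup>2 * (K * J (polar r t))"
    by (intro mult_left_mono qr) auto
  moreover have "0 \<le> (norm (gt r t))\<^sup>2" by simp
  ultimately have "r\<^sup>2 * (norm (gr r t))\<^sup>2 \<le> r\<^sup>2 * (K * J (polar r t))" using norm_gr_gt[of r t] by linarith
  then show ?thesis using r by simp
qed

text \<open>The derivative of \<open>A H\<close> is the integral of a nonnegative density: the
  factor \<open>t * H' t + H t\<close> is nonnegative by assumption, and J by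
  quasiregularity.\<close>

lemma A_mono:
  fixes H H' :: "real \<Rightarrow> real"
  assumes H: "\<And>t. t \<ge> 0 \<Longrightarrow> (H has_real_derivative H' t) (at t)" and H': "continuous_on {0..} H'"
    and nn: "\<And>t. t \<ge> 0 \<Longrightarrow> t * H' t + H t \<ge> 0"
    and r: "0 \<le> r" "r \<le> s" "s < R0"
  shows "A H r \<le> A H s"
proof (rule DERIV_nonneg_imp_nondecreasing[OF r(2)])
  fix x assume x: "r \<le> x" "x \<le> s"
  have Hc: "continuous_on {0..} H"
    using H by (meson DERIV_isCont atLeast_iff continuous_at_imp_continuous_on)
  show "\<exists>y. (A H has_real_derivative y) (at x) \<and> 0 \<le> y"
  proof (intro exI conjI)
    show "(A H has_real_derivative integral {0..2*pi} (energy_density H H' x)) (at x)"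
      using x r by (intro energy_identity H H') auto
    have "continuous_on {0..2*pi} (\<lambda>t. H (norm (g x t)^2))" "continuous_on {0..2*pi} (\<lambda>t. H' (norm (g x t)^2))"
      by (rule continuous_on_compose2[OF Hc] continuous_on_compose2[OF H'];
          use x r in \<open>auto intro!: continuous_intros cont_g\<close>)+
    then show "0 \<le> integral {0..2*pi} (energy_density H H' x)"
      using x r by (intro integral_nonneg integrable_continuous_interval continuous_intros cont_g mult_nonneg_nonneg nn J_nonneg) auto
  qed
qed

lemma A_nonneg:
  assumes "\<And>t. t \<ge> 0 \<Longrightarrow> (H has_real_derivative H' t) (at t)" "continuous_on {0..} H'"
    "\<And>t. t \<ge> 0 \<Longrightarrow> t * H' t + H t \<ge> 0" "0 \<le> r" "r < R0"
  shows "0 \<le> A H r"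
  using A_mono[OF assms(1-3) _ assms(4,5)] by simp

text \<open>The weight H vanishes where |f|^2 \<le> \<epsilon>, so \<open>A H\<close> is 0 on the
  circle of radius s, and by monotonicity on all smaller ones. Hence the energy density vanishes
  inside: where |f|^2 > \<epsilon>, the Jacobian is 0, and with it the whole differential. So H of
  |f|^2 is constant along rays and equals its boundary value 0.\<close>

lemma max_principle:
  assumes s: "0 < s" "s < R0" and b: "\<And>t. (norm (g s t))\<^sup>2 \<le> \<epsilon>" and z: "norm z \<le> s"
  shows "(norm (f z))\<^sup>2 \<le> \<epsilon>"
proof -
  define H H' where "H = (\<lambda>t. (max 0 (t - \<epsilon>))\<^sup>2)" and "H' = (\<lambda>t. 2 * max 0 (t - \<epsilon>))"
  have H: "(H has_real_derivative H' t) (at t)" for t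
    unfolding H_def H'_def by (rule deriv_max_square)
  have H': "continuous_on T H'" and Hc: "continuous_on T H" for T
    unfolding H'_def H_def by (intro continuous_intros)+
  have \<epsilon>: "\<epsilon> \<ge> 0" using b[of 0] by (meson order_trans zero_le_power2)
  have nn: "t * H' t + H t \<ge> 0" if "t \<ge> 0" for t using that by (simp add: H_def H'_def)
  have As: "A H s = 0"
  proof -
    have "H ((norm (g s t))\<^sup>2) = 0" for t using b[of t] by (simp add: H_def max_def)
    then show ?thesis by (simp add: A_def)
  qed
  have A0: "A H r = 0" if "0 \<le> r" "r \<le> s" for r
  proof (rule antisym)
    show "A H r \<le> 0" using A_mono[of H H' r s, OF H H' nn] As that s by simp
    show "0 \<le> A H r" using A_nonneg[of H H' r, OF H H' nn] that s by simp
  qed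
  have key: "(norm (g r t))\<^sup>2 \<le> \<epsilon> \<or> J (polar r t) = 0" if r: "0 < r" "r < s" and t: "t \<in> {0..2*pi}" for r t
  proof -
    let ?I = "energy_density H H' r"
    have r0: "\<bar>r\<bar> < R0" using r s by auto
    have "integral {0..2*pi} ?I = 0"
    proof (rule DERIV_local_const[OF energy_identity[of H H' r, OF H H' r0]])
      show "0 < min r (s - r)" using r by simp
      show "\<forall>y. \<bar>r - y\<bar> < min r (s - r) \<longrightarrow> A H r = A H y"
      proof (intro allI impI)
        fix y assume "\<bar>r - y\<bar> < min r (s - r)"
        then have "0 \<le> y" "y \<le> s" using r by (auto simp: abs_less_iff)
        then show "A H r = A H y" using A0 r by simp
      qed
    qed
    moreover have "continuous_on {0..2*pi} ?I"
      using r0 by (intro continuous_intros cont_g continuous_on_compose2[OF H'[of UNIV]] continuous_on_compose2[OF Hc[of UNIV]]) auto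
    moreover have "?I t \<ge> 0" for t
      using r r0 by (intro mult_nonneg_nonneg nn J_nonneg) auto
    ultimately have "?I t = 0" using t integral_eq_0_iff[of 0 "2*pi" ?I] by auto
    then have *: "norm (g r t)^2 * H' (norm (g r t)^2) + H (norm (g r t)^2) = 0 \<or> J (polar r t) = 0"
      using r by auto
    show ?thesis
    proof (rule disjCI, rule ccontr)
      assume 1: "J (polar r t) \<noteq> 0" and 2: "\<not> (norm (g r t))\<^sup>2 \<le> \<epsilon>"
      have "H (norm (g r t)^2) > 0" using 2 by (simp add: H_def)
      moreover have "norm (g r t)^2 * H' (norm (g r t)^2) \<ge> 0" by (simp add: H'_def)
      ultimately show False using * 1 by linarith
    qed
  qed
  obtain r t where rt: "z = polar r t" "0 \<le> r" "r \<le> s" "t \<in> {0..2*pi}"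
    using that[OF polar_norm_Arg2pi] Arg2pi[of z] z by auto
  have n: "(norm (g r t))\<^sup>2 = (Re (g r t))\<^sup>2 + (Im (g r t))\<^sup>2" for r by (simp add: cmod_power2)
  have "H ((norm (g s t))\<^sup>2) = H ((norm (g r t))\<^sup>2)"
  proof (cases "r = s")
    case False
    with rt have "r < s" by simp
    show ?thesis
    proof (rule DERIV_isconst_end[OF \<open>r < s\<close>])
      show "continuous_on {r..s} (\<lambda>r. H ((norm (g r t))\<^sup>2))"
        using rt s by (intro continuous_intros cont_g continuous_on_compose2[OF Hc[of UNIV]]) auto
      fix x assume x: "r < x" "x < s"
      then have x0: "\<bar>x\<bar> < R0" using rt s by auto
      have "((\<lambda>x. (norm (g x t))\<^sup>2) has_real_derivative (2 * Re (g x t) * Re (gr x t) + 2 * Im (g x t) * Im (gr x t))) (at x)"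
        unfolding n by (rule derivative_eq_intros deriv_g(1)[OF x0] refl)+ simp
      from DERIV_chain2[OF H this]
      have D: "((\<lambda>x. H ((norm (g x t))\<^sup>2)) has_real_derivative
        H' ((norm (g x t))\<^sup>2) * (2 * Re (g x t) * Re (gr x t) + 2 * Im (g x t) * Im (gr x t))) (at x)" .
      have "H' ((norm (g x t))\<^sup>2) * (2 * Re (g x t) * Re (gr x t) + 2 * Im (g x t) * Im (gr x t)) = 0"
      proof (cases "(norm (g x t))\<^sup>2 \<le> \<epsilon>")
        case True
        then show ?thesis by (simp add: H'_def)
      next
        case False
        then have "J (polar x t) = 0" using key[of x t] x rt by auto
        then have "gr x t = 0" using gr_bound[OF x0, of t] x rt by simp
        then show ?thesis by simp
      qed
      with D show "((\<lambda>x. H ((norm (g x t))\<^sup>2)) has_real_derivative 0) (at x)" by simp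
    qed
  qed simp
  moreover have "H ((norm (g s t))\<^sup>2) = 0" using b[of t] by (simp add: H_def max_def)
  ultimately have "H ((norm (g r t))\<^sup>2) = 0" by simp
  then show ?thesis unfolding rt(1) g_def[symmetric] by (auto simp: H_def max_def split: if_splits)
qed

end

section \<open>The energy of log log (1 / |f|) and circles free of zeros\<close>

lemma polar_angle: "\<exists>s\<in>{0..2*pi}. \<forall>r. polar r t = polar r s"
proof
  show "Arg2pi (cis t) \<in> {0..2*pi}" using Arg2pi[of "cis t"] by auto
  have "cis t = cis (Arg2pi (cis t))"
    using Arg2pi[of "cis t"] by (simp add: cis_conv_exp is_Arg_def)
  then show "\<forall>r. polar r t = polar r (Arg2pi (cis t))" by (simp add: polar_def)
qed

text \<open>A one-dimensional Sobolev bound: the oscillation is at most the integral of |v'|, which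
  Cauchy-Schwarz bounds by the energy.\<close>

lemma oscillation_bound:
  fixes v v' :: "real \<Rightarrow> real"
  assumes v: "\<And>t. t \<in> {0..2*pi} \<Longrightarrow> (v has_real_derivative v' t) (at t)"
    and c: "continuous_on {0..2*pi} v'"
    and E: "integral {0..2*pi} (\<lambda>t. (v' t)\<^sup>2) \<le> E"
    and st: "s \<in> {0..2*pi}" "t \<in> {0..2*pi}"
  shows "\<bar>v t - v s\<bar> \<le> sqrt (2 * pi * E)"
proof -
  have *: "\<bar>v b - v a\<bar> \<le> sqrt (2 * pi * E)" if ab: "0 \<le> a" "a \<le> b" "b \<le> 2 * pi" for a b
  proof -
    have "(v' has_integral v b - v a) {a..b}"
      using ab v by (intro fundamental_theorem_of_calculus)
        (auto simp: has_real_derivative_iff_has_vector_derivative[symmetric] intro: has_field_derivative_at_within)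
    then have "\<bar>v b - v a\<bar> = norm (integral {a..b} v')" by (simp add: integral_unique)
    also have "\<dots> \<le> integral {a..b} (\<lambda>t. \<bar>v' t\<bar>)"
      using ab by (intro integral_norm_bound_integral integrable_continuous_interval continuous_intros
          continuous_on_subset[OF c]) auto
    also have "\<dots> \<le> integral {0..2*pi} (\<lambda>t. \<bar>v' t\<bar>)"
      using ab by (intro integral_subset_le integrable_continuous_interval continuous_intros
          continuous_on_subset[OF c]) auto
    also have "\<dots> \<le> sqrt (2 * pi * integral {0..2*pi} (\<lambda>t. (\<bar>v' t\<bar>)\<^sup>2))"
      by (intro real_le_rsqrt integral_square_le continuous_intros c)
    also have "\<dots> \<le> sqrt (2 * pi * E)" using E by simp
    finally show ?thesis .
  qed
  show ?thesis
    using *[of s t] *[of t s] st by (cases s t rule: le_cases) (auto simp: abs_minus_commute)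
qed

text \<open>With t = |f|^2 this behaves like log (1 / |f|^2), regularised at the zeros by \<delta>.
  The leading 1 keeps it at least 1, so that its reciprocal and its logarithm cause no trouble; this
  second logarithm is applied only in \<open>zero_free_circle\<close>.\<close>

definition loglog :: "real \<Rightarrow> real \<Rightarrow> real" where
  "loglog \<delta> t = 1 + ln (1 + 1 / (t + \<delta>))"

text \<open>The weight H for the energy identity, chosen so that \<open>t * H' t + H t\<close>
  dominates 1 / ((t + \<delta>) loglog^2), the weight in the squared gradient of the logarithm of
  \<open>loglog\<close>.\<close>

definition loglog_H :: "real \<Rightarrow> real \<Rightarrow> real" where
  "loglog_H \<delta> t = 1 / ((t + \<delta>) * loglog \<delta> t)"

definition loglog_H' :: "real \<Rightarrow> real \<Rightarrow> real" where
  "loglog_H' \<delta> t = 1 / ((t + \<delta>)\<^sup>2 * (t + \<delta> + 1) * (loglog \<delta> t)\<^sup>2) - 1 / ((t + \<delta>)\<^sup>2 * loglog \<delta> t)"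

context
  fixes \<delta> t :: real
  assumes \<delta>: "\<delta> > 0" and t: "t \<ge> 0"
begin

lemma loglog_ge_1: "loglog \<delta> t \<ge> 1"
  using t \<delta> by (auto simp: loglog_def intro!: ln_ge_zero)

lemma loglog_deriv: "(loglog \<delta> has_real_derivative - (1 / ((t + \<delta>) * (t + \<delta> + 1)))) (at t)"
proof -
  have p: "t + \<delta> > 0" "1 + 1 / (t + \<delta>) > 0" using t \<delta> by (auto intro: add_pos_pos)
  have "(loglog \<delta> has_real_derivative (- (1 / (t + \<delta>)\<^sup>2) / (1 + 1 / (t + \<delta>)))) (at t)"
    unfolding loglog_def using p by (auto intro!: derivative_eq_intros simp: power2_eq_square)
  also have "- (1 / (t + \<delta>)\<^sup>2) / (1 + 1 / (t + \<delta>)) = - (1 / ((t + \<delta>) * (t + \<delta> + 1)))"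
    using p by (simp add: divide_simps power2_eq_square)
  finally show ?thesis .
qed

lemma loglog_H_deriv: "(loglog_H \<delta> has_real_derivative loglog_H' \<delta> t) (at t)"
proof -
  have p: "t + \<delta> > 0" "t + \<delta> + 1 > 0" "loglog \<delta> t > 0" using t \<delta> loglog_ge_1 by auto
  have "((\<lambda>t. (t + \<delta>) * loglog \<delta> t) has_real_derivative
      (loglog \<delta> t - 1 / (t + \<delta> + 1))) (at t)"
    using p by (auto intro!: derivative_eq_intros loglog_deriv simp: divide_simps)
  then have "(loglog_H \<delta> has_real_derivative - ((loglog \<delta> t - 1 / (t + \<delta> + 1)) / ((t + \<delta>) * loglog \<delta> t)\<^sup>2)) (at t)"
    unfolding loglog_H_def using p DERIV_inverse_fun[of "\<lambda>t. (t + \<delta>) * loglog \<delta> t"]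
    by (simp add: inverse_eq_divide power2_eq_square)
  also have "- ((loglog \<delta> t - 1 / (t + \<delta> + 1)) / ((t + \<delta>) * loglog \<delta> t)\<^sup>2) = loglog_H' \<delta> t"
  proof -
    have "- ((l - 1 / b) / (a * l)\<^sup>2) = 1 / (a\<^sup>2 * b * l\<^sup>2) - 1 / (a\<^sup>2 * l)"
      if "a > 0" "b > 0" "l > 0" for a b l :: real
      using that by (simp add: field_simps power2_eq_square)
    from this[OF p] show ?thesis unfolding loglog_H'_def .
  qed
  finally show ?thesis .
qed

text \<open>C is any bound for \<open>t + \<delta> + 1\<close>, so the estimate is uniform in
  \<delta> < 1 when f is bounded. Both sides split into a term with \<delta> and a term with t; the
  terms with \<delta> compare because \<open>(t + \<delta> + 1) * loglog \<delta> t\<close> is at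
  least 1.\<close>

lemma loglog_energy:
  assumes "t + \<delta> + 1 \<le> C"
  shows "1 / ((t + \<delta>) * (loglog \<delta> t)\<^sup>2) \<le> C * (t * loglog_H' \<delta> t + loglog_H \<delta> t)"
    and loglog_energy_nonneg: "0 \<le> t * loglog_H' \<delta> t + loglog_H \<delta> t"
proof -
  have p: "t + \<delta> > 0" "t + \<delta> + 1 > 0" "loglog \<delta> t > 0" using t \<delta> loglog_ge_1 by auto
  have eq: "t * loglog_H' \<delta> t + loglog_H \<delta> t =
      \<delta> / ((t + \<delta>)\<^sup>2 * loglog \<delta> t) + t / ((t + \<delta>)\<^sup>2 * (t + \<delta> + 1) * (loglog \<delta> t)\<^sup>2)"
  proof -
    have "t * (1 / (a\<^sup>2 * b * l\<^sup>2) - 1 / (a\<^sup>2 * l)) + 1 / (a * l) = (a - t) / (a\<^sup>2 * l) + t / (a\<^sup>2 * b * l\<^sup>2)"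
      if "a > 0" "b > 0" "l > 0" for a b l :: real
      using that by (simp add: field_simps power2_eq_square)
    from this[OF p] show ?thesis unfolding loglog_H'_def loglog_H_def by simp
  qed
  then show nn: "0 \<le> t * loglog_H' \<delta> t + loglog_H \<delta> t"
    using p t \<delta> by simp
  have "1 / ((t + \<delta>) * (loglog \<delta> t)\<^sup>2) = (t + \<delta> + 1) *
      (\<delta> / ((t + \<delta>)\<^sup>2 * (t + \<delta> + 1) * (loglog \<delta> t)\<^sup>2) + t / ((t + \<delta>)\<^sup>2 * (t + \<delta> + 1) * (loglog \<delta> t)\<^sup>2))"
  proof -
    have "1 / (a * l\<^sup>2) = b * (d / (a\<^sup>2 * b * l\<^sup>2) + t / (a\<^sup>2 * b * l\<^sup>2))"
      if "a > 0" "b > 0" "l > 0" "a = d + t" for a b d l :: real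
    proof -
      have "b * (d / (a\<^sup>2 * b * l\<^sup>2) + t / (a\<^sup>2 * b * l\<^sup>2)) = b * (a / (a\<^sup>2 * b * l\<^sup>2))"
        by (simp add: that(4) add_divide_distrib)
      also have "\<dots> = 1 / (a * l\<^sup>2)" using that(1-3) by (simp add: power2_eq_square)
      finally show ?thesis by simp
    qed
    from this[OF p, of \<delta>] show ?thesis by simp
  qed
  also have "\<dots> \<le> (t + \<delta> + 1) * (t * loglog_H' \<delta> t + loglog_H \<delta> t)"
  proof (intro mult_left_mono)
    have "(t + \<delta>)\<^sup>2 * loglog \<delta> t * 1 \<le> (t + \<delta>)\<^sup>2 * loglog \<delta> t * ((t + \<delta> + 1) * loglog \<delta> t)"
      using p t \<delta> loglog_ge_1 mult_mono[of 1 "t + \<delta> + 1" 1 "loglog \<delta> t"] by (intro mult_left_mono) auto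
    then have "\<delta> / ((t + \<delta>)\<^sup>2 * (t + \<delta> + 1) * (loglog \<delta> t)\<^sup>2) \<le> \<delta> / ((t + \<delta>)\<^sup>2 * loglog \<delta> t)"
      using p \<delta> by (intro divide_left_mono) (auto simp: power2_eq_square mult_ac)
    then show "\<delta> / ((t + \<delta>)\<^sup>2 * (t + \<delta> + 1) * (loglog \<delta> t)\<^sup>2) + t / ((t + \<delta>)\<^sup>2 * (t + \<delta> + 1) * (loglog \<delta> t)\<^sup>2)
      \<le> t * loglog_H' \<delta> t + loglog_H \<delta> t" unfolding eq by simp
  qed (use p in auto)
  also have "\<dots> \<le> C * (t * loglog_H' \<delta> t + loglog_H \<delta> t)"
    using assms nn by (intro mult_right_mono)
  finally show "1 / ((t + \<delta>) * (loglog \<delta> t)\<^sup>2) \<le> C * (t * loglog_H' \<delta> t + loglog_H \<delta> t)" .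
qed

text \<open>The left side is \<open>t * (loglog_H \<delta> t)\<^sup>2\<close>, the weight that
  Cauchy-Schwarz leaves in the Riccati inequality. The same comparison serves for the derivative of
  the second logarithm.\<close>

lemma loglog_square_le: "t / ((t + \<delta>) * loglog \<delta> t)\<^sup>2 \<le> 1 / ((t + \<delta>) * (loglog \<delta> t)\<^sup>2)"
proof -
  have p: "t + \<delta> > 0" "loglog \<delta> t > 0" using t \<delta> loglog_ge_1 by auto
  have "t / ((t + \<delta>) * loglog \<delta> t)\<^sup>2 \<le> (t + \<delta>) / ((t + \<delta>) * loglog \<delta> t)\<^sup>2"
    using \<delta> by (intro divide_right_mono) auto
  also have "\<dots> = 1 / ((t + \<delta>) * (loglog \<delta> t)\<^sup>2)" using p by (simp add: power2_eq_square)
  finally show ?thesis .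
qed

end

lemma loglog_continuous:
  assumes "\<delta> > 0"
  shows "continuous_on {0..} (loglog \<delta>)" "continuous_on {0..} (loglog_H \<delta>)" "continuous_on {0..} (loglog_H' \<delta>)"
    "continuous_on {0..} (\<lambda>t. 1 / ((t + \<delta>) * (loglog \<delta> t)\<^sup>2))"
proof -
  have nz: "t + \<delta> \<noteq> 0" "t + \<delta> + 1 \<noteq> 0" "loglog \<delta> t \<noteq> 0" if "t \<ge> 0" for t
    using that assms loglog_ge_1[OF assms that] by auto
  show 1: "continuous_on {0..} (loglog \<delta>)" "continuous_on {0..} (loglog_H \<delta>)"
    using loglog_deriv[OF assms] loglog_H_deriv[OF assms]
    by (meson DERIV_isCont atLeast_iff continuous_at_imp_continuous_on)+
  show "continuous_on {0..} (loglog_H' \<delta>)"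
    unfolding loglog_H'_def by (intro continuous_intros 1) (use nz in auto)
  show "continuous_on {0..} (\<lambda>t. 1 / ((t + \<delta>) * (loglog \<delta> t)\<^sup>2))"
    by (intro continuous_intros 1) (use nz in auto)
qed

context qr_plane
begin

lemma n_deriv_t: "\<bar>r\<bar> < R0 \<Longrightarrow> ((\<lambda>t. (norm (g r t))\<^sup>2) has_real_derivative 2 * Re (cnj (g r t) * gt r t)) (at t)"
  unfolding cmod_power2 by (rule derivative_eq_intros deriv_g(2) refl | assumption)+ (simp add: algebra_simps)

lemma n_deriv_r: "\<bar>r\<bar> < R0 \<Longrightarrow> ((\<lambda>r. (norm (g r t))\<^sup>2) has_real_derivative 2 * Re (cnj (g r t) * gr r t)) (at r)"
  unfolding cmod_power2 by (rule derivative_eq_intros deriv_g(1) refl | assumption)+ (simp add: algebra_simps)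

text \<open>The energy of \<open>log log (1 / |f|)\<close> over the disc of radius \<open>r1\<close> is bounded independently of the
  regularisation \<open>\<delta>\<close>, because the primitive \<open>A\<close> satisfies the Riccati inequality
  \<open>A\<^sup>2 \<le> C A'\<close>. Hence on some circle the oscillation of \<open>log log (1 / |f|)\<close> is bounded; a zero on it
  makes \<open>f\<close> uniformly small there as \<open>\<delta> \<rightarrow> 0\<close>.\<close>

lemma zero_free_circle:
  assumes r1: "0 < r1" "r1 < R0" and z: "norm z \<le> r1 / 2" "f z \<noteq> 0"
  shows "\<exists>\<xi>. r1 / 2 < \<xi> \<and> \<xi> < r1 \<and> (\<forall>t. g \<xi> t \<noteq> 0)"
proof (rule ccontr)
  assume contra: "\<not> ?thesis"
  \<comment> \<open>Beyond r1 there has to be an annulus in which the Riccati inequality can act;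
    its width enters the bound.\<close>
  define r2 where "r2 = (r1 + R0) / 2"
  have r2: "r1 < r2" "r2 < R0" using r1 by (auto simp: r2_def)
  obtain M where M: "\<And>z. norm z \<le> r2 \<Longrightarrow> norm (f z) \<le> M"
  proof -
    have "compact (f ` cball 0 r2)"
      using r2 by (intro compact_continuous_image continuous_on_subset[OF cont_f(1)]) auto
    then show ?thesis using that compact_imp_bounded bounded_iff by (metis image_eqI mem_cball_0)
  qed
  \<comment> \<open>Bounds |f|^2 + \<delta> + 1 on the larger disc for every \<delta> < 1.\<close>
  define C0 where "C0 = M\<^sup>2 + 2"
  have C0: "C0 > 0" using zero_le_power2[of M] unfolding C0_def by linarith
  define C where "C = pi * K * C0 * R0"
  have C: "C > 0" using K C0 R0 by (simp add: C_def)
  \<comment> \<open>\<open>C2\<close> will bound the weighted angular energy on the chosen circle,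
    and V the oscillation of the second logarithm there. Neither depends on \<epsilon> or
    \<delta>.\<close>
  define C2 where "C2 = C0 * K * R0 * (C / (r2 - r1)) / r1"
  define V where "V = sqrt (2 * pi * (4 * C2))"
  have small: "(norm (f z))\<^sup>2 \<le> \<epsilon>" if \<epsilon>: "\<epsilon> > 0" for \<epsilon>
  proof -
    \<comment> \<open>At a zero, \<open>loglog\<close> is at least 1 + X. If its logarithm
      oscillates by at most V, it stays above exp (- V) times this on the whole circle, and X is
      chosen to make that exceed 1 + ln (1 + 1 / \<epsilon>).\<close>
    define X where "X = exp V * (1 + ln (1 + 1 / \<epsilon>))"
    have X: "X > 0" using \<epsilon> unfolding X_def by (intro mult_pos_pos add_pos_nonneg ln_ge_zero) auto
    define \<delta> where "\<delta> = 1 / exp X"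
    have \<delta>: "\<delta> > 0" "\<delta> < 1" using X by (auto simp: \<delta>_def)
    define n where "n r t = (norm (g r t))\<^sup>2" for r t
    have n0: "n r t \<ge> 0" for r t by (simp add: n_def)
    have nM: "n r t + \<delta> + 1 \<le> C0" if "0 \<le> r" "r \<le> r2" for r t
    proof -
      have "norm (g r t) \<le> M" using M[of "polar r t"] that by (simp add: g_def)
      then have "n r t \<le> M\<^sup>2" by (simp add: n_def power_mono)
      then show ?thesis using \<delta> by (simp add: C0_def)
    qed
    define w where "w t = 1 / ((t + \<delta>) * (loglog \<delta> t)\<^sup>2)" for t
    have w0: "w t \<ge> 0" if "t \<ge> 0" for t using that \<delta> by (simp add: w_def)
    have cn: "continuous_on {0..2*pi} (n r)" if "0 \<le> r" "r < R0" for r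
      unfolding n_def using that by (intro continuous_intros cont_g) auto
    have ct: "continuous_on {0..2*pi} (\<lambda>t. F (n r t))"
      if "0 \<le> r" "r < R0" "continuous_on {0..} F" for F :: "real \<Rightarrow> real" and r
      by (rule continuous_on_compose2[OF that(3) cn[OF that(1,2)]]) (auto simp: n0)
    note wc = loglog_continuous(4)[OF \<delta>(1), folded w_def]
    let ?I = "\<lambda>r t. 2 * (n r t * loglog_H' \<delta> (n r t) + loglog_H \<delta> (n r t)) * (r * J (polar r t))"
    define D where "D r = integral {0..2*pi} (?I r)" for r
    define e where "e r = integral {0..2*pi} (\<lambda>t. w (n r t) * (norm (gt r t))\<^sup>2)" for r
    let ?A = "A (loglog_H \<delta>)"
    have AD: "(?A has_real_derivative D r) (at r)" if "0 \<le> r" "r < R0" for r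
      unfolding D_def n_def using that
      by (intro energy_identity loglog_H_deriv loglog_continuous \<delta>) auto
    have eD: "e r \<le> r * K * C0 / 2 * D r" if r: "0 \<le> r" "r \<le> r2" for r
    proof -
      have "e r \<le> integral {0..2*pi} (\<lambda>t. r * K * C0 / 2 * ?I r t)"
        unfolding e_def
      proof (rule integral_le)
        show "(\<lambda>t. w (n r t) * (norm (gt r t))\<^sup>2) integrable_on {0..2*pi}"
          using r r2 by (intro integrable_continuous_interval continuous_intros cont_g ct wc) auto
        show "(\<lambda>t. r * K * C0 / 2 * ?I r t) integrable_on {0..2*pi}"
          using r r2 by (intro integrable_continuous_interval continuous_intros cont_g ct cn loglog_continuous \<delta>) auto
        fix t
        have "w (n r t) * (norm (gt r t))\<^sup>2 \<le> w (n r t) * (r\<^sup>2 * (K * J (polar r t)))"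
          using r r2 by (intro mult_left_mono gt_bound w0 n0) auto
        also have "\<dots> \<le> (C0 * (n r t * loglog_H' \<delta> (n r t) + loglog_H \<delta> (n r t))) * (r\<^sup>2 * (K * J (polar r t)))"
          using r r2 K unfolding w_def
          by (intro mult_right_mono loglog_energy \<delta> n0 nM mult_nonneg_nonneg J_nonneg) auto
        also have "\<dots> = r * K * C0 / 2 * ?I r t"
          by (simp add: power2_eq_square)
        finally show "w (n r t) * (norm (gt r t))\<^sup>2 \<le> r * K * C0 / 2 * ?I r t" .
      qed
      then show ?thesis by (simp add: D_def)
    qed
    have e0: "e r \<ge> 0" if "0 \<le> r" "r < R0" for r
      unfolding e_def using that
      by (intro integral_nonneg integrable_continuous_interval continuous_intros cont_g ct wc mult_nonneg_nonneg w0 n0) auto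
    have D0: "D r \<ge> 0" if "0 < r" "r \<le> r2" for r
    proof -
      have "0 \<le> r * K * C0 / 2 * D r" using e0[of r] eD[of r] that r2 by auto
      moreover have "0 < r * K * C0 / 2" using that K C0 by simp
      ultimately show ?thesis by (metis zero_le_mult_iff not_less)
    qed
    \<comment> \<open>By Cauchy-Schwarz on the circle, the square of \<open>A\<close> is at most 2
      pi times the weighted angular energy e, which in turn is at most a multiple of the derivative
      D of \<open>A\<close>.\<close>
    have Riccati: "(?A r)\<^sup>2 \<le> C * D r" if r: "0 < r" "r \<le> r2" for r
    proof -
      define u where "u t = loglog_H \<delta> (n r t) * Im (cnj (g r t) * gt r t)" for t
      have uc: "continuous_on {0..2*pi} u"
        unfolding u_def using r r2 by (intro continuous_intros cont_g ct loglog_continuous \<delta>) auto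
      have "(?A r)\<^sup>2 = (integral {0..2*pi} u)\<^sup>2" unfolding A_def u_def n_def ..
      also have "\<dots> \<le> 2 * pi * integral {0..2*pi} (\<lambda>t. (u t)\<^sup>2)" by (rule integral_square_le[OF uc])
      also have "\<dots> \<le> 2 * pi * e r"
        unfolding e_def
      proof (intro mult_left_mono integral_le)
        show "(\<lambda>t. (u t)\<^sup>2) integrable_on {0..2*pi}"
          by (intro integrable_continuous_interval continuous_intros uc)
        show "(\<lambda>t. w (n r t) * (norm (gt r t))\<^sup>2) integrable_on {0..2*pi}"
          using r r2 by (intro integrable_continuous_interval continuous_intros cont_g ct wc) auto
        fix t
        have "(Im (cnj (g r t) * gt r t))\<^sup>2 \<le> (norm (cnj (g r t) * gt r t))\<^sup>2"
          using abs_Im_le_cmod by (metis abs_norm_cancel power2_le_iff_abs_le abs_le_square_iff)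
        also have "\<dots> = n r t * (norm (gt r t))\<^sup>2" by (simp add: norm_mult n_def power_mult_distrib)
        finally have "(u t)\<^sup>2 \<le> (loglog_H \<delta> (n r t))\<^sup>2 * (n r t * (norm (gt r t))\<^sup>2)"
          unfolding u_def power_mult_distrib by (intro mult_left_mono) auto
        also have "\<dots> = n r t / ((n r t + \<delta>) * loglog \<delta> (n r t))\<^sup>2 * (norm (gt r t))\<^sup>2"
          by (simp add: loglog_H_def power_divide)
        also have "\<dots> \<le> w (n r t) * (norm (gt r t))\<^sup>2"
          unfolding w_def by (intro mult_right_mono loglog_square_le \<delta> n0) auto
        finally show "(u t)\<^sup>2 \<le> w (n r t) * (norm (gt r t))\<^sup>2" .
      qed auto
      also have "\<dots> \<le> 2 * pi * (r * K * C0 / 2 * D r)" using eD r by (intro mult_left_mono) auto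
      also have "\<dots> = r * (pi * K * C0 * D r)" by simp
      also have "\<dots> \<le> R0 * (pi * K * C0 * D r)"
        using r r2 K C0 D0[OF r] by (intro mult_right_mono mult_nonneg_nonneg) auto
      finally show ?thesis by (simp add: C_def mult_ac)
    qed
    have mono: "?A r \<le> ?A s" if "0 < r" "r \<le> s" "s \<le> r2" for r s
    proof (rule DERIV_nonneg_imp_nondecreasing[OF that(2)])
      fix x assume "r \<le> x" "x \<le> s"
      then show "\<exists>y. (?A has_real_derivative y) (at x) \<and> 0 \<le> y"
        using that r2 by (intro exI[of _ "D x"] conjI AD D0) auto
    qed
    have A0: "?A 0 \<le> ?A s" if "0 \<le> s" "s \<le> r2" for s
    proof (rule DERIV_nonneg_imp_nondecreasing[OF that(1)])
      fix x assume x: "0 \<le> x" "x \<le> s"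
      have "D 0 = 0" by (simp add: D_def)
      then have "0 \<le> D x" using D0[of x] that x by (cases "x = 0") auto
      then show "\<exists>y. (?A has_real_derivative y) (at x) \<and> 0 \<le> y"
        using that x r2 by (intro exI[of _ "D x"] conjI AD) auto
    qed
    \<comment> \<open>If \<open>A\<close> is positive at r1, then - 1 / A has derivative at least 1
      / C throughout the annulus. As it stays negative up to r2, the value 1 / A at r1 is at least
      (r2 - r1) / C.\<close>
    have Ar1: "?A r1 \<le> C / (r2 - r1)"
    proof (cases "?A r1 > 0")
      case True
      have pos: "?A r > 0" if "r1 \<le> r" "r \<le> r2" for r using mono[of r1 r] that r1 True by auto
      have "((\<lambda>r. - inverse (?A r)) has_real_derivative D r / (?A r)\<^sup>2) (at r)" if "r1 \<le> r" "r \<le> r2" for r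
        using pos[OF that] that r1 r2
        by (auto intro!: derivative_eq_intros AD simp: divide_inverse power2_eq_square)
      from MVT2[OF r2(1) this] obtain x where x: "r1 < x" "x < r2"
        and eq: "- inverse (?A r2) + inverse (?A r1) = (r2 - r1) * (D x / (?A x)\<^sup>2)" by auto
      have "1 / C \<le> D x / (?A x)\<^sup>2"
        using Riccati[of x] x r1 C pos[of x] by (simp add: field_simps)
      then have "(r2 - r1) * (1 / C) \<le> (r2 - r1) * (D x / (?A x)\<^sup>2)" using r2 by (intro mult_left_mono) auto
      also have "\<dots> \<le> inverse (?A r1)" unfolding eq[symmetric] using pos[of r2] r2 by simp
      finally show ?thesis using True C r2 by (simp add: field_simps)
    next
      case False
      moreover have "0 \<le> C / (r2 - r1)" using C r2 by simp
      ultimately show ?thesis by linarith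
    qed
    \<comment> \<open>The mean value theorem picks a circle on which the derivative of
      \<open>A\<close> equals its average, and this is bounded independently of \<delta>.\<close>
    have "r1 / 2 < r1" using r1 by simp
    from MVT2[OF this AD] obtain \<xi> where \<xi>: "r1 / 2 < \<xi>" "\<xi> < r1"
      and eq: "?A r1 - ?A (r1 / 2) = (r1 - r1 / 2) * D \<xi>" using r1 by auto
    have "0 \<le> ?A (r1 / 2)" using A0[of "r1/2"] r1 r2 by simp
    moreover have "r1 / 2 * D \<xi> = ?A r1 - ?A (r1 / 2)" using eq by simp
    ultimately have "r1 / 2 * D \<xi> \<le> C / (r2 - r1)" using Ar1 by linarith
    moreover have "r1 / 2 * D \<xi> = (D \<xi> * r1) / 2" by simp
    ultimately have "D \<xi> * r1 \<le> 2 * (C / (r2 - r1))" by linarith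
    then have D\<xi>: "D \<xi> \<le> 2 * (C / (r2 - r1)) / r1" using r1 by (simp only: pos_le_divide_eq)
    have "e \<xi> \<le> \<xi> * (K * C0 / 2 * D \<xi>)" using eD[of \<xi>] \<xi> r1 r2 by (simp add: mult_ac)
    also have "\<dots> \<le> R0 * (K * C0 / 2 * D \<xi>)"
      using \<xi> r1 r2 K C0 D0[of \<xi>] by (intro mult_right_mono mult_nonneg_nonneg) auto
    also have "\<dots> \<le> R0 * (K * C0 / 2 * (2 * (C / (r2 - r1)) / r1))"
      using K C0 R0 D\<xi> by (intro mult_left_mono) auto
    also have "\<dots> = C2" by (simp add: C2_def)
    finally have eC2: "e \<xi> \<le> C2" .
    have \<xi>R: "0 \<le> \<xi>" "\<xi> < R0" "\<bar>\<xi>\<bar> < R0" using \<xi> r1 by auto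
    define v v' where "v t = ln (loglog \<delta> (n \<xi> t))"
      and "v' t = - (1 / ((n \<xi> t + \<delta>) * (n \<xi> t + \<delta> + 1))) * (2 * Re (cnj (g \<xi> t) * gt \<xi> t)) / loglog \<delta> (n \<xi> t)" for t
    have nz: "n \<xi> t + \<delta> > 0" "loglog \<delta> (n \<xi> t) > 0" for t
      using n0[of \<xi> t] \<delta> loglog_ge_1[OF \<delta>(1) n0] by (auto intro: less_le_trans[of 0 1])
    have vd: "(v has_real_derivative v' t) (at t)" for t
    proof -
      have "((\<lambda>t. loglog \<delta> (n \<xi> t)) has_real_derivative - (1 / ((n \<xi> t + \<delta>) * (n \<xi> t + \<delta> + 1))) * (2 * Re (cnj (g \<xi> t) * gt \<xi> t))) (at t)"
        unfolding n_def by (rule DERIV_chain2[OF loglog_deriv[OF \<delta>(1)] n_deriv_t[OF \<xi>R(3)]]) simp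
      from DERIV_chain2[OF DERIV_ln_divide[OF nz(2)] this] show ?thesis
        unfolding v_def v'_def by (simp add: mult.commute del: times_complex.sel)
    qed
    have v'c: "continuous_on {0..2*pi} v'"
    proof -
      have "loglog \<delta> (n \<xi> t) \<noteq> 0" "(n \<xi> t + \<delta>) * (n \<xi> t + \<delta> + 1) \<noteq> 0" for t
        using nz[of t] by auto
      then show ?thesis unfolding v'_def
        by (intro continuous_intros cn ct cont_g \<xi>R loglog_continuous \<delta> ballI) (use \<xi>R in auto)
    qed
    have v'E: "integral {0..2*pi} (\<lambda>t. (v' t)\<^sup>2) \<le> 4 * C2"
    proof -
      have "integral {0..2*pi} (\<lambda>t. (v' t)\<^sup>2) \<le> integral {0..2*pi} (\<lambda>t. 4 * (w (n \<xi> t) * (norm (gt \<xi> t))\<^sup>2))"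
      proof (rule integral_le)
        show "(\<lambda>t. (v' t)\<^sup>2) integrable_on {0..2*pi}"
          by (intro integrable_continuous_interval continuous_intros v'c)
        show "(\<lambda>t. 4 * (w (n \<xi> t) * (norm (gt \<xi> t))\<^sup>2)) integrable_on {0..2*pi}"
          by (intro integrable_continuous_interval continuous_intros cont_g ct wc) (use \<xi>R in auto)
        fix t
        have "\<bar>Re (cnj (g \<xi> t) * gt \<xi> t)\<bar> \<le> norm (g \<xi> t) * norm (gt \<xi> t)"
          using abs_Re_le_cmod[of "cnj (g \<xi> t) * gt \<xi> t"] by (simp add: norm_mult)
        then have 1: "(Re (cnj (g \<xi> t) * gt \<xi> t))\<^sup>2 \<le> n \<xi> t * (norm (gt \<xi> t))\<^sup>2"
          unfolding n_def power_mult_distrib[symmetric] by (simp add: abs_le_square_iff[symmetric])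
        have "(v' t)\<^sup>2 = 4 * (Re (cnj (g \<xi> t) * gt \<xi> t))\<^sup>2 / ((n \<xi> t + \<delta>) * (n \<xi> t + \<delta> + 1) * loglog \<delta> (n \<xi> t))\<^sup>2"
          unfolding v'_def by (simp add: power_mult_distrib power_divide del: times_complex.sel)
        also have "\<dots> \<le> 4 * (n \<xi> t * (norm (gt \<xi> t))\<^sup>2) / ((n \<xi> t + \<delta>) * (n \<xi> t + \<delta> + 1) * loglog \<delta> (n \<xi> t))\<^sup>2"
          using 1 by (intro divide_right_mono) auto
        also have "\<dots> \<le> 4 * (n \<xi> t * (norm (gt \<xi> t))\<^sup>2) / ((n \<xi> t + \<delta>) * loglog \<delta> (n \<xi> t))\<^sup>2"
        proof (intro divide_left_mono power_mono)
          have "(n \<xi> t + \<delta>) * loglog \<delta> (n \<xi> t) * 1 \<le> (n \<xi> t + \<delta>) * loglog \<delta> (n \<xi> t) * (n \<xi> t + \<delta> + 1)"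
            using nz[of t] by (intro mult_left_mono) auto
          then show "(n \<xi> t + \<delta>) * loglog \<delta> (n \<xi> t) \<le> (n \<xi> t + \<delta>) * (n \<xi> t + \<delta> + 1) * loglog \<delta> (n \<xi> t)"
            by (simp add: mult_ac)
          have "n \<xi> t + \<delta> + 1 > 0" using nz[of t] by linarith
          then show "0 < ((n \<xi> t + \<delta>) * (n \<xi> t + \<delta> + 1) * loglog \<delta> (n \<xi> t))\<^sup>2 * ((n \<xi> t + \<delta>) * loglog \<delta> (n \<xi> t))\<^sup>2"
            using nz[of t] by simp
        qed (use nz[of t] n0 in \<open>auto intro!: mult_nonneg_nonneg less_imp_le\<close>)
        also have "\<dots> = 4 * (n \<xi> t / ((n \<xi> t + \<delta>) * loglog \<delta> (n \<xi> t))\<^sup>2) * (norm (gt \<xi> t))\<^sup>2" by simp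
        also have "\<dots> \<le> 4 * w (n \<xi> t) * (norm (gt \<xi> t))\<^sup>2"
          unfolding w_def by (intro mult_right_mono mult_left_mono loglog_square_le \<delta> n0) auto
        finally show "(v' t)\<^sup>2 \<le> 4 * (w (n \<xi> t) * (norm (gt \<xi> t))\<^sup>2)" by simp
      qed
      also have "\<dots> = 4 * e \<xi>" by (simp add: e_def)
      finally show ?thesis using eC2 by simp
    qed
    \<comment> \<open>The assumption to be refuted puts a zero on the chosen circle; there
      \<open>loglog\<close> takes its largest possible value.\<close>
    obtain t0' where "g \<xi> t0' = 0" using contra \<xi> by auto
    then obtain t0 where t0: "t0 \<in> {0..2*pi}" "g \<xi> t0 = 0" using polar_angle[of t0'] by (auto simp: g_def)
    have le: "(norm (g \<xi> t'))\<^sup>2 \<le> \<epsilon>" for t'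
    proof -
      obtain t where t: "t \<in> {0..2*pi}" "g \<xi> t' = g \<xi> t" using polar_angle[of t'] by (auto simp: g_def)
      have "\<bar>v t - v t0\<bar> \<le> V" unfolding V_def by (rule oscillation_bound[OF vd v'c v'E t0(1) t(1)])
      then have "v t0 - V \<le> v t" by linarith
      have "1 + X \<le> loglog \<delta> (n \<xi> t0)"
        using ln_mono[of "exp X" "1 + exp X"] by (simp add: loglog_def n_def t0 \<delta>_def add_pos_pos)
      also have "\<dots> = exp (v t0)" using nz by (simp add: v_def)
      also have "\<dots> \<le> exp (v t + V)" using \<open>v t0 - V \<le> v t\<close> by simp
      also have "\<dots> = loglog \<delta> (n \<xi> t) * exp V" using nz by (simp add: v_def exp_add)
      finally have "1 + X \<le> exp V * loglog \<delta> (n \<xi> t)" by (simp add: mult.commute)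
      then have "exp V * (1 + ln (1 + 1 / \<epsilon>)) \<le> exp V * loglog \<delta> (n \<xi> t)"
        unfolding X_def[symmetric] by linarith
      then have "1 + ln (1 + 1 / \<epsilon>) \<le> loglog \<delta> (n \<xi> t)" by simp
      then have "ln (1 + 1 / \<epsilon>) \<le> ln (1 + 1 / (n \<xi> t + \<delta>))" by (simp add: loglog_def)
      then have "1 + 1 / \<epsilon> \<le> 1 + 1 / (n \<xi> t + \<delta>)"
        using \<epsilon> nz[of t] by (subst (asm) ln_le_cancel_iff) (auto intro: add_pos_pos)
      then have "n \<xi> t + \<delta> \<le> \<epsilon>" using \<epsilon> nz[of t] by (simp add: field_simps)
      then show ?thesis using \<delta> t by (simp add: n_def)
    qed
    show ?thesis
      by (rule max_principle[OF _ _ le]) (use \<xi> r1 z in auto)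
  qed
  have "(norm (f z))\<^sup>2 \<le> 0" by (rule field_le_epsilon) (use small in auto)
  then show False using z by simp
qed

end

section \<open>The energy of log |f| and the order of vanishing\<close>

definition log_H :: "real \<Rightarrow> real \<Rightarrow> real" where
  "log_H \<delta> t = (1 + ln (1 + t / \<delta>)) / (t + \<delta>)"

definition log_H' :: "real \<Rightarrow> real \<Rightarrow> real" where
  "log_H' \<delta> t = - ln (1 + t / \<delta>) / (t + \<delta>)\<^sup>2"

context
  fixes \<delta> t :: real
  assumes \<delta>: "\<delta> > 0" and t: "t \<ge> 0"
begin

lemma log_H_deriv: "(log_H \<delta> has_real_derivative log_H' \<delta> t) (at t)"
proof -
  have p: "t + \<delta> > 0" "1 + t / \<delta> > 0" using t \<delta> by (auto intro: add_pos_nonneg)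
  have l: "((\<lambda>t. ln (1 + t / \<delta>)) has_real_derivative 1 / (t + \<delta>)) (at t)"
    using p \<delta> by (auto intro!: derivative_eq_intros simp: field_simps)
  have "(log_H \<delta> has_real_derivative
      (1 / (t + \<delta>) * (t + \<delta>) - (1 + ln (1 + t / \<delta>)) * 1) / ((t + \<delta>) * (t + \<delta>))) (at t)"
    unfolding log_H_def using p DERIV_add[OF DERIV_const l, of 1]
    by (intro DERIV_divide) (auto intro!: derivative_eq_intros)
  also have "(1 / (t + \<delta>) * (t + \<delta>) - (1 + ln (1 + t / \<delta>)) * 1) / ((t + \<delta>) * (t + \<delta>)) = log_H' \<delta> t"
    using p by (simp add: log_H'_def power2_eq_square)
  finally show ?thesis .
qed

text \<open>The right side is the derivative of \<open>t * log_H \<delta> t\<close>. The left side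
  is, up to a constant factor, the weight that dominates the squared gradient of log (|f|^2 +
  \<delta>); the surplus is \<delta> times a nonnegative quantity, and \<open>log_H\<close> is built
  to produce it.\<close>

lemma log_energy: "1 / (t + \<delta>) \<le> t * log_H' \<delta> t + log_H \<delta> t"
proof -
  have p: "t + \<delta> > 0" "ln (1 + t / \<delta>) \<ge> 0" using t \<delta> by (auto intro: add_pos_nonneg)
  have "t * (- l / a\<^sup>2) + (1 + l) / a = 1 / a + (a - t) * l / a\<^sup>2" if "a > 0" for a l :: real
    using that by (simp add: field_simps power2_eq_square)
  from this[OF p(1)] have "t * log_H' \<delta> t + log_H \<delta> t = 1 / (t + \<delta>) + \<delta> * ln (1 + t / \<delta>) / (t + \<delta>)\<^sup>2"
    by (simp add: log_H_def log_H'_def)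
  moreover have "0 \<le> \<delta> * ln (1 + t / \<delta>) / (t + \<delta>)\<^sup>2" using p \<delta> by simp
  ultimately show ?thesis by linarith
qed

lemma log_energy_nonneg: "0 \<le> t * log_H' \<delta> t + log_H \<delta> t"
proof -
  have "0 \<le> 1 / (t + \<delta>)" using t \<delta> by simp
  then show ?thesis using log_energy by linarith
qed

end

lemma log_H_continuous:
  assumes "\<delta> > 0"
  shows "continuous_on {0..} (log_H \<delta>)" "continuous_on {0..} (log_H' \<delta>)"
proof -
  have nz: "t + \<delta> \<noteq> 0" "1 + t / \<delta> > 0" if "t \<ge> 0" for t
    using that assms by (auto intro: add_pos_nonneg)
  show "continuous_on {0..} (log_H \<delta>)" "continuous_on {0..} (log_H' \<delta>)"
    unfolding log_H_def log_H'_def using assms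
    by (auto intro!: continuous_intros simp: nz less_imp_neq[OF nz(2), symmetric])
qed

context qr_plane
begin

lemma log_mean_deriv:
  assumes \<delta>: "\<delta> > 0" and r: "\<bar>r\<bar> < R0"
  shows "((\<lambda>r. integral {0..2*pi} (\<lambda>t. ln ((norm (g r t))\<^sup>2 + \<delta>))) has_real_derivative
    integral {0..2*pi} (\<lambda>t. 2 * Re (cnj (g r t) * gr r t) / ((norm (g r t))\<^sup>2 + \<delta>))) (at r)"
proof -
  have p: "(norm (g r t))\<^sup>2 + \<delta> > 0" for r t using \<delta> by (simp add: add_nonneg_pos)
  have "((\<lambda>r. integral (cbox 0 (2 * pi)) (\<lambda>t. ln ((norm (g r t))\<^sup>2 + \<delta>))) has_real_derivative
    integral (cbox 0 (2*pi)) (\<lambda>t. 2 * Re (cnj (g r t) * gr r t) / ((norm (g r t))\<^sup>2 + \<delta>))) (at r within {-R0<..<R0})"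
  proof (rule leibniz_rule_field_derivative)
    fix x t assume x: "x \<in> {-R0<..<R0}"
    have "((\<lambda>x. (norm (g x t))\<^sup>2 + \<delta>) has_real_derivative 2 * Re (cnj (g x t) * gr x t)) (at x)"
      using DERIV_add[OF n_deriv_r[of x t] DERIV_const[of \<delta>]] x by auto
    from DERIV_chain2[OF DERIV_ln_divide[OF p] this]
    have "((\<lambda>x. ln ((norm (g x t))\<^sup>2 + \<delta>)) has_real_derivative 2 * Re (cnj (g x t) * gr x t) / ((norm (g x t))\<^sup>2 + \<delta>)) (at x)"
      by (simp del: times_complex.sel)
    then show "((\<lambda>x. ln ((norm (g x t))\<^sup>2 + \<delta>)) has_real_derivative 2 * Re (cnj (g x t) * gr x t) / ((norm (g x t))\<^sup>2 + \<delta>)) (at x within {- R0<..<R0})"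
      by (rule has_field_derivative_at_within)
  next
    fix x assume x: "x \<in> {-R0<..<R0}"
    show "(\<lambda>t. ln ((norm (g x t))\<^sup>2 + \<delta>)) integrable_on cbox 0 (2 * pi)"
      using x by (intro integrable_continuous continuous_intros cont_g ballI less_imp_neq[OF p, symmetric]) auto
  next
    show "continuous_on ({- R0<..<R0} \<times> cbox 0 (2 * pi))
        (\<lambda>(r, t). 2 * Re (cnj (g r t) * gr r t) / ((norm (g r t))\<^sup>2 + \<delta>))"
      unfolding case_prod_unfold
      by (intro continuous_intros cont_g ballI less_imp_neq[OF p, symmetric]) auto
  qed (use r in auto)
  then show ?thesis using r by (subst (asm) at_within_open) auto
qed

text \<open>The energy of \<open>log |f|\<close>, cut off at \<open>|f|\<^sup>2 = \<delta>\<close>, over the disc of radius \<open>R\<close> is \<open>O(log (1 / \<delta>))\<close>. By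
  Cauchy-Schwarz the circular mean of \<open>log (|f|\<^sup>2 + \<delta>)\<close> then drops from radius \<open>R\<close> to radius \<open>r\<close> by at
  most a constant times \<open>sqrt (log (1 / \<delta>) log (R / r))\<close>, whereas it drops by about \<open>log (1 / \<delta>)\<close> if \<open>|f|\<^sup>2 \<le> \<delta>\<close> on the
  circle of radius \<open>r\<close>.\<close>

lemma not_infinite_order:
  assumes R: "0 < R" "R < R0" and nz: "\<And>t. g R t \<noteq> 0"
  shows "\<exists>n. \<forall>C. \<exists>z. norm z \<le> R \<and> norm (f z) > C * norm z ^ n"
proof (rule ccontr)
  assume "\<not> ?thesis"
  then have inf: "\<exists>C. \<forall>z. norm z \<le> R \<longrightarrow> norm (f z) \<le> C * norm z ^ n" for n
    by (metis not_less)
  have bdd: "\<exists>M. \<forall>t\<in>{0..2*pi}. u t \<le> M" if "continuous_on {0..2*pi} u" for u :: "real \<Rightarrow> real"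
    using continuous_attains_sup[OF compact_Icc _ that] by auto
  obtain c where c: "c > 0" "\<And>t. t \<in> {0..2*pi} \<Longrightarrow> c \<le> norm (g R t)"
  proof -
    have "continuous_on {0..2*pi} (\<lambda>t. norm (g R t))" by (intro continuous_intros cont_g) (use R in auto)
    from continuous_attains_inf[OF compact_Icc _ this]
    obtain s where "\<forall>t\<in>{0..2*pi}. norm (g R s) \<le> norm (g R t)" by auto
    then show ?thesis using nz[of s] that[of "norm (g R s)"] by simp
  qed
  have "\<exists>M. \<forall>t\<in>{0..2*pi}. norm (g R t) \<le> M"
    using bdd[OF continuous_on_norm[OF cont_g(1)[of "{0..2*pi}" "\<lambda>t. R" "\<lambda>t. t"]]] R by auto
  then obtain M where M: "\<And>t. t \<in> {0..2*pi} \<Longrightarrow> norm (g R t) \<le> M" by blast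
  have "\<exists>M. \<forall>t\<in>{0..2*pi}. norm (gt R t) \<le> M"
    using bdd[OF continuous_on_norm[OF cont_g(3)[of "{0..2*pi}" "\<lambda>t. R" "\<lambda>t. t"]]] R by auto
  then obtain M' where M': "\<And>t. t \<in> {0..2*pi} \<Longrightarrow> norm (gt R t) \<le> M'" by blast
  have M'0: "M' \<ge> 0" using M'[of 0] by (auto intro: order_trans[OF norm_ge_zero])
  \<comment> \<open>On the fixed circle of radius R the energy is at most
    \<open>C1 * (Q - ln \<delta>)\<close>: the weight \<open>log_H\<close> contributes the logarithm
    of 1 / \<delta>, while c keeps |f| away from 0. The added 1 makes C1 positive.\<close>
  define C1 where "C1 = 2 * pi * M' / c + 1"
  have C1: "C1 > 0" using c M'0 by (simp add: C1_def add_nonneg_pos)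
  define Q where "Q = 1 + ln (1 + M\<^sup>2)"
  have key: "2 * pi * (ln (c\<^sup>2) - ln (2 * \<delta>)) \<le> pi * (Q - ln \<delta>) + K * C1 * (ln R - ln r)"
    if r: "0 < r" "r < R" and \<delta>: "0 < \<delta>" "\<delta> \<le> 1" and small: "\<And>t. (norm (g r t))\<^sup>2 \<le> \<delta>" for r \<delta>
  proof -
    define U where "U r = integral {0..2*pi} (\<lambda>t. ln ((norm (g r t))\<^sup>2 + \<delta>))" for r
    \<comment> \<open>With this weight the energy term costs \<open>pi * (Q - ln \<delta>)\<close>,
      which is half of the drop 2 pi log (1 / \<delta>) to be accounted for.\<close>
    define lam where "lam = pi / C1"
    have lam: "lam > 0" using C1 by (simp add: lam_def)
    define n where "n r t = (norm (g r t))\<^sup>2" for r t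
    have n0: "n r t \<ge> 0" for r t by (simp add: n_def)
    have p: "n r t + \<delta> > 0" for r t using n0[of r t] \<delta> by linarith
    have cn: "continuous_on {0..2*pi} (n r)" if "\<bar>r\<bar> < R0" for r
      unfolding n_def using that by (intro continuous_intros cont_g) auto
    have ct: "continuous_on {0..2*pi} (\<lambda>t. F (n r t))"
      if "\<bar>r\<bar> < R0" "continuous_on {0..} F" for F :: "real \<Rightarrow> real" and r
      by (rule continuous_on_compose2[OF that(2) cn[OF that(1)]]) (auto simp: n0)
    let ?A = "A (log_H \<delta>)"
    \<comment> \<open>The derivative of the mean is at most lam times the derivative of the energy
      plus pi K / (lam x), and the latter is the derivative of the subtracted logarithm.\<close>
    have dec: "U R - lam * ?A R - pi * K / lam * ln R \<le> U r - lam * ?A r - pi * K / lam * ln r"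
    proof (rule DERIV_nonpos_imp_nonincreasing[of r R "\<lambda>r. U r - lam * ?A r - pi * K / lam * ln r"])
      fix x assume x: "r \<le> x" "x \<le> R"
      then have x0: "x > 0" "\<bar>x\<bar> < R0" using r R by auto
      let ?U' = "integral {0..2*pi} (\<lambda>t. 2 * Re (cnj (g x t) * gr x t) / (n x t + \<delta>))"
      let ?D = "integral {0..2*pi} (\<lambda>t. 2 * (n x t * log_H' \<delta> (n x t) + log_H \<delta> (n x t)) * (x * J (polar x t)))"
      have "(U has_real_derivative ?U') (at x)"
        unfolding U_def n_def by (rule log_mean_deriv[OF \<delta>(1) x0(2)])
      moreover have "(?A has_real_derivative ?D) (at x)"
        unfolding n_def by (intro energy_identity log_H_deriv log_H_continuous \<delta> x0)
      ultimately have "((\<lambda>r. U r - lam * ?A r - pi * K / lam * ln r) has_real_derivative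
          ?U' - lam * ?D - pi * K / lam * (1 / x)) (at x)"
        using x0 by (intro DERIV_diff DERIV_cmult DERIV_ln_divide) auto
      moreover have "?U' - lam * ?D - pi * K / lam * (1 / x) \<le> 0"
      proof -
        let ?I = "\<lambda>t. 2 * (n x t * log_H' \<delta> (n x t) + log_H \<delta> (n x t)) * (x * J (polar x t))"
        have I: "?I integrable_on {0..2*pi}"
          using x0 by (intro integrable_continuous_interval continuous_intros cont_g ct cn log_H_continuous \<delta>) auto
        have "?U' \<le> integral {0..2*pi} (\<lambda>t. lam * ?I t + K / (2 * lam * x))"
        proof (rule integral_le)
          show "(\<lambda>t. 2 * Re (cnj (g x t) * gr x t) / (n x t + \<delta>)) integrable_on {0..2*pi}"
            using x0 by (intro integrable_continuous_interval continuous_intros cont_g cn ballI less_imp_neq[OF p, symmetric]) auto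
          show "(\<lambda>t. lam * ?I t + K / (2 * lam * x)) integrable_on {0..2*pi}"
            using x0 by (intro integrable_continuous_interval continuous_intros cont_g ct cn log_H_continuous \<delta>) auto
          fix t
          let ?s = "sqrt (n x t + \<delta>)"
          define a where "a = norm (gr x t) / ?s"
          have s: "?s > 0" "?s\<^sup>2 = n x t + \<delta>" using p[of x t] by auto
          have "Re (cnj (g x t) * gr x t) \<le> norm (g x t) * norm (gr x t)"
            using complex_Re_le_cmod[of "cnj (g x t) * gr x t"] by (simp add: norm_mult)
          also have "\<dots> \<le> ?s * norm (gr x t)"
            using \<delta> by (intro mult_right_mono real_le_rsqrt) (auto simp: n_def)
          finally have "2 * Re (cnj (g x t) * gr x t) / (n x t + \<delta>) \<le> 2 * (?s * norm (gr x t)) / (n x t + \<delta>)"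
            using p[of x t] by (intro divide_right_mono mult_left_mono) auto
          also have "\<dots> = 2 * a"
          proof -
            have "2 * (S * b) / d = 2 * (b / S)" if "S > 0" "S\<^sup>2 = d" for S b d :: real
              using that by (auto simp: power2_eq_square)
            from this[OF s] show ?thesis unfolding a_def .
          qed
          also have "\<dots> \<le> (2 * lam * x / K) * a\<^sup>2 + K / (2 * lam * x)"
          proof -
            \<comment> \<open>The weighted inequality 2 a \<le> q a^2 + 1 / q, with q such that q
              a^2 is at most lam times the energy density.\<close>
            define q where "q = 2 * lam * x / K"
            have q: "q > 0" using lam x0 K by (simp add: q_def)
            have "0 \<le> (q * a - 1)\<^sup>2 / q" using q by simp
            also have "\<dots> = q * a\<^sup>2 - 2 * a + 1 / q" using q by (simp add: power2_eq_square field_simps)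
            finally show ?thesis by (simp add: q_def)
          qed
          also have "(2 * lam * x / K) * a\<^sup>2 \<le> lam * ?I t"
          proof -
            have "a\<^sup>2 = (norm (gr x t))\<^sup>2 / (n x t + \<delta>)" by (simp add: a_def power_divide s)
            also have "\<dots> \<le> (K * J (polar x t)) / (n x t + \<delta>)"
              using p[of x t] x0 by (intro divide_right_mono gr_bound) auto
            also have "\<dots> = 1 / (n x t + \<delta>) * (K * J (polar x t))" by simp
            also have "\<dots> \<le> (n x t * log_H' \<delta> (n x t) + log_H \<delta> (n x t)) * (K * J (polar x t))"
              using x0 K by (intro mult_right_mono log_energy \<delta> n0 mult_nonneg_nonneg J_nonneg) auto
            finally have "(2 * lam * x / K) * a\<^sup>2 \<le> (2 * lam * x / K) * ((n x t * log_H' \<delta> (n x t) + log_H \<delta> (n x t)) * (K * J (polar x t)))"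
              using lam x0 K by (intro mult_left_mono) auto
            also have "\<dots> = lam * ?I t" using K by simp
            finally show ?thesis .
          qed
          finally show "2 * Re (cnj (g x t) * gr x t) / (n x t + \<delta>) \<le> lam * ?I t + K / (2 * lam * x)" by simp
        qed
        also have "\<dots> = lam * ?D + 2 * pi * (K / (2 * lam * x))"
        proof -
          have "(\<lambda>t. lam * ?I t) integrable_on {0..2*pi}"
            using integrable_cmul[OF I, of lam] by (simp only: real_scaleR_def)
          then have "integral {0..2*pi} (\<lambda>t. lam * ?I t + K / (2 * lam * x)) =
            integral {0..2*pi} (\<lambda>t. lam * ?I t) + integral {0..2*pi} (\<lambda>t. K / (2 * lam * x))"
            by (rule integral_add) auto
          then show ?thesis by (simp only: integral_mult_right) simp
        qed
        finally show ?thesis using lam x0 by simp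
      qed
      ultimately show "\<exists>y. ((\<lambda>r. U r - lam * ?A r - pi * K / lam * ln r) has_real_derivative y) (at x) \<and> y \<le> 0"
        by blast
    qed (use r in auto)
    have "0 \<le> ?A r"
      using r R by (intro A_nonneg[of _ "log_H' \<delta>"] log_H_deriv log_H_continuous log_energy_nonneg \<delta>) auto
    then have lA: "0 \<le> lam * ?A r" using lam by simp
    have UR: "2 * pi * ln (c\<^sup>2) \<le> U R"
    proof -
      have "integral {0..2*pi} (\<lambda>t. ln (c\<^sup>2)) \<le> U R"
        unfolding U_def
      proof (rule integral_le)
        show "(\<lambda>t. ln ((norm (g R t))\<^sup>2 + \<delta>)) integrable_on {0..2*pi}"
          using R by (intro integrable_continuous_interval continuous_intros cont_g ballI less_imp_neq[OF p[unfolded n_def], symmetric]) auto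
        fix t assume "t \<in> {0..2*pi}"
        then have "c\<^sup>2 \<le> (norm (g R t))\<^sup>2" using c by (intro power_mono) auto
        then have "c\<^sup>2 \<le> (norm (g R t))\<^sup>2 + \<delta>" using \<delta> by linarith
        then show "ln (c\<^sup>2) \<le> ln ((norm (g R t))\<^sup>2 + \<delta>)" using c by (intro ln_mono) auto
      qed auto
      then show ?thesis by simp
    qed
    have Ur: "U r \<le> 2 * pi * ln (2 * \<delta>)"
    proof -
      have "U r \<le> integral {0..2*pi} (\<lambda>t. ln (2 * \<delta>))"
        unfolding U_def
      proof (rule integral_le)
        show "(\<lambda>t. ln ((norm (g r t))\<^sup>2 + \<delta>)) integrable_on {0..2*pi}"
          using R r by (intro integrable_continuous_interval continuous_intros cont_g ballI less_imp_neq[OF p[unfolded n_def], symmetric]) auto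
        fix t assume "t \<in> {0..2*pi}"
        show "ln ((norm (g r t))\<^sup>2 + \<delta>) \<le> ln (2 * \<delta>)"
          using small[of t] p[of r t] by (intro ln_mono) (auto simp: n_def)
      qed auto
      then show ?thesis by simp
    qed
    have AR: "?A R \<le> C1 * (Q - ln \<delta>)"
    proof -
      define B where "B = 1 + ln (1 + M\<^sup>2 / \<delta>)"
      have B: "B \<ge> 1" unfolding B_def using \<delta> by (simp add: ln_ge_zero)
      have "?A R \<le> integral {0..2*pi} (\<lambda>t. B * (M' / c))"
        unfolding A_def
      proof (rule integral_le)
        show "(\<lambda>t. log_H \<delta> ((norm (g R t))\<^sup>2) * Im (cnj (g R t) * gt R t)) integrable_on {0..2*pi}"
          using R unfolding n_def[symmetric]
          by (intro integrable_continuous_interval continuous_intros cont_g ct log_H_continuous \<delta>) auto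
        fix t assume t: "t \<in> {0..2*pi}"
        have gp: "norm (g R t) > 0" using c(2)[OF t] c(1) by linarith
        have "0 \<le> log_H \<delta> (n R t)" using n0 \<delta> by (auto simp: log_H_def intro!: divide_nonneg_nonneg add_nonneg_nonneg ln_ge_zero)
        then have "log_H \<delta> (n R t) * Im (cnj (g R t) * gt R t) \<le> log_H \<delta> (n R t) * (norm (g R t) * norm (gt R t))"
          using abs_Im_le_cmod[of "cnj (g R t) * gt R t"] by (intro mult_left_mono) (auto simp: norm_mult)
        also have "\<dots> \<le> (B / n R t) * (norm (g R t) * norm (gt R t))"
        proof (intro mult_right_mono)
          have "(1 + ln (1 + n R t / \<delta>)) / (n R t + \<delta>) \<le> B / n R t"
          proof (rule frac_le)
            have "n R t \<le> M\<^sup>2" using M[OF t] by (simp add: n_def power_mono)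
            then have "n R t / \<delta> \<le> M\<^sup>2 / \<delta>" using \<delta> by (intro divide_right_mono) auto
            moreover have "0 \<le> n R t / \<delta>" using \<delta> n0 by simp
            ultimately have "ln (1 + n R t / \<delta>) \<le> ln (1 + M\<^sup>2 / \<delta>)" by (intro ln_mono) auto
            then show "1 + ln (1 + n R t / \<delta>) \<le> B" unfolding B_def by simp
          qed (use B gp \<delta> in \<open>auto simp: n_def\<close>)
          then show "log_H \<delta> (n R t) \<le> B / n R t" by (simp add: log_H_def)
        qed auto
        also have "\<dots> = B * (norm (gt R t) / norm (g R t))" using gp by (simp add: n_def power2_eq_square)
        also have "\<dots> \<le> B * (M' / c)"
          using B M'[OF t] c(2)[OF t] c(1) M'0 by (intro mult_left_mono frac_le) auto
        finally show "log_H \<delta> ((norm (g R t))\<^sup>2) * Im (cnj (g R t) * gt R t) \<le> B * (M' / c)" by (simp add: n_def)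
      qed auto
      also have "\<dots> = (2 * pi * M' / c) * B" by simp
      also have "\<dots> \<le> C1 * B" using B by (intro mult_right_mono) (auto simp: C1_def)
      also have "B \<le> Q - ln \<delta>"
      proof -
        have "ln (1 + M\<^sup>2 / \<delta>) \<le> ln ((1 + M\<^sup>2) / \<delta>)"
          using \<delta> by (intro ln_mono) (auto simp: field_simps intro: add_pos_nonneg)
        also have "\<dots> = ln (1 + M\<^sup>2) - ln \<delta>" using \<delta> by (intro ln_divide_pos) (auto intro: add_pos_nonneg)
        finally show ?thesis by (simp add: B_def Q_def)
      qed
      finally show ?thesis using C1 by simp
    qed
    have "U R - U r \<le> lam * ?A R + pi * K / lam * (ln R - ln r)"
      unfolding right_diff_distrib using dec lA by linarith
    also have "\<dots> \<le> lam * (C1 * (Q - ln \<delta>)) + pi * K / lam * (ln R - ln r)"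
      using AR lam by simp
    also have "lam * (C1 * (Q - ln \<delta>)) = pi * (Q - ln \<delta>)" using C1 by (simp add: lam_def)
    also have "pi * K / lam = K * C1" using C1 by (simp add: lam_def)
    finally show ?thesis using UR Ur by (simp add: right_diff_distrib)
  qed
  \<comment> \<open>At this order of vanishing the remaining half of the drop, about 2 pi n log (1 /
    r), exceeds K C1 log (1 / r) by at least log (1 / r).\<close>
  obtain n :: nat where n: "K * C1 + 1 \<le> 2 * pi * n" "n \<ge> 1"
  proof -
    obtain k :: nat where "K * C1 + 1 \<le> k" using real_arch_simple by blast
    moreover have "real k \<le> 2 * pi * real (Suc k)"
      using pi_ge_two mult_mono[of 1 "2 * pi" "real k" "real (Suc k)"] by auto
    ultimately show ?thesis using that[of "Suc k"] by linarith
  qed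
  obtain C' where C': "\<And>z. norm z \<le> R \<Longrightarrow> norm (f z) \<le> C' * norm z ^ n" using inf[of n] by blast
  define C where "C = max C' 1"
  have C: "C \<ge> 1" "\<And>z. norm z \<le> R \<Longrightarrow> norm (f z) \<le> C * norm z ^ n"
    using C' unfolding C_def by (auto intro!: order_trans[OF C'] mult_right_mono)
  have lnC: "ln C \<ge> 0" using C by simp
  \<comment> \<open>Collects, in absolute value, all terms that do not depend on r, so that l = log
    (1 / r) > X contradicts the estimate.\<close>
  define X where "X = 2 * pi * (ln C + ln 2) + pi * \<bar>Q\<bar> + K * C1 * \<bar>ln R\<bar> + 2 * pi * \<bar>ln (c\<^sup>2)\<bar>"
  have X0: "X \<ge> 0" unfolding X_def using lnC K C1 by (intro add_nonneg_nonneg mult_nonneg_nonneg) auto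
  define l where "l = X + ln C + \<bar>ln R\<bar> + 1"
  define r where "r = exp (- l)"
  \<comment> \<open>The bound for |f|^2 on the circle of radius r that vanishing to order n
    provides.\<close>
  define \<delta> where "\<delta> = (C * r ^ n)\<^sup>2"
  have l1: "l \<ge> 1" "l \<ge> ln C" "l > \<bar>ln R\<bar>" "l > X" unfolding l_def using X0 lnC by auto
  have r: "0 < r" "r < R"
  proof -
    have "exp (- l) < exp (ln R)" using l1 by simp
    then show "r < R" using R by (simp add: r_def)
  qed (simp add: r_def)
  have ln\<delta>: "ln \<delta> = 2 * ln C - 2 * real n * l"
    using C r by (simp add: \<delta>_def ln_mult ln_realpow) (simp add: r_def)
  have \<delta>: "0 < \<delta>" "\<delta> \<le> 1"
  proof -
    show "0 < \<delta>" using C r by (simp add: \<delta>_def)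
    have "ln C \<le> real n * l" using l1 n(2) mult_mono[of 1 "real n" "ln C" l] lnC by auto
    then have "ln \<delta> \<le> 0" unfolding ln\<delta> by simp
    then show "\<delta> \<le> 1" using \<open>0 < \<delta>\<close> by simp
  qed
  have "(norm (g r t))\<^sup>2 \<le> \<delta>" for t
  proof -
    have "norm (g r t) \<le> C * r ^ n" using C(2)[of "polar r t"] r by (simp add: g_def)
    then show ?thesis unfolding \<delta>_def by (intro power_mono) auto
  qed
  from key[OF r \<delta> this]
  have "2 * pi * (ln (c\<^sup>2) - ln (2 * \<delta>)) \<le> pi * (Q - ln \<delta>) + K * C1 * (ln R - ln r)" .
  moreover have "ln (2 * \<delta>) = ln 2 + ln \<delta>" using \<delta> by (simp add: ln_mult)
  moreover have "ln r = - l" by (simp add: r_def)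
  ultimately have "2 * pi * ln (c\<^sup>2) - 2 * pi * ln 2 - 2 * pi * ln \<delta> \<le> pi * Q - pi * ln \<delta> + K * C1 * ln R + K * C1 * l"
    by (simp add: algebra_simps)
  then have "2 * pi * real n * l - K * C1 * l \<le> pi * Q + K * C1 * ln R + 2 * pi * ln 2 + 2 * pi * ln C - 2 * pi * ln (c\<^sup>2)"
    unfolding ln\<delta> by (simp add: algebra_simps)
  also have "\<dots> \<le> X"
  proof -
    have "pi * Q \<le> pi * \<bar>Q\<bar>" by (intro mult_left_mono) auto
    moreover have "K * C1 * ln R \<le> K * C1 * \<bar>ln R\<bar>" using K C1 by (intro mult_left_mono) auto
    moreover have "2 * pi * (- ln (c\<^sup>2)) \<le> 2 * pi * \<bar>ln (c\<^sup>2)\<bar>" by (intro mult_left_mono) auto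
    moreover have "2 * pi * (ln C + ln 2) = 2 * pi * ln C + 2 * pi * ln 2" by (simp only: distrib_left)
    ultimately show ?thesis unfolding X_def mult_minus_right by linarith
  qed
  also have "\<dots> < 1 * l" using l1 by simp
  also have "\<dots> \<le> (2 * pi * real n - K * C1) * l" using n l1 by (intro mult_right_mono) auto
  finally show False by (simp add: algebra_simps)
qed

text \<open>A nonzero value within R / 2 yields a zero-free circle between the radii R / 2 and R,
  and on the disc that it bounds f cannot vanish to infinite order at 0.\<close>

theorem strong_unique_continuation:
  assumes R: "0 < R" "R < R0"
    and inf: "\<And>n. \<exists>C. \<forall>z. norm z \<le> R \<longrightarrow> norm (f z) \<le> C * norm z ^ n"
    and z: "norm z \<le> R / 2"
  shows "f z = 0"
proof (rule ccontr)
  assume "f z \<noteq> 0"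
  from zero_free_circle[OF R z this] obtain \<xi> where \<xi>: "R / 2 < \<xi>" "\<xi> < R" "\<And>t. g \<xi> t \<noteq> 0" by auto
  then have "0 < \<xi>" "\<xi> < R0" using R by auto
  from not_infinite_order[OF this \<xi>(3)] obtain n where n: "\<And>C. \<exists>z. norm z \<le> \<xi> \<and> norm (f z) > C * norm z ^ n" by blast
  obtain C where "\<And>z. norm z \<le> R \<Longrightarrow> norm (f z) \<le> C * norm z ^ n" using inf[of n] by blast
  with n[of C] \<xi> show False by (meson le_less_trans less_imp_le not_le)
qed

end


section \<open>The leading term of a smooth quasiregular map\<close>

abbreviation "D1 f \<equiv> \<lambda>z. frechet_derivative f (at z) (1::complex)"
abbreviation "D2 f \<equiv> \<lambda>z. frechet_derivative f (at z) \<i>"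

section \<open>Taylor expansion along rays\<close>

lemma smooth_on_partials:
  assumes "smooth_on S f" "z \<in> S"
  shows "(f has_derivative (\<lambda>h. Re h *\<^sub>R D1 f z + Im h *\<^sub>R D2 f z)) (at z)"
  using smooth_on_has_derivative[OF assms] linear_complex_decomp[OF smooth_on_linear_derivative[OF assms]]
  by (metis (no_types, lifting) ext)

text \<open>The coefficient of r^j in the expansion of f along the ray at angle t. The recursion
  integrates the radial derivative cos t f_x + sin t f_y; integrating r^j contributes the division
  by j + 1, so no factorials appear.\<close>

primrec polar_coeff :: "nat \<Rightarrow> (complex \<Rightarrow> complex) \<Rightarrow> real \<Rightarrow> complex" where
  "polar_coeff 0 f t = f 0"
| "polar_coeff (Suc j) f t = (cos t *\<^sub>R polar_coeff j (D1 f) t + sin t *\<^sub>R polar_coeff j (D2 f) t) /\<^sub>R real (Suc j)"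

lemma polar_coeff_continuous: "continuous_on S (polar_coeff j f)"
proof (induction j arbitrary: f)
  case (Suc j)
  then show ?case unfolding polar_coeff.simps by (intro continuous_intros)
qed simp

lemma polar_coeff_periodic: "polar_coeff j f (t + 2 * pi) = polar_coeff j f t"
  by (induction j arbitrary: f) (auto simp del: of_nat_Suc)

text \<open>The induction runs over all f at once: the remainder vanishes at r = 0, and its radial
  derivative combines the remainders, one order lower, of the two partial derivatives. The constant
  is uniform in t.\<close>

lemma polar_Taylor:
  assumes "smooth_on (ball 0 R0) f" "R < R0"
  shows "\<exists>C\<ge>0. \<forall>r t. 0 \<le> r \<and> r \<le> R \<longrightarrow> norm (f (polar r t) - (\<Sum>j<n. r ^ j *\<^sub>R polar_coeff j f t)) \<le> C * r ^ n"
  using assms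
proof (induction n arbitrary: f)
  case 0
  have "compact (f ` cball 0 R)"
    using 0 by (intro compact_continuous_image continuous_on_subset[OF smooth_on_imp_continuous_on[OF 0(1)]]) auto
  then obtain C where "\<forall>z\<in>cball 0 R. norm (f z) \<le> C"
    using compact_imp_bounded bounded_iff by (metis image_eqI)
  then show ?case by (intro exI[of _ "max C 0"]) (auto simp: le_max_iff_disj)
next
  case (Suc n)
  obtain C1 where C1: "C1 \<ge> 0" "\<And>r t. 0 \<le> r \<Longrightarrow> r \<le> R \<Longrightarrow>
      norm (D1 f (polar r t) - (\<Sum>j<n. r ^ j *\<^sub>R polar_coeff j (D1 f) t)) \<le> C1 * r ^ n"
    using Suc.IH[OF smooth_on_frechet_derivative[OF Suc.prems(1)] Suc.prems(2)] by blast
  obtain C2 where C2: "C2 \<ge> 0" "\<And>r t. 0 \<le> r \<Longrightarrow> r \<le> R \<Longrightarrow>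
      norm (D2 f (polar r t) - (\<Sum>j<n. r ^ j *\<^sub>R polar_coeff j (D2 f) t)) \<le> C2 * r ^ n"
    using Suc.IH[OF smooth_on_frechet_derivative[OF Suc.prems(1)] Suc.prems(2)] by blast
  show ?case
  proof (intro exI[of _ "C1 + C2"] conjI allI impI)
    fix r t assume r: "0 \<le> r \<and> r \<le> R"
    define h where "h s = f (polar s t) - (\<Sum>j<Suc n. s ^ j *\<^sub>R polar_coeff j f t)" for s
    define h' where "h' s = cos t *\<^sub>R (D1 f (polar s t) - (\<Sum>j<n. s ^ j *\<^sub>R polar_coeff j (D1 f) t))
       + sin t *\<^sub>R (D2 f (polar s t) - (\<Sum>j<n. s ^ j *\<^sub>R polar_coeff j (D2 f) t))" for s
    have d: "(h has_vector_derivative h' s) (at s)" if s: "0 \<le> s" "s \<le> R" for s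
    proof -
      have 1: "((\<lambda>s. f (polar s t)) has_vector_derivative (cos t *\<^sub>R D1 f (polar s t) + sin t *\<^sub>R D2 f (polar s t))) (at s)"
        using s Suc.prems by (intro partials_polar_r smooth_on_partials) auto
      have "(\<lambda>s. \<Sum>j<Suc n. s ^ j *\<^sub>R polar_coeff j f t) = (\<lambda>s. f 0 + (\<Sum>j<n. s ^ Suc j *\<^sub>R polar_coeff (Suc j) f t))"
        by (simp only: sum.lessThan_Suc_shift) simp
      moreover have "((\<lambda>s. f 0 + (\<Sum>j<n. s ^ Suc j *\<^sub>R polar_coeff (Suc j) f t)) has_vector_derivative
         (\<Sum>j<n. (real (Suc j) * s ^ j) *\<^sub>R polar_coeff (Suc j) f t)) (at s)"
        by (auto intro!: derivative_eq_intros simp del: of_nat_Suc power_Suc polar_coeff.simps)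
      moreover have "(real (Suc j) * s ^ j) *\<^sub>R polar_coeff (Suc j) f t =
         cos t *\<^sub>R (s ^ j *\<^sub>R polar_coeff j (D1 f) t) + sin t *\<^sub>R (s ^ j *\<^sub>R polar_coeff j (D2 f) t)" for j
      proof -
        have k: "real (Suc j) * s ^ j * inverse (real (Suc j)) = s ^ j" by (simp add: field_simps)
        show ?thesis unfolding polar_coeff.simps scaleR_scaleR k by (simp add: scaleR_add_right mult.commute)
      qed
      ultimately have "((\<lambda>s. \<Sum>j<Suc n. s ^ j *\<^sub>R polar_coeff j f t) has_vector_derivative
         (cos t *\<^sub>R (\<Sum>j<n. s ^ j *\<^sub>R polar_coeff j (D1 f) t) + sin t *\<^sub>R (\<Sum>j<n. s ^ j *\<^sub>R polar_coeff j (D2 f) t))) (at s)"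
        by (simp only: sum.distrib scaleR_sum_right)
      from has_vector_derivative_diff[OF 1 this] show ?thesis
        unfolding h_def h'_def by (simp add: algebra_simps del: sum.lessThan_Suc)
    qed
    have b: "norm (h' s) \<le> (C1 + C2) * r ^ n" if s: "0 \<le> s" "s \<le> r" for s
    proof -
      have "norm (h' s) \<le> \<bar>cos t\<bar> * (C1 * s ^ n) + \<bar>sin t\<bar> * (C2 * s ^ n)"
        unfolding h'_def using s r
        by (intro norm_triangle_le add_mono) (auto intro!: mult_left_mono C1 C2)
      also have "\<dots> \<le> 1 * (C1 * r ^ n) + 1 * (C2 * r ^ n)"
        using s C1 C2 by (intro add_mono mult_mono power_mono) (auto intro: mult_nonneg_nonneg)
      finally show ?thesis by (simp add: algebra_simps)
    qed
    have "norm (h r - h 0) \<le> ((C1 + C2) * r ^ n) * norm (r - 0)"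
    proof (rule differentiable_bound[of "{0..r}" h "\<lambda>s k. k *\<^sub>R h' s"])
      fix s assume s: "s \<in> {0..r}"
      show "(h has_derivative (\<lambda>k. k *\<^sub>R h' s)) (at s within {0..r})"
        using d[of s] s r by (auto simp: has_vector_derivative_def intro: has_derivative_at_withinI)
      show "onorm (\<lambda>k. k *\<^sub>R h' s) \<le> (C1 + C2) * r ^ n"
        using b[of s] s C1 C2 r by (intro onorm_bound) (auto simp: mult.commute mult_left_mono)
    qed (use r in auto)
    moreover have "h 0 = 0" by (simp add: h_def polar_def sum.lessThan_Suc_shift del: sum.lessThan_Suc)
    ultimately show "norm (f (polar r t) - (\<Sum>j<Suc n. r ^ j *\<^sub>R polar_coeff j f t)) \<le> (C1 + C2) * r ^ Suc n"
      using r by (simp add: h_def mult_ac del: sum.lessThan_Suc)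
  qed (use C1 C2 in auto)
qed

text \<open>Near t the lift has to be Q t + Ln (q s / q t), because by continuity the imaginary part
  of Q s - Q t stays inside the principal strip.\<close>

lemma continuous_log_deriv:
  fixes q Q :: "real \<Rightarrow> complex"
  assumes Q: "continuous_on UNIV Q" "\<And>t. q t = exp (Q t)" and q: "(q has_vector_derivative d) (at t)"
  shows "(Q has_vector_derivative d / q t) (at (t::real))"
proof -
  have q0: "q t \<noteq> 0" using Q by simp
  have "((\<lambda>s. q s / q t) has_vector_derivative d / q t) (at t)"
    using q by (intro has_vector_derivative_divide)
  moreover have "(Ln has_field_derivative 1) (at (q t / q t))"
    using q0 by (auto intro!: derivative_eq_intros)
  ultimately have "((Ln \<circ> (\<lambda>s. q s / q t)) has_vector_derivative d / q t * 1) (at t)"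
    by (rule field_vector_diff_chain_at)
  then have 1: "((\<lambda>s. Q t + Ln (q s / q t)) has_vector_derivative d / q t) (at t)"
    by (auto intro!: derivative_eq_intros simp: o_def)
  have "isCont Q t" using Q by (simp add: continuous_on_eq_continuous_at)
  then have "(Q \<longlongrightarrow> Q t) (nhds t)" by (simp add: isCont_def tendsto_at_iff_tendsto_nhds)
  then have "((\<lambda>s. Im (Q s - Q t)) \<longlongrightarrow> Im (Q t - Q t)) (nhds t)" by (intro tendsto_intros)
  then have "\<forall>\<^sub>F s in nhds t. dist (Im (Q s - Q t)) (Im (Q t - Q t)) < pi"
    using tendstoD pi_gt_zero by blast
  then have "\<forall>\<^sub>F s in nhds t. Q t + Ln (q s / q t) = Q s"
  proof (eventually_elim)
    case (elim s)
    then have "Ln (exp (Q s - Q t)) = Q s - Q t" by (intro Ln_exp) (auto simp: dist_real_def)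
    then show ?case by (simp add: Q exp_diff)
  qed
  then have ev: "\<forall>\<^sub>F s in nhds t. s \<in> UNIV \<longrightarrow> Q t + Ln (q s / q t) = Q s" by simp
  show ?thesis
    using 1 has_vector_derivative_cong_ev[OF ev] q0 by simp
qed

text \<open>A lift of q changes by 2 pi i k m when its argument moves by 2 pi k, so an angle that
  turns n times multiplies the degree by n.\<close>

lemma has_deg_compose_angle:
  assumes q: "has_deg q m" and Y: "continuous_on UNIV \<theta>" "\<And>t. \<theta> (t + 2 * pi) = \<theta> t + 2 * pi * of_int n"
  shows "has_deg (\<lambda>t. q (\<theta> t)) (n * m)"
proof -
  obtain Q where Q: "continuous_on UNIV Q" "\<And>t. q t = exp (Q t)" "\<And>t. Q (t + 2 * pi) = Q t + 2 * pi * of_int m * \<i>"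
    using q unfolding has_deg_def by metis
  have nat: "Q (t + 2 * pi * real k) = Q t + 2 * pi * of_int (int k * m) * \<i>" for t k
  proof (induction k)
    case (Suc k)
    have "Q (t + 2 * pi * real (Suc k)) = Q ((t + 2 * pi * real k) + 2 * pi)" by (simp add: algebra_simps)
    also have "\<dots> = Q t + 2 * pi * of_int (int (Suc k) * m) * \<i>" unfolding Q(3) Suc by (simp add: algebra_simps)
    finally show ?case .
  qed simp
  have int: "Q (t + 2 * pi * of_int k) = Q t + 2 * pi * of_int (k * m) * \<i>" for t k
  proof (cases "k \<ge> 0")
    case True
    then show ?thesis using nat[of t "nat k"] by simp
  next
    case False
    then show ?thesis using nat[of "t + 2 * pi * of_int k" "nat (- k)"] by (simp add: algebra_simps)
  qed
  show ?thesis unfolding has_deg_def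
  proof (intro exI[of _ "\<lambda>t. Q (\<theta> t)"] conjI allI)
    show "continuous_on UNIV (\<lambda>t. Q (\<theta> t))" by (rule continuous_on_compose2[OF Q(1) Y(1)]) auto
  qed (use Q Y int in auto)
qed

section \<open>The leading coefficient of a quasiregular map: absence of zeros and degree\<close>

locale smooth_qr =
  fixes f :: "complex \<Rightarrow> complex" and R0 K :: real
  assumes R0: "R0 > 0" and K: "K > 0" and f: "smooth_on (ball 0 R0) f" and f0: "f 0 = 0"
    and quasi: "\<And>z. norm z < R0 \<Longrightarrow> (norm (D1 f z))\<^sup>2 + (norm (D2 f z))\<^sup>2 \<le> K * Im (cnj (D1 f z) * D2 f z)"
begin

sublocale qr_plane f "D1 f" "D2 f" "D1 (D1 f)" "D2 (D1 f)" "D2 (D2 f)" R0 K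
proof -
  have m: "D1 (D2 f) z = D2 (D1 f) z" if "norm z < R0" for z
    using smooth_on_mixed_partials[OF open_ball _ f, of z] that by simp
  interpret c2_plane f "D1 f" "D2 f" "D1 (D1 f)" "D2 (D1 f)" "D2 (D2 f)" R0
  proof
    show "R0 > 0" by (rule R0)
    show "(f has_derivative (\<lambda>h. Re h *\<^sub>R D1 f z + Im h *\<^sub>R D2 f z)) (at z)" if "norm z < R0" for z
      using smooth_on_partials[OF f] that by simp
    show "(D1 f has_derivative (\<lambda>h. Re h *\<^sub>R D1 (D1 f) z + Im h *\<^sub>R D2 (D1 f) z)) (at z)" if "norm z < R0" for z
      using smooth_on_partials[OF smooth_on_frechet_derivative[OF f]] that by simp
    show "(D2 f has_derivative (\<lambda>h. Re h *\<^sub>R D2 (D1 f) z + Im h *\<^sub>R D2 (D2 f) z)) (at z)" if "norm z < R0" for z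
      using smooth_on_partials[OF smooth_on_frechet_derivative[OF f], of z \<i>] that m[OF that] by simp
  qed (intro smooth_on_imp_continuous_on smooth_on_frechet_derivative f)+
  show "qr_plane f (D1 f) (D2 f) (D1 (D1 f)) (D2 (D1 f)) (D2 (D2 f)) R0 K"
    by unfold_locales (use K quasi in \<open>auto simp: J_def\<close>)
qed

text \<open>Together with f 0 = 0, the vanishing coefficients of the gradient kill those of f, which
  lie one order higher. Every Taylor remainder is then f itself, and unique continuation
  applies.\<close>

lemma infinite_order_imp_zero:
  assumes "\<And>j t. polar_coeff j (D1 f) t = 0 \<and> polar_coeff j (D2 f) t = 0"
  shows "\<exists>\<epsilon>>0. \<forall>z. norm z < \<epsilon> \<longrightarrow> f z = 0"
proof -
  have z: "polar_coeff j f t = 0" for j t by (cases j) (auto simp: assms f0)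
  define R where "R = R0 / 2"
  have R: "0 < R" "R < R0" using R0 by (auto simp: R_def)
  have inf: "\<exists>C. \<forall>z. norm z \<le> R \<longrightarrow> norm (f z) \<le> C * norm z ^ n" for n
  proof -
    obtain C where C: "\<And>r t. 0 \<le> r \<Longrightarrow> r \<le> R \<Longrightarrow> norm (f (polar r t)) \<le> C * r ^ n"
      using polar_Taylor[OF f R(2), of n] by (auto simp: z)
    show ?thesis
    proof (intro exI[of _ C] allI impI)
      fix z :: complex assume "norm z \<le> R"
      then show "norm (f z) \<le> C * norm z ^ n"
        using C[of "norm z" "Arg2pi z"] polar_norm_Arg2pi[of z] by simp
    qed
  qed
  have "f z = 0" if "norm z < R / 2" for z
    using strong_unique_continuation[OF R inf, of z] that by simp
  then show ?thesis using R by (intro exI[of _ "R / 2"]) auto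
qed

context
  fixes j0 :: nat and t1 :: real
  assumes least: "\<And>j t. j < j0 \<Longrightarrow> polar_coeff j (D1 f) t = 0 \<and> polar_coeff j (D2 f) t = 0"
    and nonzero: "polar_coeff j0 (D1 f) t1 \<noteq> 0 \<or> polar_coeff j0 (D2 f) t1 \<noteq> 0"
begin

definition "N = Suc j0"
definition "p1 = polar_coeff j0 (D1 f)"
definition "p2 = polar_coeff j0 (D2 f)"
definition "q = polar_coeff N f"
definition "qd t = (- sin t) *\<^sub>R p1 t + cos t *\<^sub>R p2 t"

lemma N_q: "real N *\<^sub>R q t = cos t *\<^sub>R p1 t + sin t *\<^sub>R p2 t"
  by (simp add: N_def q_def p1_def p2_def del: of_nat_Suc)

lemma p1_eq: "p1 t = cos t *\<^sub>R (real N *\<^sub>R q t) - sin t *\<^sub>R qd t"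
proof -
  have "c *\<^sub>R (c *\<^sub>R a + s *\<^sub>R b) - s *\<^sub>R ((- s) *\<^sub>R a + c *\<^sub>R b) = (s\<^sup>2 + c\<^sup>2) *\<^sub>R a" for c s and a b :: complex
    by (simp add: algebra_simps power2_eq_square)
  from this[of "cos t" _ "sin t"] show ?thesis unfolding N_q qd_def by simp
qed

lemma leading_terms:
  obtains C where "C > 0"
    "\<And>r t. 0 \<le> r \<Longrightarrow> r \<le> R0 / 2 \<Longrightarrow> norm (D1 f (polar r t) - r ^ j0 *\<^sub>R p1 t) \<le> C * r ^ N"
    "\<And>r t. 0 \<le> r \<Longrightarrow> r \<le> R0 / 2 \<Longrightarrow> norm (D2 f (polar r t) - r ^ j0 *\<^sub>R p2 t) \<le> C * r ^ N"
    "\<And>r t. 0 \<le> r \<Longrightarrow> r \<le> R0 / 2 \<Longrightarrow> norm (f (polar r t) - r ^ N *\<^sub>R q t) \<le> C * r ^ Suc N"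
proof -
  have z: "(\<Sum>j<N. r ^ j *\<^sub>R polar_coeff j (D1 f) t) = r ^ j0 *\<^sub>R p1 t"
    "(\<Sum>j<N. r ^ j *\<^sub>R polar_coeff j (D2 f) t) = r ^ j0 *\<^sub>R p2 t"
    "(\<Sum>j<Suc N. r ^ j *\<^sub>R polar_coeff j f t) = r ^ N *\<^sub>R q t" for r t
  proof -
    show "(\<Sum>j<N. r ^ j *\<^sub>R polar_coeff j (D1 f) t) = r ^ j0 *\<^sub>R p1 t"
      "(\<Sum>j<N. r ^ j *\<^sub>R polar_coeff j (D2 f) t) = r ^ j0 *\<^sub>R p2 t"
      unfolding N_def p1_def p2_def by (simp_all add: least)
    have "polar_coeff j f t = 0" if "j < N" for j
      using that by (cases j) (auto simp: N_def f0 least)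
    then show "(\<Sum>j<Suc N. r ^ j *\<^sub>R polar_coeff j f t) = r ^ N *\<^sub>R q t"
      unfolding q_def by simp
  qed
  have R: "R0 / 2 < R0" using R0 by simp
  note s = smooth_on_frechet_derivative[OF f]
  obtain Ca where a: "Ca \<ge> 0" "\<And>r t. 0 \<le> r \<Longrightarrow> r \<le> R0 / 2 \<Longrightarrow> norm (D1 f (polar r t) - r ^ j0 *\<^sub>R p1 t) \<le> Ca * r ^ N"
    using polar_Taylor[OF s R, of 1 N] unfolding z by auto
  obtain Cb where b: "Cb \<ge> 0" "\<And>r t. 0 \<le> r \<Longrightarrow> r \<le> R0 / 2 \<Longrightarrow> norm (D2 f (polar r t) - r ^ j0 *\<^sub>R p2 t) \<le> Cb * r ^ N"
    using polar_Taylor[OF s R, of \<i> N] unfolding z by auto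
  obtain Cc where c: "Cc \<ge> 0" "\<And>r t. 0 \<le> r \<Longrightarrow> r \<le> R0 / 2 \<Longrightarrow> norm (f (polar r t) - r ^ N *\<^sub>R q t) \<le> Cc * r ^ Suc N"
    using polar_Taylor[OF f R, of "Suc N"] unfolding z by auto
  define C where "C = Ca + Cb + Cc + 1"
  have C: "Ca \<le> C" "Cb \<le> C" "Cc \<le> C" "C > 0" using a b c by (auto simp: C_def)
  have le: "x \<le> A * r ^ k \<Longrightarrow> A \<le> C \<Longrightarrow> 0 \<le> r \<Longrightarrow> x \<le> C * r ^ k" for x A r :: real and k
    by (meson mult_right_mono order_trans zero_le_power)
  show ?thesis
    by (rule that[OF C(4)]) (rule le[OF a(2) C(1)] le[OF b(2) C(2)] le[OF c(2) C(3)]; assumption)+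
qed

lemma q_continuous: "continuous_on S q" "continuous_on S p1" "continuous_on S p2" "continuous_on S qd"
  unfolding q_def p1_def p2_def qd_def by (intro polar_coeff_continuous continuous_intros)+

lemma q_periodic: "q (t + 2 * pi) = q t" "p1 (t + 2 * pi) = p1 t"
  unfolding q_def p1_def by (rule polar_coeff_periodic)+

lemma scaled_limit:
  fixes F G :: "real \<Rightarrow> complex"
  assumes "C > 0" "\<And>r. 0 \<le> r \<Longrightarrow> r \<le> R0 / 2 \<Longrightarrow> norm (F r - r ^ k *\<^sub>R p) \<le> C * r ^ Suc k"
  shows "((\<lambda>r. F r /\<^sub>R r ^ k) \<longlongrightarrow> p) (at_right 0)"
proof (rule Lim_transform[of "\<lambda>_. p"])
  show "((\<lambda>r. F r /\<^sub>R r ^ k - p) \<longlongrightarrow> 0) (at_right 0)"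
  proof (rule Lim_null_comparison)
    show "\<forall>\<^sub>F r in at_right 0. norm (F r /\<^sub>R r ^ k - p) \<le> C * r"
      unfolding eventually_at_right_field
    proof (intro exI[of _ "R0 / 2"] conjI allI impI)
      fix r assume r: "0 < r" "r < R0 / 2"
      have eq: "F r /\<^sub>R r ^ k - p = (F r - r ^ k *\<^sub>R p) /\<^sub>R r ^ k" using r by (simp add: scaleR_diff_right)
      have "\<bar>inverse (r ^ k)\<bar> = inverse (r ^ k)" using r by simp
      then have "norm (F r /\<^sub>R r ^ k - p) = norm (F r - r ^ k *\<^sub>R p) / r ^ k"
        by (metis eq norm_scaleR divide_inverse_commute)
      also have "\<dots> \<le> (C * r ^ Suc k) / r ^ k" using assms(2)[of r] r by (intro divide_right_mono) auto
      finally show "norm (F r /\<^sub>R r ^ k - p) \<le> C * r" using r by simp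
    qed (use R0 in auto)
    show "((\<lambda>r. C * r) \<longlongrightarrow> 0) (at_right 0)" by (auto intro!: tendsto_eq_intros)
  qed
qed auto

text \<open>Both sides are quadratic in the gradient, so the inequality survives the division by
  r^(2 j0) and the limit as r tends to 0.\<close>

lemma leading_qr: "(norm (p1 t))\<^sup>2 + (norm (p2 t))\<^sup>2 \<le> K * Im (cnj (p1 t) * p2 t)"
proof -
  obtain C where C: "C > 0"
    "\<And>r t. 0 \<le> r \<Longrightarrow> r \<le> R0 / 2 \<Longrightarrow> norm (D1 f (polar r t) - r ^ j0 *\<^sub>R p1 t) \<le> C * r ^ N"
    "\<And>r t. 0 \<le> r \<Longrightarrow> r \<le> R0 / 2 \<Longrightarrow> norm (D2 f (polar r t) - r ^ j0 *\<^sub>R p2 t) \<le> C * r ^ N"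
    using leading_terms by metis
  define a b where "a r = D1 f (polar r t) /\<^sub>R r ^ j0" and "b r = D2 f (polar r t) /\<^sub>R r ^ j0" for r
  have l: "(a \<longlongrightarrow> p1 t) (at_right 0)" "(b \<longlongrightarrow> p2 t) (at_right 0)"
    unfolding a_def b_def using C by (auto intro!: scaled_limit[OF C(1)] simp: N_def)
  show ?thesis
  proof (rule tendsto_le[OF trivial_limit_at_right_real])
    show "((\<lambda>r. K * Im (cnj (a r) * b r)) \<longlongrightarrow> K * Im (cnj (p1 t) * p2 t)) (at_right 0)"
      "((\<lambda>r. (norm (a r))\<^sup>2 + (norm (b r))\<^sup>2) \<longlongrightarrow> (norm (p1 t))\<^sup>2 + (norm (p2 t))\<^sup>2) (at_right 0)"
      by (intro tendsto_intros l)+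
    show "\<forall>\<^sub>F r in at_right 0. (norm (a r))\<^sup>2 + (norm (b r))\<^sup>2 \<le> K * Im (cnj (a r) * b r)"
      unfolding eventually_at_right_field
    proof (intro exI[of _ R0] conjI allI impI)
      fix r assume r: "0 < r" "r < R0"
      define c where "c = inverse (r ^ j0)"
      have "(norm (a r))\<^sup>2 + (norm (b r))\<^sup>2 = c\<^sup>2 * ((norm (D1 f (polar r t)))\<^sup>2 + (norm (D2 f (polar r t)))\<^sup>2)"
        unfolding a_def b_def c_def[symmetric] by (simp add: power_mult_distrib algebra_simps)
      also have "\<dots> \<le> c\<^sup>2 * (K * Im (cnj (D1 f (polar r t)) * D2 f (polar r t)))"
        using r by (intro mult_left_mono quasi) auto
      also have "\<dots> = K * Im (cnj (a r) * b r)"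
        unfolding a_def b_def c_def[symmetric] by (simp add: power2_eq_square algebra_simps)
      finally show "(norm (a r))\<^sup>2 + (norm (b r))\<^sup>2 \<le> K * Im (cnj (a r) * b r)" .
    qed (use R0 in auto)
  qed
qed

text \<open>On circles shrinking to 0, f divided by r^N converges to \<open>q\<close>, and its
  angular derivatives converge to \<open>qd\<close> uniformly in the angle. The limit may therefore
  be differentiated, without touching the recursion that defines \<open>q\<close>.\<close>

lemma q_deriv: "(q has_vector_derivative qd t) (at t)"
proof -
  obtain C where C: "C > 0"
    "\<And>r t. 0 \<le> r \<Longrightarrow> r \<le> R0 / 2 \<Longrightarrow> norm (D1 f (polar r t) - r ^ j0 *\<^sub>R p1 t) \<le> C * r ^ N"
    "\<And>r t. 0 \<le> r \<Longrightarrow> r \<le> R0 / 2 \<Longrightarrow> norm (D2 f (polar r t) - r ^ j0 *\<^sub>R p2 t) \<le> C * r ^ N"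
    "\<And>r t. 0 \<le> r \<Longrightarrow> r \<le> R0 / 2 \<Longrightarrow> norm (f (polar r t) - r ^ N *\<^sub>R q t) \<le> C * r ^ Suc N"
    using leading_terms by metis
  define \<rho> where "\<rho> n = R0 / 2 / real (Suc n)" for n
  have \<rho>: "0 < \<rho> n" "\<rho> n \<le> R0 / 2" "\<rho> n < R0" for n
  proof -
    show 1: "0 < \<rho> n" using R0 by (simp add: \<rho>_def)
    have "R0 / 2 / real (Suc n) \<le> R0 / 2 / 1" using R0 by (intro divide_left_mono) auto
    then show "\<rho> n \<le> R0 / 2" by (simp add: \<rho>_def)
    then show "\<rho> n < R0" using R0 by simp
  qed
  have \<rho>0: "\<rho> \<longlonglongrightarrow> 0"
  proof -
    have "\<rho> = (\<lambda>n. R0 / 2 * inverse (real (Suc n)))"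
      by (rule ext) (simp only: \<rho>_def divide_inverse[of "R0 / 2"])
    then show ?thesis using tendsto_mult_left[OF LIMSEQ_inverse_real_of_nat, of "R0 / 2"] by (simp only: mult_zero_right)
  qed
  then have \<rho>r: "filterlim \<rho> (at_right 0) sequentially"
    using \<rho>(1) by (simp add: filterlim_at less_imp_neq[OF \<rho>(1), symmetric])
  have lim: "(\<lambda>n. g (\<rho> n) s /\<^sub>R \<rho> n ^ N) \<longlonglongrightarrow> q s" for s
    unfolding g_def
    by (rule filterlim_compose[OF scaled_limit[OF C(1)] \<rho>r]) (use C(4) in auto)
  have "\<exists>h. \<forall>s\<in>UNIV. (\<lambda>n. g (\<rho> n) s /\<^sub>R \<rho> n ^ N) \<longlonglongrightarrow> h s \<and>
      (h has_derivative (\<lambda>k. k *\<^sub>R qd s)) (at s within UNIV)"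
  proof (rule has_derivative_sequence)
    show "((\<lambda>s. g (\<rho> n) s /\<^sub>R \<rho> n ^ N) has_derivative (\<lambda>k. k *\<^sub>R (gt (\<rho> n) s /\<^sub>R \<rho> n ^ N))) (at s within UNIV)" for n s
      using deriv_g(2)[of "\<rho> n" s] \<rho>[of n]
      by (auto simp: has_vector_derivative_def scaleR_left_commute intro!: derivative_eq_intros)
    show "(\<lambda>n. g (\<rho> n) 0 /\<^sub>R \<rho> n ^ N) \<longlonglongrightarrow> q 0" by (rule lim)
    fix e :: real assume e: "e > 0"
    have "\<forall>\<^sub>F n in sequentially. \<rho> n < e / (2 * C)"
      using order_tendstoD(2)[OF \<rho>0, of "e / (2 * C)"] e C by simp
    then show "\<forall>\<^sub>F n in sequentially. \<forall>s\<in>UNIV. \<forall>k. norm (k *\<^sub>R (gt (\<rho> n) s /\<^sub>R \<rho> n ^ N) - k *\<^sub>R qd s) \<le> e * norm k"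
    proof (eventually_elim, intro ballI allI)
      fix n s and k :: real assume n: "\<rho> n < e / (2 * C)"
      define r where "r = \<rho> n"
      have r: "0 < r" "r \<le> R0 / 2" using \<rho> by (auto simp: r_def)
      have "gt r s /\<^sub>R r ^ N - qd s = ((- sin s) *\<^sub>R (D1 f (polar r s) - r ^ j0 *\<^sub>R p1 s) + cos s *\<^sub>R (D2 f (polar r s) - r ^ j0 *\<^sub>R p2 s)) /\<^sub>R r ^ j0"
      proof -
        have "(r *\<^sub>R (a *\<^sub>R x + b *\<^sub>R y)) /\<^sub>R r ^ N - (a *\<^sub>R u + b *\<^sub>R v) =
            (a *\<^sub>R (x - r ^ j0 *\<^sub>R u) + b *\<^sub>R (y - r ^ j0 *\<^sub>R v)) /\<^sub>R r ^ j0" for a b and x y u v :: complex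
        proof -
          have "inverse (r ^ N) * r = inverse (r ^ j0)" "inverse (r ^ j0) * r ^ j0 = 1"
            using r by (simp_all add: N_def)
          then have e: "(r *\<^sub>R (a *\<^sub>R x + b *\<^sub>R y)) /\<^sub>R r ^ N = (a *\<^sub>R x + b *\<^sub>R y) /\<^sub>R r ^ j0"
            "(r ^ j0 *\<^sub>R (a *\<^sub>R u + b *\<^sub>R v)) /\<^sub>R r ^ j0 = a *\<^sub>R u + b *\<^sub>R v"
            by (simp_all only: scaleR_scaleR scaleR_one)
          have "a *\<^sub>R (x - c *\<^sub>R u) + b *\<^sub>R (y - c *\<^sub>R v) = (a *\<^sub>R x + b *\<^sub>R y) - c *\<^sub>R (a *\<^sub>R u + b *\<^sub>R v)" for c
            by (simp add: algebra_simps)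
          then show ?thesis by (simp only: e scaleR_diff_right[of "inverse (r ^ j0)"])
        qed
        then show ?thesis unfolding gt_def qd_def .
      qed
      moreover have "\<bar>inverse (r ^ j0)\<bar> = inverse (r ^ j0)" using r by simp
      ultimately have "norm (gt r s /\<^sub>R r ^ N - qd s) =
          norm ((- sin s) *\<^sub>R (D1 f (polar r s) - r ^ j0 *\<^sub>R p1 s) + cos s *\<^sub>R (D2 f (polar r s) - r ^ j0 *\<^sub>R p2 s)) / r ^ j0"
        by (metis norm_scaleR divide_inverse_commute)
      also have "\<dots> \<le> (\<bar>sin s\<bar> * (C * r ^ N) + \<bar>cos s\<bar> * (C * r ^ N)) / r ^ j0"
        using r C(2,3)[of r s]
        by (intro divide_right_mono norm_triangle_le add_mono) (auto intro!: mult_left_mono)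
      also have "\<dots> \<le> (1 * (C * r ^ N) + 1 * (C * r ^ N)) / r ^ j0"
        using r C by (intro divide_right_mono add_mono mult_right_mono) auto
      also have "\<dots> = 2 * C * r" using r by (simp add: N_def)
      also have "\<dots> \<le> e" using n C by (simp add: r_def field_simps)
      finally have "norm k * norm (gt r s /\<^sub>R r ^ N - qd s) \<le> norm k * e" by (intro mult_left_mono) auto
      then show "norm (k *\<^sub>R (gt (\<rho> n) s /\<^sub>R \<rho> n ^ N) - k *\<^sub>R qd s) \<le> e * norm k"
        unfolding r_def scaleR_diff_right[symmetric] norm_scaleR by (simp add: mult.commute)
    qed
  qed auto
  then obtain h where h: "\<And>s. (\<lambda>n. g (\<rho> n) s /\<^sub>R \<rho> n ^ N) \<longlonglongrightarrow> h s"
    "\<And>s. (h has_derivative (\<lambda>k. k *\<^sub>R qd s)) (at s)" by auto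
  have "h = q" using LIMSEQ_unique[OF h(1) lim] by auto
  then show ?thesis using h(2) by (simp add: has_vector_derivative_def)
qed

text \<open>Passing to radial and angular components is a rotation, which preserves both the sum of
  squares and the determinant.\<close>

lemma q_qr: "(real N * norm (q t))\<^sup>2 + (norm (qd t))\<^sup>2 \<le> K * (real N * Im (cnj (q t) * qd t))"
proof -
  have "(norm (c *\<^sub>R a + s *\<^sub>R b))\<^sup>2 + (norm ((- s) *\<^sub>R a + c *\<^sub>R b))\<^sup>2 = (s\<^sup>2 + c\<^sup>2) * ((norm a)\<^sup>2 + (norm b)\<^sup>2)"
    "Im (cnj (c *\<^sub>R a + s *\<^sub>R b) * ((- s) *\<^sub>R a + c *\<^sub>R b)) = (s\<^sup>2 + c\<^sup>2) * Im (cnj a * b)" for a b :: complex and c s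
    unfolding cmod_power2 by (simp_all add: algebra_simps power2_eq_square)
  from this[of "cos t" "p1 t" "sin t" "p2 t"]
  have "(norm (real N *\<^sub>R q t))\<^sup>2 + (norm (qd t))\<^sup>2 = (norm (p1 t))\<^sup>2 + (norm (p2 t))\<^sup>2"
    "Im (cnj (real N *\<^sub>R q t) * qd t) = Im (cnj (p1 t) * p2 t)"
    unfolding N_q qd_def by (simp_all del: times_complex.sel)
  moreover have "(real N * norm (q t))\<^sup>2 = (norm (real N *\<^sub>R q t))\<^sup>2"
    "real N * Im (cnj (q t) * qd t) = Im (cnj (real N *\<^sub>R q t) * qd t)"
    by (simp_all add: algebra_simps)
  ultimately show ?thesis using leading_qr[of t] by (simp only:)
qed

text \<open>Dropping the radial term and bounding the determinant by the product of norms leaves a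
  linear differential inequality for \<open>q\<close>.\<close>

lemma qd_bound: "norm (qd t) \<le> K * real N * norm (q t)"
proof (cases "qd t = 0")
  case True
  then show ?thesis using K by simp
next
  case False
  have "(norm (qd t))\<^sup>2 \<le> K * (real N * Im (cnj (q t) * qd t))"
    using q_qr[of t] zero_le_power2[of "real N * norm (q t)"] by linarith
  also have "\<dots> \<le> K * (real N * (norm (q t) * norm (qd t)))"
    using K abs_Im_le_cmod[of "cnj (q t) * qd t"] by (intro mult_left_mono) (auto simp: norm_mult)
  finally have "norm (qd t) * norm (qd t) \<le> (K * real N * norm (q t)) * norm (qd t)"
    by (simp add: power2_eq_square mult_ac)
  then show ?thesis using False by simp
qed

text \<open>Gronwall in both directions: |q|^2 changes at a rate of at most L |q|^2, so a single
  zero makes \<open>q\<close> vanish identically. Then both components of the leading gradient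
  vanish at t1, against the choice of t1.\<close>

lemma q_nonzero: "q t \<noteq> 0"
proof
  assume q0: "q t = 0"
  define L where "L = 2 * K * real N"
  define s where "s t = (norm (q t))\<^sup>2" for t
  have sd: "(s has_real_derivative 2 * Re (cnj (q x) * qd x)) (at x)" for x
    unfolding s_def cmod_power2
    by (rule derivative_eq_intros q_deriv refl)+ (simp add: algebra_simps)
  have b: "\<bar>2 * Re (cnj (q x) * qd x)\<bar> \<le> L * s x" for x
  proof -
    have "\<bar>Re (cnj (q x) * qd x)\<bar> \<le> norm (q x) * norm (qd x)"
      using abs_Re_le_cmod[of "cnj (q x) * qd x"] by (simp add: norm_mult)
    also have "\<dots> \<le> norm (q x) * (K * real N * norm (q x))" by (intro mult_left_mono qd_bound) auto
    finally show ?thesis by (simp add: L_def s_def power2_eq_square mult_ac)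
  qed
  have E1: "((\<lambda>x. s x * exp (- L * x)) has_real_derivative (2 * Re (cnj (q x) * qd x) - L * s x) * exp (- L * x)) (at x)" for x
    by (auto intro!: derivative_eq_intros sd simp: algebra_simps)
  have E2: "((\<lambda>x. s x * exp (L * x)) has_real_derivative (2 * Re (cnj (q x) * qd x) + L * s x) * exp (L * x)) (at x)" for x
    by (auto intro!: derivative_eq_intros sd simp: algebra_simps)
  have "s x = 0" for x
  proof (cases "t \<le> x")
    case True
    have "s x * exp (- L * x) \<le> s t * exp (- L * t)"
    proof (rule DERIV_nonpos_imp_nonincreasing[OF True])
      fix x
      have "(2 * Re (cnj (q x) * qd x) - L * s x) * exp (- L * x) \<le> 0"
        using b[of x] by (intro mult_nonpos_nonneg) (auto simp: abs_le_iff simp del: times_complex.sel)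
      with E1 show "\<exists>y. ((\<lambda>x. s x * exp (- L * x)) has_real_derivative y) (at x) \<and> y \<le> 0" by blast
    qed
    then have "s x \<le> 0" using q0 by (simp add: s_def mult_le_0_iff)
    then show ?thesis by (simp add: s_def)
  next
    case False
    then have "x \<le> t" by simp
    have "s x * exp (L * x) \<le> s t * exp (L * t)"
    proof (rule DERIV_nonneg_imp_nondecreasing[OF \<open>x \<le> t\<close>])
      fix x
      have "0 \<le> (2 * Re (cnj (q x) * qd x) + L * s x) * exp (L * x)"
        using b[of x] by (intro mult_nonneg_nonneg) (auto simp: abs_le_iff simp del: times_complex.sel)
      with E2 show "\<exists>y. ((\<lambda>x. s x * exp (L * x)) has_real_derivative y) (at x) \<and> 0 \<le> y" by blast
    qed
    then have "s x \<le> 0" using q0 by (simp add: s_def mult_le_0_iff)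
    then show ?thesis by (simp add: s_def)
  qed
  then have z: "q x = 0" for x by (simp add: s_def)
  then have "qd t1 = 0" using qd_bound[of t1] by simp
  then have "p1 t1 = 0" using z p1_eq[of t1] by simp
  moreover have "p2 t1 = 0"
    using leading_qr[of t1] \<open>p1 t1 = 0\<close> by simp
  ultimately show False using nonzero by (simp add: p1_def p2_def)
qed

text \<open>This is the angular velocity of \<open>q\<close>. As \<open>q\<close> has no zeros, the
  left side of \<open>q_qr\<close> is positive, so \<open>q\<close> turns strictly forwards.\<close>

lemma Im_qd_q: "Im (qd t / q t) > 0"
proof -
  have "0 < (real N * norm (q t))\<^sup>2" using q_nonzero by (simp add: N_def)
  then have "0 < K * (real N * Im (cnj (q t) * qd t))" using q_qr[of t] zero_le_power2[of "norm (qd t)"] by linarith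
  then have "0 < Im (cnj (q t) * qd t)" using K by (simp add: zero_less_mult_iff N_def del: times_complex.sel)
  moreover have "qd t / q t = (cnj (q t) * qd t) / of_real ((norm (q t))\<^sup>2)"
    unfolding complex_norm_square[unfolded of_real_power[symmetric]] using q_nonzero[of t] by simp
  ultimately show ?thesis using q_nonzero[of t] by (simp del: times_complex.sel of_real_power)
qed

lemma q_degree: obtains m where "has_deg q m" "m \<ge> 1"
proof -
  obtain m where m: "has_deg q m"
    using has_deg_exists[OF q_continuous(1) q_nonzero q_periodic(1)] by blast
  then obtain Q where Q: "continuous_on UNIV Q" "\<And>t. q t = exp (Q t)" "\<And>t. Q (t + 2 * pi) = Q t + 2 * pi * of_int m * \<i>"
    unfolding has_deg_def by blast
  have "Im (Q 0) < Im (Q (2 * pi))"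
  proof (rule DERIV_pos_imp_increasing[of 0 "2 * pi" "\<lambda>x. Im (Q x)"])
    fix x
    show "\<exists>y. ((\<lambda>x. Im (Q x)) has_real_derivative y) (at x) \<and> 0 < y"
      by (intro exI conjI, rule has_vector_derivative_ImD[OF continuous_log_deriv[OF Q(1,2) q_deriv]], rule Im_qd_q)
  qed simp
  also have "Im (Q (2 * pi)) = Im (Q 0) + 2 * pi * of_int m" using Q(3)[of 0] by simp
  finally have "m \<ge> 1" by (simp add: zero_less_mult_iff)
  with m that show ?thesis by blast
qed

lemma p1_nonzero: "p1 t \<noteq> 0"
proof
  assume "p1 t = 0"
  then have "p2 t = 0" using leading_qr[of t] by simp
  with \<open>p1 t = 0\<close> have "real N *\<^sub>R q t = 0" unfolding N_q by simp
  then show False using q_nonzero[of t] by (simp add: N_def)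
qed

text \<open>With h = qd / q, \<open>p1\<close> is \<open>q\<close> times N cos t - h sin t. For h =
  i N this factor is N exp (- i t). In general Im h > 0 suffices: the factor times exp (i t) never
  meets the nonpositive axis, so the factor turns once backwards.\<close>

lemma p1_degree: assumes "has_deg q m" shows "has_deg p1 (m - 1)"
proof -
  have u: "has_deg (\<lambda>t. q t * cnj (cis t)) (m - 1)"
    using has_deg_mult[OF assms has_deg_cnj[OF has_deg_cis]] by simp
  show ?thesis
  proof (rule has_deg_near[OF u q_continuous(2) q_periodic(2)])
    fix t
    define h where "h = qd t / q t"
    have h: "Im h > 0" unfolding h_def by (rule Im_qd_q)
    have "p1 t = q t * (of_real (cos t * real N) - of_real (sin t) * h)"
      unfolding p1_eq using q_nonzero[of t] by (simp add: h_def scaleR_conv_of_real algebra_simps)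
    then have "p1 t / (q t * cnj (cis t)) = (of_real (cos t * real N) - of_real (sin t) * h) / cnj (cis t)"
      using q_nonzero[of t] by simp
    also have "\<dots> = (of_real (cos t * real N) - of_real (sin t) * h) * cis t"
      by (simp add: cis_cnj divide_inverse)
    finally have eq: "p1 t / (q t * cnj (cis t)) = (of_real (cos t * real N) - of_real (sin t) * h) * cis t" .
    show "p1 t / (q t * cnj (cis t)) \<notin> \<real>\<^sub>\<le>\<^sub>0"
    proof
      assume "p1 t / (q t * cnj (cis t)) \<in> \<real>\<^sub>\<le>\<^sub>0"
      then obtain l where l: "(of_real (cos t * real N) - of_real (sin t) * h) * cis t = - of_real l" "l \<ge> 0"
        unfolding eq complex_nonpos_Reals_iff
        by (metis (no_types, lifting) complex_eq_iff Im_complex_of_real Re_complex_of_real minus_complex.sel uminus_complex.sel neg_0_le_iff_le add.inverse_inverse neg_0_equal_iff_equal)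
      have "(of_real (cos t * real N) - of_real (sin t) * h) * (cis t * cnj (cis t)) = - of_real l * cnj (cis t)"
        using l(1) by (simp only: mult.assoc[symmetric])
      then have e: "of_real (cos t * real N) - of_real (sin t) * h = - of_real l * cnj (cis t)"
        by (simp add: cis_cnj cis_mult)
      have "- (sin t * Im h) = l * sin t" using arg_cong[OF e, of Im] by simp
      then have "sin t * (l + Im h) = 0" by (simp add: algebra_simps)
      then have s: "sin t = 0" using h l by auto
      then have "cos t * real N = - l * cos t" using arg_cong[OF e, of Re] by simp
      then have "cos t * (real N + l) = 0" by (simp add: algebra_simps)
      then have "cos t = 0" using l by (auto simp: N_def)
      then show False using s sin_cos_squared_add[of t] by simp
    qed
  qed
qed

text \<open>Within radius \<epsilon> the Taylor remainders are smaller than the leading terms, so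
  Rouche's condition transfers the degrees of \<open>q\<close> and \<open>p1\<close> to f and its
  derivative. The claim on f admits arbitrary small loops because a change of charts does not
  preserve circles.\<close>

lemma finite_order_local:
  "\<exists>\<epsilon>>0. \<exists>m\<ge>1. \<epsilon> \<le> R0 \<and> (\<forall>z. z \<noteq> 0 \<and> norm z < \<epsilon> \<longrightarrow> D1 f z \<noteq> 0) \<and>
     (\<forall>y n. has_deg y n \<and> (\<forall>t. norm (y t) < \<epsilon>) \<longrightarrow> has_deg (\<lambda>t. f (y t)) (n * m)) \<and>
     (\<forall>r. 0 < r \<and> r < \<epsilon> \<longrightarrow> has_deg (\<lambda>t. D1 f (polar r t)) (m - 1))"
proof -
  obtain C where C: "C > 0"
    "\<And>r t. 0 \<le> r \<Longrightarrow> r \<le> R0 / 2 \<Longrightarrow> norm (D1 f (polar r t) - r ^ j0 *\<^sub>R p1 t) \<le> C * r ^ N"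
    "\<And>r t. 0 \<le> r \<Longrightarrow> r \<le> R0 / 2 \<Longrightarrow> norm (f (polar r t) - r ^ N *\<^sub>R q t) \<le> C * r ^ Suc N"
    using leading_terms by metis
  obtain m where m: "has_deg q m" "m \<ge> 1" by (rule q_degree)
  have lower: "\<exists>c>0. \<forall>t. c \<le> norm (u t)"
    if u: "continuous_on UNIV u" "\<And>t. u t \<noteq> 0" "\<And>t. u (t + 2 * pi) = u t" for u :: "real \<Rightarrow> complex"
  proof -
    have "continuous_on {0..2*pi} (\<lambda>t. norm (u t))"
      by (intro continuous_intros continuous_on_subset[OF u(1)]) auto
    from continuous_attains_inf[OF compact_Icc _ this] obtain s where s: "\<forall>t\<in>{0..2*pi}. norm (u s) \<le> norm (u t)" by auto
    have "\<exists>t'\<in>{0..2*pi}. u t = u t'" for t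
    proof -
      define k where "k = \<lfloor>t / (2 * pi)\<rfloor>"
      have per: "u (x + 2 * pi * of_nat n) = u x" for x n
      proof (induction n)
        case (Suc n)
        have "x + 2 * pi * of_nat (Suc n) = (x + 2 * pi * of_nat n) + 2 * pi" by (simp add: algebra_simps)
        then show ?case using u(3)[of "x + 2 * pi * of_nat n"] Suc by (simp only:)
      qed simp
      have peri: "u (x + 2 * pi * of_int i) = u x" for x i
        using per[of x "nat i"] per[of "x + 2 * pi * of_int i" "nat (- i)"] by (cases "i \<ge> 0") auto
      have "of_int k \<le> t / (2 * pi)" "t / (2 * pi) < of_int k + 1" unfolding k_def by linarith+
      then have "2 * pi * of_int k \<le> t" "t < 2 * pi * of_int k + 2 * pi"
        using pi_gt_zero by (simp_all add: field_simps)
      moreover have "u t = u (t - 2 * pi * of_int k)" using peri[of "t - 2 * pi * of_int k" k] by simp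
      ultimately show ?thesis by (intro bexI[of _ "t - 2 * pi * of_int k"]) auto
    qed
    then show ?thesis using s u(2)[of s] by (intro exI[of _ "norm (u s)"]) (metis zero_less_norm_iff)
  qed
  obtain c where c: "c > 0" "\<And>t. c \<le> norm (q t)"
    using lower[OF q_continuous(1) q_nonzero q_periodic(1)] by blast
  obtain c' where c': "c' > 0" "\<And>t. c' \<le> norm (p1 t)"
    using lower[OF q_continuous(2) p1_nonzero q_periodic(2)] by blast
  define \<epsilon> where "\<epsilon> = min (R0 / 2) (min (c / C) (c' / C))"
  have \<epsilon>: "\<epsilon> > 0" "\<epsilon> \<le> R0 / 2" "\<epsilon> \<le> c / C" "\<epsilon> \<le> c' / C"
  proof -
    show "\<epsilon> > 0" using R0 C c c' by (simp add: \<epsilon>_def)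
    show "\<epsilon> \<le> R0 / 2" unfolding \<epsilon>_def by (rule min.cobounded1)
    show "\<epsilon> \<le> c / C" unfolding \<epsilon>_def by (rule order_trans[OF min.cobounded2 min.cobounded1])
    show "\<epsilon> \<le> c' / C" unfolding \<epsilon>_def by (rule order_trans[OF min.cobounded2 min.cobounded2])
  qed
  have b1: "norm (D1 f (polar r t) - r ^ j0 *\<^sub>R p1 t) < norm (r ^ j0 *\<^sub>R p1 t)" if r: "0 < r" "r < \<epsilon>" for r t
  proof -
    have "norm (D1 f (polar r t) - r ^ j0 *\<^sub>R p1 t) \<le> r ^ j0 * (C * r)"
      using C(2)[of r t] r \<epsilon> by (simp add: N_def mult_ac)
    also have "\<dots> < r ^ j0 * c'"
    proof (intro mult_strict_left_mono)
      have "r < c' / C" using r \<epsilon> by linarith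
      then show "C * r < c'" using C(1) by (simp add: pos_less_divide_eq mult.commute)
    qed (use r in simp)
    also have "\<dots> \<le> norm (r ^ j0 *\<^sub>R p1 t)" using c'(2)[of t] r by simp
    finally show ?thesis .
  qed
  have b2: "norm (f (polar r t) - r ^ N *\<^sub>R q t) < norm (r ^ N *\<^sub>R q t)" if r: "0 < r" "r < \<epsilon>" for r t
  proof -
    have "norm (f (polar r t) - r ^ N *\<^sub>R q t) \<le> r ^ N * (C * r)"
      using C(3)[of r t] r \<epsilon> by (simp add: mult_ac)
    also have "\<dots> < r ^ N * c"
    proof (intro mult_strict_left_mono)
      have "r < c / C" using r \<epsilon> by linarith
      then show "C * r < c" using C(1) by (simp add: pos_less_divide_eq mult.commute)
    qed (use r in simp)
    also have "\<dots> \<le> norm (r ^ N *\<^sub>R q t)" using c(2)[of t] r by simp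
    finally show ?thesis .
  qed
  show ?thesis
  proof (intro exI[of _ \<epsilon>] conjI exI[of _ m] allI impI)
    show "\<epsilon> > 0" "m \<ge> 1" by fact+
    show "\<epsilon> \<le> R0" using \<epsilon> R0 by simp
  next
    fix z :: complex assume z: "z \<noteq> 0 \<and> norm z < \<epsilon>"
    show "D1 f z \<noteq> 0"
      using b1[of "norm z" "Arg2pi z"] z polar_norm_Arg2pi[of z] by auto
  next
    fix y n assume y: "has_deg y n \<and> (\<forall>t. norm (y t) < \<epsilon>)"
    then obtain Y where Y: "continuous_on UNIV Y" "\<And>t. y t = exp (Y t)" "\<And>t. Y (t + 2 * pi) = Y t + 2 * pi * of_int n * \<i>"
      unfolding has_deg_def by metis
    define r where "r t = norm (y t)" for t
    \<comment> \<open>The logarithm of y supplies a continuous angle, so the loop is written in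
      polar coordinates with variable radius.\<close>
    have yp: "y t = polar (r t) (Im (Y t))" for t
      unfolding Y(2) polar_def cis_conv_exp r_def by (simp add: norm_exp_eq_Re exp_of_real[symmetric] exp_add[symmetric] complex_eq[symmetric] del: exp_of_real)
    have r: "0 < r t" "r t < \<epsilon>" for t using y has_deg_nonzero[of y n t] by (auto simp: r_def)
    have rc: "continuous_on UNIV r" unfolding r_def using y by (intro continuous_intros has_deg_continuous[of y n]) auto
    have rp: "r (t + 2 * pi) = r t" for t using has_deg_periodic[of y n t] y by (simp add: r_def)
    have 1: "has_deg (\<lambda>t. q (Im (Y t))) (n * m)"
      by (rule has_deg_compose_angle[OF m(1)]) (auto simp: Y(3) intro!: continuous_intros Y(1))
    have 2: "has_deg (\<lambda>t. r t ^ N *\<^sub>R q (Im (Y t))) (n * m)"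
      using 1
    proof (rule has_deg_scale_pos)
      show "continuous_on UNIV (\<lambda>t. r t ^ N *\<^sub>R q (Im (Y t)))"
        by (intro continuous_intros rc has_deg_continuous[OF 1])
      show "r (t + 2 * pi) ^ N *\<^sub>R q (Im (Y (t + 2 * pi))) = r t ^ N *\<^sub>R q (Im (Y t))" for t
        using has_deg_periodic[OF 1, of t] rp[of t] by simp
      show "r t ^ N *\<^sub>R q (Im (Y t)) = of_real (r t ^ N) * q (Im (Y t))" for t by (simp add: scaleR_conv_of_real)
      show "0 < r t ^ N" for t using r by simp
    qed
    show "has_deg (\<lambda>t. f (y t)) (n * m)"
      using 2
    proof (rule has_deg_Rouche)
      show "continuous_on UNIV (\<lambda>t. f (y t))"
        by (rule continuous_on_compose2[OF cont_f(1) has_deg_continuous[of y n]]) (use y \<epsilon> R0 in \<open>auto intro: less_trans\<close>, smt (verit) y)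
      show "f (y (t + 2 * pi)) = f (y t)" for t using has_deg_periodic[of y n t] y by simp
      show "norm (f (y t) - r t ^ N *\<^sub>R q (Im (Y t))) < norm (r t ^ N *\<^sub>R q (Im (Y t)))" for t
        using b2[OF r, of t "Im (Y t)"] yp[of t] by simp
    qed
  next
    fix r assume r: "0 < r \<and> r < \<epsilon>"
    have 1: "has_deg (\<lambda>t. r ^ j0 *\<^sub>R p1 t) (m - 1)"
      using p1_degree[OF m(1)]
    proof (rule has_deg_scale_pos)
      show "continuous_on UNIV (\<lambda>t. r ^ j0 *\<^sub>R p1 t)" by (intro continuous_intros q_continuous)
      show "r ^ j0 *\<^sub>R p1 (t + 2 * pi) = r ^ j0 *\<^sub>R p1 t" for t by (simp add: q_periodic)
      show "r ^ j0 *\<^sub>R p1 t = of_real (r ^ j0) * p1 t" for t by (simp add: scaleR_conv_of_real)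
      show "0 < r ^ j0" using r by simp
    qed
    show "has_deg (\<lambda>t. D1 f (polar r t)) (m - 1)"
      using 1
    proof (rule has_deg_Rouche)
      show "continuous_on UNIV (\<lambda>t. D1 f (polar r t))"
        by (rule cont_polar[OF cont_f(2)]) (use r \<epsilon> R0 in \<open>auto intro!: continuous_intros\<close>)
    qed (use b1[of r] r in auto)
  qed
qed

end

theorem local_structure:
  "(\<exists>\<epsilon>>0. \<forall>z. norm z < \<epsilon> \<longrightarrow> f z = 0) \<or>
   (\<exists>\<epsilon>>0. \<exists>m\<ge>1. \<epsilon> \<le> R0 \<and> (\<forall>z. z \<noteq> 0 \<and> norm z < \<epsilon> \<longrightarrow> D1 f z \<noteq> 0) \<and>
     (\<forall>y n. has_deg y n \<and> (\<forall>t. norm (y t) < \<epsilon>) \<longrightarrow> has_deg (\<lambda>t. f (y t)) (n * m)) \<and>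
     (\<forall>r. 0 < r \<and> r < \<epsilon> \<longrightarrow> has_deg (\<lambda>t. D1 f (polar r t)) (m - 1)))"
proof (cases "\<forall>j t. polar_coeff j (D1 f) t = 0 \<and> polar_coeff j (D2 f) t = 0")
  case True
  then show ?thesis using infinite_order_imp_zero by blast
next
  case False
  define P where "P j \<longleftrightarrow> (\<exists>t. \<not> (polar_coeff j (D1 f) t = 0 \<and> polar_coeff j (D2 f) t = 0))" for j
  have "\<exists>j. P j" using False unfolding P_def by blast
  then have j: "P (LEAST j. P j)" "\<And>j. j < (LEAST j. P j) \<Longrightarrow> \<not> P j"
    by (auto intro: LeastI_ex dest: not_less_Least)
  then obtain t1 where "polar_coeff (LEAST j. P j) (D1 f) t1 \<noteq> 0 \<or> polar_coeff (LEAST j. P j) (D2 f) t1 \<noteq> 0"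
    unfolding P_def by blast
  from finite_order_local[OF _ this] j(2) show ?thesis unfolding P_def by blast
qed

end


section \<open>The shape operator in a parametrization\<close>

text \<open>The part r of v outside the span of E1 and E2 is orthogonal to three independent vectors
  of a three-dimensional space.\<close>

lemma orthonormal_expansion_3:
  fixes n E1 E2 v :: "real^3"
  assumes "norm n = 1" "norm E1 = 1" "norm E2 = 1" "n \<bullet> E1 = 0" "n \<bullet> E2 = 0" "E1 \<bullet> E2 = 0" "n \<bullet> v = 0"
  shows "v = (v \<bullet> E1) *\<^sub>R E1 + (v \<bullet> E2) *\<^sub>R E2"
proof -
  define r where "r = v - (v \<bullet> E1) *\<^sub>R E1 - (v \<bullet> E2) *\<^sub>R E2"
  have E: "E1 \<bullet> E1 = 1" "E2 \<bullet> E2 = 1" "n \<bullet> n = 1" using assms by (simp_all add: dot_square_norm)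
  have r: "r \<bullet> n = 0" "r \<bullet> E1 = 0" "r \<bullet> E2 = 0"
    using assms E by (simp_all add: r_def inner_diff_left inner_diff_right inner_commute)
  let ?S = "{n, E1, E2}"
  have ne: "n \<noteq> E1" "n \<noteq> E2" "E1 \<noteq> E2" "0 \<notin> ?S" using assms E by auto
  have po: "pairwise orthogonal ?S"
    using assms by (auto simp: pairwise_def orthogonal_def inner_commute)
  have "independent ?S" by (rule pairwise_orthogonal_independent[OF po ne(4)])
  moreover have "card ?S = 3" using ne by simp
  ultimately have "UNIV \<subseteq> span ?S"
    by (intro card_ge_dim_independent) (auto simp: dim_UNIV)
  then have "r \<in> span ?S" by auto
  moreover have "\<And>x. x \<in> ?S \<Longrightarrow> orthogonal r x" using r by (auto simp: orthogonal_def)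
  ultimately have "orthogonal r r" using orthogonal_to_span by blast
  then have "r = 0" by (simp add: orthogonal_def)
  then show ?thesis by (simp add: r_def algebra_simps)
qed

section \<open>The Gram-Schmidt frame and the complex form of the shape operator\<close>

definition frame1 :: "(complex \<Rightarrow> real^3) \<Rightarrow> real^3" where
  "frame1 D = D 1 /\<^sub>R norm (D 1)"

definition shear :: "(complex \<Rightarrow> real^3) \<Rightarrow> real" where
  "shear D = D \<i> \<bullet> frame1 D"

definition perp :: "(complex \<Rightarrow> real^3) \<Rightarrow> real^3" where
  "perp D = D \<i> - shear D *\<^sub>R frame1 D"

definition frame2 :: "(complex \<Rightarrow> real^3) \<Rightarrow> real^3" where
  "frame2 D = perp D /\<^sub>R norm (perp D)"

text \<open>The inverse of the frame: for injective D, the image of \<open>frame_coord D u\<close>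
  under D has coordinates Re u and Im u in the orthonormal frame. The matrix is triangular with
  positive diagonal.\<close>

definition frame_coord :: "(complex \<Rightarrow> real^3) \<Rightarrow> complex \<Rightarrow> complex" where
  "frame_coord D u = of_real (Re u / norm (D 1)) +
     of_real (Im u / norm (perp D)) * (\<i> - of_real (shear D / norm (D 1)))"

definition half_trace :: "(complex \<Rightarrow> real^3) \<Rightarrow> (complex \<Rightarrow> real^3) \<Rightarrow> real" where
  "half_trace D N = (- N (frame_coord D 1) \<bullet> frame1 D - N (frame_coord D \<i>) \<bullet> frame2 D) / 2"

text \<open>Up to conjugation and a constant factor, the coefficient of the Hopf differential with
  respect to the orthonormal frame: half the difference of the diagonal entries, and the
  off-diagonal entry.\<close>

definition hopf :: "(complex \<Rightarrow> real^3) \<Rightarrow> (complex \<Rightarrow> real^3) \<Rightarrow> complex" where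
  "hopf D N = Complex ((- N (frame_coord D 1) \<bullet> frame1 D + N (frame_coord D \<i>) \<bullet> frame2 D) / 2)
     (- N (frame_coord D 1) \<bullet> frame2 D)"

text \<open>\<open>D\<close> and \<open>N\<close> are the differentials of the immersion and of the unit normal \<open>n\<close> at a point.
  In the orthonormal frame obtained from the coordinate frame by Gram-Schmidt, the
  shape operator becomes \<open>u \<mapsto> H u + h cnj u\<close> with \<open>H = half_trace D N\<close> and \<open>h = hopf D N\<close>.\<close>

locale shape_at =
  fixes D N :: "complex \<Rightarrow> real^3" and n :: "real^3"
  assumes linear_D: "linear D" and linear_N: "linear N" and inj_D: "inj D" and norm_n: "norm n = 1"
    and n_D: "\<And>w. n \<bullet> D w = 0" and n_N: "\<And>w. n \<bullet> N w = 0" and sym: "N 1 \<bullet> D \<i> = N \<i> \<bullet> D 1"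
begin

abbreviation "E1 \<equiv> frame1 D"
abbreviation "E2 \<equiv> frame2 D"
abbreviation "B \<equiv> frame_coord D"
abbreviation "l \<equiv> norm (D 1)"
abbreviation "m \<equiv> shear D"
abbreviation "d \<equiv> norm (perp D)"
abbreviation "H \<equiv> half_trace D N"
abbreviation "h \<equiv> hopf D N"

lemma D_decomp: "D w = Re w *\<^sub>R D 1 + Im w *\<^sub>R D \<i>"
  by (rule linear_complex_decomp[OF linear_D])

lemma N_decomp: "N w = Re w *\<^sub>R N 1 + Im w *\<^sub>R N \<i>"
  by (rule linear_complex_decomp[OF linear_N])

lemma D_eq_0: "D w = 0 \<longleftrightarrow> w = 0"
  using inj_D linear_D by (metis linear_0 injD)

lemma l_pos: "l > 0" using D_eq_0[of 1] by simp

lemma D_1: "D 1 = l *\<^sub>R E1" using l_pos by (simp add: frame1_def)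

lemma D_i: "D \<i> = m *\<^sub>R E1 + d *\<^sub>R E2"
proof (cases "d = 0")
  case True
  then show ?thesis by (simp add: perp_def)
next
  case False
  then show ?thesis by (simp add: frame2_def perp_def)
qed

lemma d_pos: "d > 0"
proof -
  have "perp D = D (\<i> - of_real (m / l))"
    by (subst D_decomp) (simp add: perp_def frame1_def divide_inverse[where 'a=real] del: of_real_divide of_real_mult)
  moreover have "\<i> - of_real (m / l) \<noteq> 0" by (simp add: complex_eq_iff)
  ultimately show ?thesis using D_eq_0 by simp
qed

lemma frame_norm: "norm E1 = 1" "norm E2 = 1"
  using l_pos d_pos by (simp_all add: frame1_def frame2_def)

lemma frame_orth: "E1 \<bullet> E2 = 0"
proof -
  have "E1 \<bullet> E1 = 1" using frame_norm by (simp add: dot_square_norm)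
  then have "E1 \<bullet> perp D = 0" by (simp add: perp_def inner_diff_right shear_def inner_commute)
  then show ?thesis by (simp add: frame2_def)
qed

lemma frame_inner: "E1 \<bullet> E1 = 1" "E2 \<bullet> E2 = 1" "E1 \<bullet> E2 = 0" "E2 \<bullet> E1 = 0"
  using frame_norm frame_orth by (simp_all add: dot_square_norm inner_commute)

lemma n_frame: "n \<bullet> E1 = 0" "n \<bullet> E2 = 0"
  using n_D by (simp_all add: frame1_def frame2_def perp_def inner_diff_right shear_def)

lemma B_linear: "linear B"
  by (intro linearI) (auto simp: frame_coord_def complex_eq_iff algebra_simps add_divide_distrib diff_divide_distrib)

lemma D_B: "D (B u) = Re u *\<^sub>R E1 + Im u *\<^sub>R E2"
proof -
  have "D (B u) = (Re u / l - Im u / d * (m / l)) *\<^sub>R D 1 + (Im u / d) *\<^sub>R D \<i>"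
    by (subst D_decomp) (simp add: frame_coord_def)
  also have "\<dots> = Re u *\<^sub>R E1 + Im u *\<^sub>R E2"
    unfolding D_i using l_pos d_pos by (subst D_1) (simp add: algebra_simps)
  finally show ?thesis .
qed

lemma B_eq_0: "B u = 0 \<longleftrightarrow> u = 0"
proof
  assume "B u = 0"
  then have z: "Re u *\<^sub>R E1 + Im u *\<^sub>R E2 = 0" using D_B[of u] D_eq_0[of 0] by simp
  have "(Re u *\<^sub>R E1 + Im u *\<^sub>R E2) \<bullet> E1 = Re u" "(Re u *\<^sub>R E1 + Im u *\<^sub>R E2) \<bullet> E2 = Im u"
    by (simp_all add: inner_add_left frame_inner)
  then show "u = 0" unfolding z by (simp add: complex_eq_iff)
qed (simp add: frame_coord_def)

lemma B_l: "B (of_real l) = 1"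
  using l_pos by (simp add: frame_coord_def)

lemma B_md: "B (Complex m d) = \<i>"
  using l_pos d_pos by (simp add: frame_coord_def complex_eq_iff)

lemma B_surj: "\<exists>u. w = B u"
proof
  show "w = B (Re w *\<^sub>R of_real l + Im w *\<^sub>R Complex m d)"
    unfolding linear_add[OF B_linear] linear_scale[OF B_linear] B_l B_md by (simp add: complex_eq_iff)
qed

lemma shape_sym: "N v \<bullet> D w = N w \<bullet> D v"
proof -
  have "N v \<bullet> D w - N w \<bullet> D v = (Re v * Im w - Im v * Re w) * (N 1 \<bullet> D \<i> - N \<i> \<bullet> D 1)"
    unfolding D_decomp[of v] D_decomp[of w] N_decomp[of v] N_decomp[of w]
    by (simp add: inner_add_left inner_add_right algebra_simps)
  then show ?thesis using sym by simp
qed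

lemma D_B_basis: "D (B 1) = E1" "D (B \<i>) = E2"
  by (simp_all add: D_B)

lemma N_expand: "N w = (N w \<bullet> E1) *\<^sub>R E1 + (N w \<bullet> E2) *\<^sub>R E2"
  by (rule orthonormal_expansion_3[OF norm_n frame_norm n_frame frame_orth n_N])

text \<open>In the frame the shape operator is a symmetric matrix with entries \<alpha>, \<beta>,
  \<gamma>. Its scalar part is multiplication by H; its traceless part is a reflection scaled by
  |h|, that is, u -> h cnj u.\<close>

lemma shape_B: "- N (B u) = Re (of_real H * u + h * cnj u) *\<^sub>R E1 + Im (of_real H * u + h * cnj u) *\<^sub>R E2"
proof -
  define \<alpha> \<beta> \<gamma> where "\<alpha> = - N (B 1) \<bullet> E1" and "\<beta> = - N (B 1) \<bullet> E2" and "\<gamma> = - N (B \<i>) \<bullet> E2"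
  have \<beta>: "- N (B \<i>) \<bullet> E1 = \<beta>"
    using shape_sym[of "B 1" "B \<i>"] by (simp add: D_B_basis \<beta>_def)
  have u: "u = Re u *\<^sub>R 1 + Im u *\<^sub>R \<i>" by (simp add: complex_eq_iff)
  have "N (B u) = Re u *\<^sub>R N (B 1) + Im u *\<^sub>R N (B \<i>)"
    by (subst u) (simp only: linear_add[OF B_linear] linear_scale[OF B_linear] linear_add[OF linear_N] linear_scale[OF linear_N])
  also have "N (B 1) = - \<alpha> *\<^sub>R E1 - \<beta> *\<^sub>R E2"
    by (subst N_expand) (simp add: \<alpha>_def \<beta>_def)
  also have "N (B \<i>) = - \<beta> *\<^sub>R E1 - \<gamma> *\<^sub>R E2"
    by (subst N_expand) (simp add: \<beta>[symmetric] \<gamma>_def)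
  finally have "- N (B u) = (\<alpha> * Re u + \<beta> * Im u) *\<^sub>R E1 + (\<beta> * Re u + \<gamma> * Im u) *\<^sub>R E2"
    by (simp add: scaleR_add_left scaleR_diff_right scaleR_add_right mult.commute)
  moreover have Hh: "H = (\<alpha> + \<gamma>) / 2" "h = Complex ((\<alpha> - \<gamma>) / 2) \<beta>"
    by (simp_all add: half_trace_def hopf_def \<alpha>_def \<beta>_def \<gamma>_def)
  have "Re (of_real H * u + h * cnj u) = \<alpha> * Re u + \<beta> * Im u"
    "Im (of_real H * u + h * cnj u) = \<beta> * Re u + \<gamma> * Im u"
    unfolding Hh by (simp_all add: field_simps)
  ultimately show ?thesis by (simp only:)
qed

lemma eigen_iff: "- N (B u) = k *\<^sub>R D (B u) \<longleftrightarrow> of_real H * u + h * cnj u = of_real k * u"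
proof
  let ?v = "of_real H * u + h * cnj u"
  assume e: "- N (B u) = k *\<^sub>R D (B u)"
  have "(- N (B u)) \<bullet> E1 = Re ?v" "(- N (B u)) \<bullet> E2 = Im ?v"
    unfolding shape_B inner_add_left inner_scaleR_left frame_inner by simp_all
  moreover have "(k *\<^sub>R D (B u)) \<bullet> E1 = k * Re u" "(k *\<^sub>R D (B u)) \<bullet> E2 = k * Im u"
    unfolding D_B by (simp_all add: inner_add_left frame_inner)
  ultimately have "Re ?v = k * Re u" "Im ?v = k * Im u" unfolding e by auto
  then show "?v = of_real k * u" by (intro complex_eqI) simp_all
next
  assume "of_real H * u + h * cnj u = of_real k * u"
  then show "- N (B u) = k *\<^sub>R D (B u)" unfolding shape_B D_B by (simp add: scaleR_add_right)
qed

text \<open>Taking norms in h cnj u = (k - H) u forces |k - H| = |h|. Conversely, a square root of h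
  and i times this root are eigenvectors for the two signs.\<close>

lemma eigenvalues: "{k. \<exists>w. w \<noteq> 0 \<and> - N w = k *\<^sub>R D w} = {H + norm h, H - norm h}"
proof -
  have "(\<exists>w. w \<noteq> 0 \<and> - N w = k *\<^sub>R D w) \<longleftrightarrow> (\<exists>u. u \<noteq> 0 \<and> of_real H * u + h * cnj u = of_real k * u)" for k
    by (metis B_surj B_eq_0 eigen_iff)
  moreover have "(\<exists>u. u \<noteq> 0 \<and> of_real H * u + h * cnj u = of_real k * u) \<longleftrightarrow> k = H + norm h \<or> k = H - norm h" for k
  proof
    assume "\<exists>u. u \<noteq> 0 \<and> of_real H * u + h * cnj u = of_real k * u"
    then obtain u where u: "u \<noteq> 0" "of_real H * u + h * cnj u = of_real k * u" by blast
    then have "h * cnj u = of_real (k - H) * u" by (simp add: algebra_simps)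
    then have "norm h * norm u = \<bar>k - H\<bar> * norm u" by (metis complex_mod_cnj norm_mult norm_of_real)
    then have "norm h = \<bar>k - H\<bar>" using u by simp
    then show "k = H + norm h \<or> k = H - norm h" by linarith
  next
    define v where "v = csqrt h"
    have v: "h * cnj v = of_real (norm h) * v"
    proof -
      have "h * cnj v = v * (v * cnj v)" by (simp add: v_def power2_eq_square[symmetric] mult.assoc[symmetric])
      also have "\<dots> = v * of_real ((norm v)\<^sup>2)" by (simp only: complex_norm_square)
      also have "(norm v)\<^sup>2 = norm h" by (simp add: v_def norm_power[symmetric])
      finally show ?thesis by simp
    qed
    assume k: "k = H + norm h \<or> k = H - norm h"
    show "\<exists>u. u \<noteq> 0 \<and> of_real H * u + h * cnj u = of_real k * u"
    proof (cases "h = 0")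
      case True
      with k show ?thesis by (intro exI[of _ 1]) auto
    next
      case False
      then have v0: "v \<noteq> 0" by (simp add: v_def)
      from k show ?thesis
      proof
        assume "k = H + norm h"
        then show ?thesis using v v0 by (intro exI[of _ v]) (auto simp: algebra_simps)
      next
        assume "k = H - norm h"
        moreover have "h * cnj (\<i> * v) = - of_real (norm h) * (\<i> * v)" using v by (simp add: mult.left_commute)
        ultimately show ?thesis using v0 by (intro exI[of _ "\<i> * v"]) (simp add: left_diff_distrib)
      qed
    qed
  qed
  ultimately show ?thesis by auto
qed

text \<open>For u = v cis \<tau>, where 2 \<tau> is an argument of h, the map u -> h cnj u acts as
  \<rho> times the conjugation of v. Its eigenvectors are the real and the imaginary v. This halving
  of the argument is the source of half-integer indices.\<close>

lemma principal_lines: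
  assumes h: "h = of_real \<rho> * cis (2 * \<tau>)" "\<rho> > 0"
  shows "{w. - N w = (H + norm h) *\<^sub>R D w} = span {B (cis \<tau>)}"
    and "{w. - N w = (H - norm h) *\<^sub>R D w} = span {B (cis (\<tau> + pi / 2))}"
proof -
  have nh: "norm h = \<rho>" using h by (simp add: norm_mult)
  have hc: "h * cnj (v * cis \<tau>) = of_real \<rho> * (cnj v * cis \<tau>)" for v
  proof -
    have "cis (2 * \<tau>) * cnj (cis \<tau>) = cis \<tau>" by (simp add: cis_cnj cis_mult)
    then show ?thesis unfolding h(1) by (simp add: mult.assoc mult.left_commute[of "cis (2 * \<tau>)"])
  qed
  have img: "{w. - N w = k *\<^sub>R D w} = B ` {u. of_real H * u + h * cnj u = of_real k * u}" for k
    using B_surj eigen_iff by (auto simp: image_iff) metis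
  have sp: "B ` span {x} = span {B x}" for x
    using linear_span_image[OF B_linear, of "{x}"] by simp
  have ex: "\<exists>v. u = v * cis \<tau>" for u by (rule exI[of _ "u / cis \<tau>"]) simp
  have 1: "{u. of_real H * u + h * cnj u = of_real (H + norm h) * u} = span {cis \<tau>}"
  proof -
    have "of_real H * u + h * cnj u = of_real (H + norm h) * u \<longleftrightarrow> u \<in> span {cis \<tau>}" for u
    proof -
      obtain v where v: "u = v * cis \<tau>" using ex by blast
      have "of_real H * u + h * cnj u = of_real (H + norm h) * u \<longleftrightarrow> h * cnj u = of_real \<rho> * u"
        unfolding nh of_real_add distrib_right by simp
      also have "\<dots> \<longleftrightarrow> cnj v = v" unfolding v hc using h(2) by simp
      also have "\<dots> \<longleftrightarrow> (\<exists>x. v = of_real x)" by (metis Reals_cases Reals_cnj_iff complex_cnj_complex_of_real)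
      also have "\<dots> \<longleftrightarrow> u \<in> span {cis \<tau>}" unfolding v by (auto simp: span_singleton scaleR_conv_of_real)
      finally show ?thesis .
    qed
    then show ?thesis by blast
  qed
  have 2: "{u. of_real H * u + h * cnj u = of_real (H - norm h) * u} = span {cis (\<tau> + pi / 2)}"
  proof -
    have "of_real H * u + h * cnj u = of_real (H - norm h) * u \<longleftrightarrow> u \<in> span {cis (\<tau> + pi / 2)}" for u
    proof -
      obtain v where v: "u = v * cis \<tau>" using ex by blast
      have "of_real H * u + h * cnj u = of_real (H - norm h) * u \<longleftrightarrow> h * cnj u = of_real \<rho> * (- u)"
        unfolding nh of_real_diff left_diff_distrib by (auto simp: eq_diff_eq eq_neg_iff_add_eq_0 add.commute)
      also have "\<dots> \<longleftrightarrow> cnj v = - v" unfolding v hc mult_minus_left[symmetric] using h(2)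
        by (simp only: mult_cancel_left mult_cancel_right of_real_eq_0_iff cis_neq_zero less_imp_neq[symmetric] simp_thms)
      also have "\<dots> \<longleftrightarrow> (\<exists>x. v = of_real x * \<i>)"
        by (auto simp: complex_eq_iff intro: exI[of _ "Im v"])
      also have "\<dots> \<longleftrightarrow> u \<in> span {cis (\<tau> + pi / 2)}" unfolding v
        by (auto simp: span_singleton scaleR_conv_of_real cis_mult[symmetric] mult_ac)
      finally show ?thesis .
    qed
    then show ?thesis by blast
  qed
  show "{w. - N w = (H + norm h) *\<^sub>R D w} = span {B (cis \<tau>)}" unfolding img 1 sp ..
  show "{w. - N w = (H - norm h) *\<^sub>R D w} = span {B (cis (\<tau> + pi / 2))}" unfolding img 2 sp ..
qed

text \<open>\<open>B\<close> is triangular with positive diagonal entries 1 / l and 1 / d, so it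
  never reverses a direction. Passing from the frame to the parameter plane thus does not change how
  often a line turns.\<close>

lemma B_cis_quotient: "B (cis s) / cis s \<notin> \<real>\<^sub>\<le>\<^sub>0"
proof
  assume "B (cis s) / cis s \<in> \<real>\<^sub>\<le>\<^sub>0"
  then obtain k where k: "B (cis s) / cis s = of_real k" "k \<le> 0" by (auto elim: nonpos_Reals_cases)
  then have e: "B (cis s) = of_real k * cis s" by (simp add: divide_eq_eq)
  have "sin s / d = k * sin s" using arg_cong[OF e, of Im] by (simp add: frame_coord_def)
  then have "sin s * (1 / d - k) = 0" by (simp add: algebra_simps)
  moreover have "1 / d > 0" using d_pos by simp
  ultimately have s: "sin s = 0" using k by auto
  then have "cos s / l = k * cos s" using arg_cong[OF e, of Re] by (simp add: frame_coord_def)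
  then have "cos s * (1 / l - k) = 0" by (simp add: algebra_simps)
  moreover have "1 / l > 0" using l_pos by simp
  ultimately have "cos s = 0" using k by auto
  then show False using s sin_cos_squared_add[of s] by simp
qed

end


section \<open>Immersed surfaces in charts\<close>

abbreviation "half_trace_at \<Sigma> \<phi> z \<equiv> half_trace (dimm \<Sigma> \<phi> z) (dnrm \<Sigma> \<phi> z)"
abbreviation "hopf_at \<Sigma> \<phi> z \<equiv> hopf (dimm \<Sigma> \<phi> z) (dnrm \<Sigma> \<phi> z)"

lemma frechet_derivative_chain:
  assumes "(\<psi> has_derivative L) (at z)" "(X has_derivative X') (at (\<psi> z))"
    "\<And>z'. z' \<in> W \<Longrightarrow> Y z' = X (\<psi> z')" "open W" "z \<in> W"
  shows "frechet_derivative Y (at z) = X' \<circ> L"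
proof -
  have "((\<lambda>z. X (\<psi> z)) has_derivative (\<lambda>w. X' (L w))) (at z)"
    by (rule has_derivative_compose[OF assms(1,2)])
  then have "(Y has_derivative (\<lambda>w. X' (L w))) (at z)"
    by (rule has_derivative_transform_within_open[OF _ assms(4,5)]) (use assms(3) in auto)
  then show ?thesis using frechet_derivative_at by (metis comp_def ext)
qed

section \<open>Charts, transition maps and principal curvatures\<close>

context
  fixes \<Sigma> :: "'a surface"
  assumes surf: "immersed_surface \<Sigma>"
begin

lemma chartD:
  assumes "(U, \<phi>) \<in> charts \<Sigma>"
  shows "open U" "embedding_map (top_of_set U) (surf_top \<Sigma>) \<phi>" "openin (surf_top \<Sigma>) (\<phi> ` U)"
    "smooth_on U (imm \<Sigma> \<circ> \<phi>)" "smooth_on U (nrm \<Sigma> \<circ> \<phi>)"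
    "\<And>z. z \<in> U \<Longrightarrow> inj (dimm \<Sigma> \<phi> z)" "\<And>z. z \<in> U \<Longrightarrow> norm (nrm \<Sigma> (\<phi> z)) = 1"
    "\<And>z w. z \<in> U \<Longrightarrow> nrm \<Sigma> (\<phi> z) \<bullet> dimm \<Sigma> \<phi> z w = 0"
  using surf assms unfolding immersed_surface_def smooth_atlas_def by (fast, fast, fast, fast, fast, fast, fast, fast)

lemma chart_exists:
  assumes "p \<in> topspace (surf_top \<Sigma>)"
  obtains U \<phi> z where "(U, \<phi>) \<in> charts \<Sigma>" "z \<in> U" "\<phi> z = p"
proof -
  have "(\<Union>(U, \<phi>)\<in>charts \<Sigma>. \<phi> ` U) = topspace (surf_top \<Sigma>)"
    using surf unfolding immersed_surface_def smooth_atlas_def by blast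
  with assms have "\<exists>(U, \<phi>)\<in>charts \<Sigma>. p \<in> \<phi> ` U" by blast
  then show ?thesis using that by auto
qed

lemma chart_in_topspace: "(U, \<phi>) \<in> charts \<Sigma> \<Longrightarrow> z \<in> U \<Longrightarrow> \<phi> z \<in> topspace (surf_top \<Sigma>)"
  using chartD(3) openin_subset by blast

lemma chart_inj: "(U, \<phi>) \<in> charts \<Sigma> \<Longrightarrow> inj_on \<phi> U"
  using chartD(2) homeomorphic_imp_injective_map unfolding embedding_map_def by fastforce

lemma chart_open_image:
  assumes "(U, \<phi>) \<in> charts \<Sigma>" "open W" "W \<subseteq> U"
  shows "openin (surf_top \<Sigma>) (\<phi> ` W)"
proof -
  have "open_map (top_of_set U) (subtopology (surf_top \<Sigma>) (\<phi> ` U)) \<phi>"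
    using chartD(2)[OF assms(1)] homeomorphic_imp_open_map unfolding embedding_map_def by fastforce
  moreover have "openin (top_of_set U) W" using assms chartD(1) by (simp add: openin_open_eq)
  ultimately have "openin (subtopology (surf_top \<Sigma>) (\<phi> ` U)) (\<phi> ` W)" by (simp add: open_map_def)
  then show ?thesis using openin_trans_full chartD(3)[OF assms(1)] by blast
qed

lemma chart_open_preimage:
  assumes "(U, \<phi>) \<in> charts \<Sigma>" "openin (surf_top \<Sigma>) S"
  shows "open {z \<in> U. \<phi> z \<in> S}"
proof -
  have "continuous_map (top_of_set U) (surf_top \<Sigma>) \<phi>"
    using chartD(2)[OF assms(1)] homeomorphic_imp_continuous_map continuous_map_in_subtopology
    unfolding embedding_map_def by blast
  from openin_continuous_map_preimage[OF this assms(2)]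
  have "openin (top_of_set U) {z \<in> U. \<phi> z \<in> S}" by simp
  then show ?thesis using chartD(1)[OF assms(1)] by (simp add: openin_open_eq)
qed

lemma eventually_nhdsin_chartD:
  assumes "(U, \<phi>) \<in> charts \<Sigma>" "z \<in> U" "\<forall>\<^sub>F q in nhdsin (surf_top \<Sigma>) (\<phi> z). P q"
  obtains \<epsilon> where "\<epsilon> > 0" "ball z \<epsilon> \<subseteq> U" "\<And>w. w \<in> ball z \<epsilon> \<Longrightarrow> P (\<phi> w)"
proof -
  obtain S where S: "openin (surf_top \<Sigma>) S" "\<phi> z \<in> S" "\<forall>q\<in>S. P q"
    using assms(3) chart_in_topspace[OF assms(1,2)] by (auto simp: eventually_nhdsin)
  have "open {z \<in> U. \<phi> z \<in> S}" by (rule chart_open_preimage[OF assms(1) S(1)])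
  then obtain \<epsilon> where "\<epsilon> > 0" "ball z \<epsilon> \<subseteq> {z \<in> U. \<phi> z \<in> S}"
    using S(2) assms(2) by (metis (no_types, lifting) mem_Collect_eq openE)
  then show ?thesis using S(3) by (intro that[of \<epsilon>]) auto
qed

lemma eventually_nhdsin_chartI:
  assumes "(U, \<phi>) \<in> charts \<Sigma>" "\<epsilon> > 0" "ball z \<epsilon> \<subseteq> U" "\<And>w. w \<in> ball z \<epsilon> \<Longrightarrow> P (\<phi> w)"
  shows "\<forall>\<^sub>F q in nhdsin (surf_top \<Sigma>) (\<phi> z). P q"
proof -
  have "openin (surf_top \<Sigma>) (\<phi> ` ball z \<epsilon>)" by (rule chart_open_image[OF assms(1) open_ball assms(3)])
  moreover have "\<phi> z \<in> \<phi> ` ball z \<epsilon>" using assms by auto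
  ultimately show ?thesis unfolding eventually_nhdsin using assms(4) by blast
qed

lemma eventually_atin_chartI:
  assumes "(U, \<phi>) \<in> charts \<Sigma>" "\<epsilon> > 0" "ball z \<epsilon> \<subseteq> U" "\<And>w. w \<in> ball z \<epsilon> \<Longrightarrow> w \<noteq> z \<Longrightarrow> P (\<phi> w)"
  shows "\<forall>\<^sub>F q in atin (surf_top \<Sigma>) (\<phi> z). P q"
proof -
  have "openin (surf_top \<Sigma>) (\<phi> ` ball z \<epsilon>)" by (rule chart_open_image[OF assms(1) open_ball assms(3)])
  moreover have "\<phi> z \<in> \<phi> ` ball z \<epsilon>" using assms by auto
  ultimately show ?thesis unfolding eventually_atin using assms(4) by blast
qed

lemma chart_has_derivative:
  assumes "(U, \<phi>) \<in> charts \<Sigma>" "z \<in> U"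
  shows "((imm \<Sigma> \<circ> \<phi>) has_derivative dimm \<Sigma> \<phi> z) (at z)" "((nrm \<Sigma> \<circ> \<phi>) has_derivative dnrm \<Sigma> \<phi> z) (at z)"
  unfolding dimm_def dnrm_def using smooth_on_has_derivative chartD(4,5)[OF assms(1)] assms(2) by blast+

text \<open>Differentiating |n|^2 = 1 makes dn tangent. Differentiating n . dX = 0 expresses dn . dX
  through the second derivatives of X, and their symmetry is that of the shape operator.\<close>

lemma chart_shape_at:
  assumes "(U, \<phi>) \<in> charts \<Sigma>" "z \<in> U"
  shows "shape_at (dimm \<Sigma> \<phi> z) (dnrm \<Sigma> \<phi> z) (nrm \<Sigma> (\<phi> z))"
proof (rule shape_at.intro)
  note c = chartD[OF assms(1)]
  note der = chart_has_derivative[OF assms(1)]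
  show "linear (dimm \<Sigma> \<phi> z)" "linear (dnrm \<Sigma> \<phi> z)" using der[OF assms(2)] has_derivative_linear by blast+
  show "inj (dimm \<Sigma> \<phi> z)" "norm (nrm \<Sigma> (\<phi> z)) = 1" "\<And>w. nrm \<Sigma> (\<phi> z) \<bullet> dimm \<Sigma> \<phi> z w = 0"
    using c(6-8) assms(2) by auto
  show "nrm \<Sigma> (\<phi> z) \<bullet> dnrm \<Sigma> \<phi> z w = 0" for w
  proof -
    have 1: "((\<lambda>z. nrm \<Sigma> (\<phi> z) \<bullet> nrm \<Sigma> (\<phi> z)) has_derivative
        (\<lambda>w. nrm \<Sigma> (\<phi> z) \<bullet> dnrm \<Sigma> \<phi> z w + dnrm \<Sigma> \<phi> z w \<bullet> nrm \<Sigma> (\<phi> z))) (at z)"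
      using has_derivative_inner[OF der(2)[OF assms(2)] der(2)[OF assms(2)]] by (simp add: o_def)
    have "((\<lambda>z. 1::real) has_derivative (\<lambda>w. 0)) (at z)" by simp
    then have "((\<lambda>z. nrm \<Sigma> (\<phi> z) \<bullet> nrm \<Sigma> (\<phi> z)) has_derivative (\<lambda>w. 0)) (at z)"
      by (rule has_derivative_transform_within_open[OF _ c(1) assms(2)]) (use c(7) in \<open>simp add: dot_square_norm\<close>)
    from has_derivative_unique[OF 1 this] have "nrm \<Sigma> (\<phi> z) \<bullet> dnrm \<Sigma> \<phi> z w + dnrm \<Sigma> \<phi> z w \<bullet> nrm \<Sigma> (\<phi> z) = 0"
      by metis
    then show ?thesis by (simp add: inner_commute)
  qed
  have key: "dnrm \<Sigma> \<phi> z v \<bullet> dimm \<Sigma> \<phi> z w = - (nrm \<Sigma> (\<phi> z) \<bullet> frechet_derivative (\<lambda>z. dimm \<Sigma> \<phi> z w) (at z) v)" for v w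
  proof -
    have "smooth_on U (\<lambda>z. dimm \<Sigma> \<phi> z w)" unfolding dimm_def by (rule smooth_on_frechet_derivative[OF c(4)])
    from smooth_on_has_derivative[OF this assms(2)]
    have 1: "((\<lambda>z. nrm \<Sigma> (\<phi> z) \<bullet> dimm \<Sigma> \<phi> z w) has_derivative
        (\<lambda>v. nrm \<Sigma> (\<phi> z) \<bullet> frechet_derivative (\<lambda>z. dimm \<Sigma> \<phi> z w) (at z) v + dnrm \<Sigma> \<phi> z v \<bullet> dimm \<Sigma> \<phi> z w)) (at z)"
      using has_derivative_inner[OF der(2)[OF assms(2)]] by (simp add: o_def)
    have "((\<lambda>z. 0::real) has_derivative (\<lambda>w. 0)) (at z)" by simp
    then have "((\<lambda>z. nrm \<Sigma> (\<phi> z) \<bullet> dimm \<Sigma> \<phi> z w) has_derivative (\<lambda>w. 0)) (at z)"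
      by (rule has_derivative_transform_within_open[OF _ c(1) assms(2)]) (use c(8) in simp)
    from has_derivative_unique[OF 1 this] have "nrm \<Sigma> (\<phi> z) \<bullet> frechet_derivative (\<lambda>z. dimm \<Sigma> \<phi> z w) (at z) v + dnrm \<Sigma> \<phi> z v \<bullet> dimm \<Sigma> \<phi> z w = 0"
      by metis
    then show ?thesis by simp
  qed
  show "dnrm \<Sigma> \<phi> z 1 \<bullet> dimm \<Sigma> \<phi> z \<i> = dnrm \<Sigma> \<phi> z \<i> \<bullet> dimm \<Sigma> \<phi> z 1"
    unfolding key unfolding dimm_def using smooth_on_mixed_partials[OF c(1) assms(2) c(4)] by simp
qed

text \<open>The differential L of the chart change factors both dX and dn, so it carries
  eigenvectors to eigenvectors. It is injective because dX is.\<close>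

lemma transition:
  assumes c1: "(U, \<phi>) \<in> charts \<Sigma>" "z \<in> U" and c2: "(V, \<xi>) \<in> charts \<Sigma>" "w \<in> V" and eq: "\<phi> z = \<xi> w"
  obtains \<psi> W L where "open W" "z \<in> W" "W \<subseteq> U" "continuous_on W \<psi>" "\<psi> z = w"
    "\<And>z'. z' \<in> W \<Longrightarrow> \<psi> z' \<in> V \<and> \<xi> (\<psi> z') = \<phi> z'" "(\<psi> has_derivative L) (at z)" "inj L"
    "dimm \<Sigma> \<phi> z = dimm \<Sigma> \<xi> w \<circ> L" "dnrm \<Sigma> \<phi> z = dnrm \<Sigma> \<xi> w \<circ> L"
proof -
  define W where "W = {z \<in> U. \<phi> z \<in> \<xi> ` V}"
  define \<psi> where "\<psi> = inv_into V \<xi> \<circ> \<phi>"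
  have W: "open W" "z \<in> W" "W \<subseteq> U"
    using chart_open_preimage[OF c1(1) chartD(3)[OF c2(1)]] c1 c2 eq by (auto simp: W_def)
  have sm: "smooth_on W \<psi>"
    using surf c1(1) c2(1) unfolding immersed_surface_def smooth_atlas_def W_def \<psi>_def by fast
  have \<psi>: "\<psi> z' \<in> V \<and> \<xi> (\<psi> z') = \<phi> z'" if "z' \<in> W" for z'
    using that by (auto simp: W_def \<psi>_def inv_into_into f_inv_into_f)
  have \<psi>z: "\<psi> z = w" using eq c2 chart_inj[OF c2(1)] by (simp add: \<psi>_def)
  define L where "L = frechet_derivative \<psi> (at z)"
  have L: "(\<psi> has_derivative L) (at z)" unfolding L_def by (rule smooth_on_has_derivative[OF sm W(2)])
  note d = chart_has_derivative[OF c2]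
  have 1: "dimm \<Sigma> \<phi> z = dimm \<Sigma> \<xi> w \<circ> L"
    unfolding dimm_def[of \<Sigma> \<phi>]
    by (rule frechet_derivative_chain[OF L _ _ W(1,2), of "imm \<Sigma> \<circ> \<xi>"]) (use d \<psi>z \<psi> in auto)
  have 2: "dnrm \<Sigma> \<phi> z = dnrm \<Sigma> \<xi> w \<circ> L"
    unfolding dnrm_def[of \<Sigma> \<phi>]
    by (rule frechet_derivative_chain[OF L _ _ W(1,2), of "nrm \<Sigma> \<circ> \<xi>"]) (use d \<psi>z \<psi> in auto)
  have "inj L" using chartD(6)[OF c1] 1 by (metis inj_on_imageI2)
  from that[OF W smooth_on_imp_continuous_on[OF sm] \<psi>z \<psi> L this 1 2] show ?thesis by blast
qed

text \<open>The definition collects eigenvalues from all charts around the point. A chart change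
  transports eigenvectors without altering the eigenvalue, so a single chart already gives them
  all.\<close>

lemma principal_curvatures_chart:
  assumes c: "(U, \<phi>) \<in> charts \<Sigma>" "z \<in> U"
  shows "principal_curvatures \<Sigma> (\<phi> z) = {half_trace_at \<Sigma> \<phi> z + norm (hopf_at \<Sigma> \<phi> z), half_trace_at \<Sigma> \<phi> z - norm (hopf_at \<Sigma> \<phi> z)}"
proof -
  have "principal_curvatures \<Sigma> (\<phi> z) = {k. \<exists>w. w \<noteq> 0 \<and> - dnrm \<Sigma> \<phi> z w = k *\<^sub>R dimm \<Sigma> \<phi> z w}"
  proof (intro equalityI subsetI)
    fix k assume "k \<in> principal_curvatures \<Sigma> (\<phi> z)"
    then obtain V \<xi> y w where V: "(V, \<xi>) \<in> charts \<Sigma>" "y \<in> V" "\<xi> y = \<phi> z" and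
      w: "w \<noteq> 0" "- dnrm \<Sigma> \<xi> y w = k *\<^sub>R dimm \<Sigma> \<xi> y w"
      unfolding principal_curvatures_def by auto
    obtain L where L: "inj L" "dimm \<Sigma> \<xi> y = dimm \<Sigma> \<phi> z \<circ> L" "dnrm \<Sigma> \<xi> y = dnrm \<Sigma> \<phi> z \<circ> L"
      "linear L"
      using transition[OF V(1,2) c V(3)] has_derivative_linear by metis
    have "L w \<noteq> 0" using L(1,4) w(1) by (metis injD linear_0)
    then show "k \<in> {k. \<exists>w. w \<noteq> 0 \<and> - dnrm \<Sigma> \<phi> z w = k *\<^sub>R dimm \<Sigma> \<phi> z w}"
      using w(2) unfolding L(2,3) by auto
  next
    fix k assume "k \<in> {k. \<exists>w. w \<noteq> 0 \<and> - dnrm \<Sigma> \<phi> z w = k *\<^sub>R dimm \<Sigma> \<phi> z w}"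
    then show "k \<in> principal_curvatures \<Sigma> (\<phi> z)"
      unfolding principal_curvatures_def using c by blast
  qed
  then show ?thesis using shape_at.eigenvalues[OF chart_shape_at[OF c]] by simp
qed

lemma kappa_chart:
  assumes "(U, \<phi>) \<in> charts \<Sigma>" "z \<in> U"
  shows "kappa1 \<Sigma> (\<phi> z) = half_trace_at \<Sigma> \<phi> z + norm (hopf_at \<Sigma> \<phi> z)"
    "kappa2 \<Sigma> (\<phi> z) = half_trace_at \<Sigma> \<phi> z - norm (hopf_at \<Sigma> \<phi> z)"
  unfolding kappa1_def kappa2_def principal_curvatures_chart[OF assms] by (simp_all add: max_def min_def)

lemma umbilic_chart:
  assumes "(U, \<phi>) \<in> charts \<Sigma>" "z \<in> U"
  shows "umbilic \<Sigma> (\<phi> z) \<longleftrightarrow> hopf_at \<Sigma> \<phi> z = 0"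
  unfolding umbilic_def kappa_chart[OF assms] using chart_in_topspace[OF assms] by auto

lemma chart_continuous:
  assumes c: "(U, \<phi>) \<in> charts \<Sigma>"
  shows "continuous_on U (\<lambda>z. dimm \<Sigma> \<phi> z w)" "continuous_on U (\<lambda>z. dnrm \<Sigma> \<phi> z w)"
    "continuous_on U (\<lambda>z. frame1 (dimm \<Sigma> \<phi> z))" "continuous_on U (\<lambda>z. frame2 (dimm \<Sigma> \<phi> z))"
    "continuous_on U (\<lambda>z. perp (dimm \<Sigma> \<phi> z))"
    "continuous_on U (\<lambda>z. shear (dimm \<Sigma> \<phi> z))"
    "continuous_on U (\<lambda>z. half_trace_at \<Sigma> \<phi> z)" "continuous_on U (\<lambda>z. hopf_at \<Sigma> \<phi> z)"
proof -
  note s = chart_shape_at[OF c]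
  show D: "continuous_on U (\<lambda>z. dimm \<Sigma> \<phi> z w)" for w
    unfolding dimm_def by (intro smooth_on_imp_continuous_on smooth_on_frechet_derivative chartD[OF c])
  show N: "continuous_on U (\<lambda>z. dnrm \<Sigma> \<phi> z w)" for w
    unfolding dnrm_def by (intro smooth_on_imp_continuous_on smooth_on_frechet_derivative chartD[OF c])
  have l0: "norm (dimm \<Sigma> \<phi> z 1) \<noteq> 0" "norm (perp (dimm \<Sigma> \<phi> z)) \<noteq> 0" if "z \<in> U" for z
    using shape_at.l_pos[OF s[OF that]] shape_at.d_pos[OF s[OF that]] by auto
  show E1: "continuous_on U (\<lambda>z. frame1 (dimm \<Sigma> \<phi> z))"
    unfolding frame1_def by (intro continuous_intros D ballI l0)
  show m: "continuous_on U (\<lambda>z. shear (dimm \<Sigma> \<phi> z))"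
    unfolding shear_def by (intro continuous_intros D E1)
  show p: "continuous_on U (\<lambda>z. perp (dimm \<Sigma> \<phi> z))"
    unfolding perp_def by (intro continuous_intros D E1 m)
  show E2: "continuous_on U (\<lambda>z. frame2 (dimm \<Sigma> \<phi> z))"
    unfolding frame2_def by (intro continuous_intros p ballI l0)
  have B: "continuous_on U (\<lambda>z. frame_coord (dimm \<Sigma> \<phi> z) u)" for u
    unfolding frame_coord_def by (intro continuous_intros p m D ballI l0)
  \<comment> \<open>The argument of \<open>dnrm\<close> varies with z as well, so it is expanded in
    the fixed basis 1, \<i>.\<close>
  have NB: "continuous_on U (\<lambda>z. dnrm \<Sigma> \<phi> z (frame_coord (dimm \<Sigma> \<phi> z) u))" for u
  proof -
    have "continuous_on U (\<lambda>z. Re (frame_coord (dimm \<Sigma> \<phi> z) u) *\<^sub>R dnrm \<Sigma> \<phi> z 1 + Im (frame_coord (dimm \<Sigma> \<phi> z) u) *\<^sub>R dnrm \<Sigma> \<phi> z \<i>)"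
      by (intro continuous_intros B N)
    then show ?thesis
      by (rule continuous_on_eq) (simp add: shape_at.N_decomp[OF s, symmetric])
  qed
  show "continuous_on U (\<lambda>z. half_trace_at \<Sigma> \<phi> z)"
    unfolding half_trace_def by (intro continuous_intros NB E1 E2) auto
  show "continuous_on U (\<lambda>z. hopf_at \<Sigma> \<phi> z)"
    unfolding hopf_def Complex_eq by (intro continuous_intros NB E1 E2) auto
qed

text \<open>Half the argument of the Hopf coefficient is a continuous angle of the line in the
  frame, with variation pi \<nu>. Passing to the parameter plane multiplies by Q, which is periodic
  and avoids the nonpositive axis, so its argument closes up and the variation is unchanged.\<close>

lemma rotation_index:
  assumes c: "(U, \<phi>) \<in> charts \<Sigma>" and e: "\<epsilon> > 0" "ball z \<epsilon> \<subseteq> U"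
    and deg: "\<And>r. 0 < r \<Longrightarrow> r < \<epsilon> \<Longrightarrow> has_deg (\<lambda>t. hopf_at \<Sigma> \<phi> (z + polar r t)) \<nu>"
    and \<kappa>: "\<kappa> \<in> {kappa1 \<Sigma>, kappa2 \<Sigma>}"
  shows "has_rotation_index (principal_line \<Sigma> \<kappa> \<phi>) z (of_int \<nu> / 2)"
  unfolding has_rotation_index_def
proof (intro exI[of _ \<epsilon>] conjI allI impI e)
  fix r assume r: "0 < r \<and> r < \<epsilon>"
  define y where "y t = z + polar r t" for t
  have yU: "y t \<in> U" for t using e r by (auto simp: y_def dist_norm subset_iff)
  have yc: "continuous_on UNIV y" unfolding y_def by (intro continuous_intros)
  have yp: "y (t + 2 * pi) = y t" for t by (simp add: y_def)
  note s = chart_shape_at[OF c yU]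
  have hd: "has_deg (\<lambda>t. hopf_at \<Sigma> \<phi> (y t)) \<nu>" using deg[of r] r by (simp add: y_def)
  then obtain q where q: "continuous_on UNIV q" "\<And>t. hopf_at \<Sigma> \<phi> (y t) = exp (q t)"
    "\<And>t. q (t + 2 * pi) = q t + 2 * pi * of_int \<nu> * \<i>"
    unfolding has_deg_def by blast
  define \<tau> where "\<tau> t = Im (q t) / 2" for t
  have h: "hopf_at \<Sigma> \<phi> (y t) = of_real (exp (Re (q t))) * cis (2 * \<tau> t)" for t
    unfolding q(2) \<tau>_def by (simp add: exp_eq_polar)
  \<comment> \<open>In the frame the second line field is orthogonal to the first; a constant shift
    does not affect the variation.\<close>
  define a where "a = (if \<kappa> = kappa1 \<Sigma> then 0 else pi / 2)"
  have line: "principal_line \<Sigma> \<kappa> \<phi> (y t) = span {frame_coord (dimm \<Sigma> \<phi> (y t)) (cis (\<tau> t + a))}" for t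
    using \<kappa> shape_at.principal_lines[OF s h, of t] unfolding principal_line_def a_def
    by (auto simp: kappa_chart[OF c yU])
  define Q where "Q t = frame_coord (dimm \<Sigma> \<phi> (y t)) (cis (\<tau> t + a)) / cis (\<tau> t + a)" for t
  have \<tau>c: "continuous_on UNIV \<tau>" unfolding \<tau>_def by (intro continuous_intros q) auto
  have Qc: "continuous_on UNIV Q"
  proof -
    note yc' = continuous_on_compose2[OF _ yc]
    have n: "norm (dimm \<Sigma> \<phi> (y t) 1) \<noteq> 0" "norm (perp (dimm \<Sigma> \<phi> (y t))) \<noteq> 0" for t
      using shape_at.l_pos[OF s] shape_at.d_pos[OF s] by auto
    have "continuous_on UNIV (\<lambda>t. dimm \<Sigma> \<phi> (y t) 1)" "continuous_on UNIV (\<lambda>t. perp (dimm \<Sigma> \<phi> (y t)))"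
      "continuous_on UNIV (\<lambda>t. shear (dimm \<Sigma> \<phi> (y t)))"
      by (rule yc'[OF chart_continuous(1)[OF c]] yc'[OF chart_continuous(5)[OF c]]
          yc'[OF chart_continuous(6)[OF c]]; use yU in auto)+
    then show ?thesis unfolding Q_def frame_coord_def using n
      by (intro continuous_intros \<tau>c) auto
  qed
  have \<tau>p: "\<tau> (t + 2 * pi) = \<tau> t + pi * of_int \<nu>" for t unfolding \<tau>_def q(3) by simp
  have full: "cis (x + 2 * pi * of_int k) = cis x" for x and k :: int
    unfolding cis_mult[symmetric] by (simp add: cis_multiple_2pi)
  \<comment> \<open>For odd \<nu> the representing direction is reversed after one turn; the
    numerator and the denominator of Q then change sign together.\<close>
  have flip: "cis (x + pi * of_int \<nu>) = cis x \<or> cis (x + pi * of_int \<nu>) = - cis x" for x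
  proof (cases "even \<nu>")
    case True
    then obtain k where "\<nu> = 2 * k" by blast
    then have "x + pi * of_int \<nu> = x + 2 * pi * of_int k" by simp
    then show ?thesis by (simp only: full simp_thms)
  next
    case False
    then obtain k where "\<nu> = 2 * k + 1" by (elim oddE)
    then have e: "x + pi * of_int \<nu> = (x + pi) + 2 * pi * of_int k" by (simp add: algebra_simps)
    have "cis (x + pi) = - cis x" by (simp add: cis_mult[symmetric])
    then show ?thesis unfolding e full by simp
  qed
  have Qp: "Q (t + 2 * pi) = Q t" for t
  proof -
    have "linear (frame_coord (dimm \<Sigma> \<phi> (y t)))" by (rule shape_at.B_linear[OF s])
    moreover have e: "\<tau> t + pi * of_int \<nu> + a = (\<tau> t + a) + pi * of_int \<nu>" by simp
    ultimately show ?thesis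
      unfolding Q_def yp \<tau>p e using flip[of "\<tau> t + a"] by (auto simp: linear_neg)
  qed
  have Qn: "Q t \<notin> \<real>\<^sub>\<le>\<^sub>0" for t unfolding Q_def by (rule shape_at.B_cis_quotient[OF s])
  then have Q0: "Q t \<noteq> 0" for t by (metis nonpos_Reals_zero_I)
  define \<theta> where "\<theta> t = \<tau> t + a + Im (Ln (Q t))" for t
  have \<theta>: "frame_coord (dimm \<Sigma> \<phi> (y t)) (cis (\<tau> t + a)) = norm (Q t) *\<^sub>R cis (\<theta> t)" for t
  proof -
    have "frame_coord (dimm \<Sigma> \<phi> (y t)) (cis (\<tau> t + a)) = Q t * cis (\<tau> t + a)" by (simp add: Q_def)
    also have "Q t = of_real (norm (Q t)) * cis (Im (Ln (Q t)))"
      using Q0[of t] by (metis Re_Ln exp_Ln exp_eq_polar exp_ln zero_less_norm_iff)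
    finally show ?thesis by (simp add: \<theta>_def scaleR_conv_of_real cis_mult[symmetric] mult_ac)
  qed
  show "\<exists>\<theta>. continuous_on {0..2*pi} \<theta> \<and>
      (\<forall>t\<in>{0..2*pi}. principal_line \<Sigma> \<kappa> \<phi> (z + of_real r * cis t) = span {cis (\<theta> t)}) \<and>
      (\<theta> (2*pi) - \<theta> 0) / (2*pi) = of_int \<nu> / 2"
  proof (intro exI[of _ \<theta>] conjI ballI)
    show "continuous_on {0..2*pi} \<theta>"
      unfolding \<theta>_def using Qn
      by (intro continuous_intros continuous_on_subset[OF \<tau>c] continuous_on_subset[OF Qc]) auto
    show "principal_line \<Sigma> \<kappa> \<phi> (z + of_real r * cis t) = span {cis (\<theta> t)}" for t
    proof -
      have "span {norm (Q t) *\<^sub>R cis (\<theta> t)} = span {cis (\<theta> t)}"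
        using Q0[of t] span_image_scale[of "{cis (\<theta> t)}" "\<lambda>_. norm (Q t)"] by simp
      then have "principal_line \<Sigma> \<kappa> \<phi> (y t) = span {cis (\<theta> t)}" unfolding line \<theta> .
      then show ?thesis by (simp add: y_def polar_def)
    qed
    have "\<theta> (0 + 2 * pi) = \<theta> 0 + pi * of_int \<nu>" unfolding \<theta>_def \<tau>p Qp by simp
    then show "(\<theta> (2*pi) - \<theta> 0) / (2*pi) = of_int \<nu> / 2" by (simp add: field_simps)
  qed
qed

end

section \<open>Degrees under moving frames and changes of charts\<close>

lemma smooth_on_const: "smooth_on S (\<lambda>x. c)"
proof -
  have "Ck_on k S (\<lambda>x::'a. c :: 'b)" for k and c :: 'b
  proof (induction k arbitrary: c)
    case (Suc k)
    have "frechet_derivative (\<lambda>x::'a. c) (at x) = (\<lambda>v. 0)" for x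
      by (rule frechet_derivative_at[symmetric]) simp
    then show ?case using Suc by simp
  qed simp
  then show ?thesis by (simp add: smooth_on_def)
qed

lemma has_derivative_shift:
  "((\<lambda>z. f (a + z)) has_derivative D) (at z) \<longleftrightarrow> (f has_derivative D) (at (a + z))"
proof
  assume "(f has_derivative D) (at (a + z))"
  moreover have "((\<lambda>z. a + z) has_derivative (\<lambda>h. h)) (at z)" by (auto intro!: derivative_eq_intros)
  ultimately show "((\<lambda>z. f (a + z)) has_derivative D) (at z)"
    using has_derivative_compose by fastforce
next
  assume 1: "((\<lambda>z. f (a + z)) has_derivative D) (at z)"
  have "((\<lambda>w. - a + w) has_derivative (\<lambda>h. h)) (at (a + z))" by (auto intro!: derivative_eq_intros)
  from has_derivative_compose[OF this, of "\<lambda>z. f (a + z)" D] 1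
  show "(f has_derivative D) (at (a + z))" by simp
qed

lemma frechet_derivative_shift: "frechet_derivative (\<lambda>z. f (a + z)) (at z) = frechet_derivative f (at (a + z))"
  unfolding frechet_derivative_def has_derivative_shift ..

lemma smooth_on_shift:
  assumes "smooth_on S f" "\<And>z. z \<in> T \<Longrightarrow> a + z \<in> S"
  shows "smooth_on T (\<lambda>z. f (a + z))"
proof -
  have "Ck_on k S f \<Longrightarrow> Ck_on k T (\<lambda>z. f (a + z))" for k
  proof (induction k arbitrary: f)
    case 0
    then show ?case using assms(2) by (auto intro!: continuous_on_compose2[of S f] continuous_intros)
  next
    case (Suc k)
    then show ?case using assms(2)
      by (auto simp: differentiable_def has_derivative_shift frechet_derivative_shift)
  qed
  then show ?thesis using assms(1) by (auto simp: smooth_on_def)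
qed

definition proj :: "real^3 \<Rightarrow> real^3 \<Rightarrow> real^3 \<Rightarrow> complex" where
  "proj a1 a2 v = Complex (v \<bullet> a1) (v \<bullet> a2)"

lemma bounded_linear_proj: "bounded_linear (proj a1 a2)"
proof -
  have "proj a1 a2 = (\<lambda>v. of_real (v \<bullet> a1) + \<i> * of_real (v \<bullet> a2))"
    by (simp add: fun_eq_iff proj_def Complex_eq)
  then show ?thesis
    by (auto intro!: bounded_linear_add bounded_linear_of_real bounded_linear_compose[OF bounded_linear_of_real]
        bounded_linear_inner_left bounded_linear_compose[OF bounded_linear_mult_right])
qed

lemma linear_proj: "linear (proj a1 a2)"
  by (rule bounded_linear.linear[OF bounded_linear_proj])

lemma det_pairing:
  fixes P Q u v :: complex
  shows "Im (cnj (Re u *\<^sub>R P + Im u *\<^sub>R Q) * (Re v *\<^sub>R P + Im v *\<^sub>R Q)) = Im (cnj P * Q) * Im (cnj u * v)"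
  by (simp add: algebra_simps)

text \<open>The map is \<open>v \<mapsto> A v + C cnj v\<close> with \<open>A = (P - i Q) / 2\<close>, \<open>C = (P + i Q) / 2\<close>, and its
  determinant is \<open>|A|\<^sup>2 - |C|\<^sup>2\<close>.\<close>

lemma has_deg_frame:
  fixes P Q v :: "real \<Rightarrow> complex"
  assumes v: "has_deg v \<nu>"
    and c: "continuous_on UNIV P" "continuous_on UNIV Q" "\<And>t. P (t + 2 * pi) = P t" "\<And>t. Q (t + 2 * pi) = Q t"
    and near: "\<And>t. norm (P t - P0) < e" "\<And>t. norm (Q t - Q0) < e" and e: "e \<le> norm (P0 - \<i> * Q0) / 2"
    and pos: "\<And>t. Im (cnj (P t) * Q t) > 0"
  shows "has_deg (\<lambda>t. Re (v t) *\<^sub>R P t + Im (v t) *\<^sub>R Q t) \<nu>"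
proof -
  have eq: "Re w *\<^sub>R p + Im w *\<^sub>R q = (p - \<i> * q) / 2 * w + (p + \<i> * q) / 2 * cnj w" for p q w :: complex
    by (simp add: complex_eq_iff field_simps)
  have dt: "(norm ((p - \<i> * q) / 2))\<^sup>2 - (norm ((p + \<i> * q) / 2))\<^sup>2 = Im (cnj p * q)" for p q :: complex
    unfolding cmod_power2 by (simp add: field_simps power2_eq_square)
  define A where "A t = (P t - \<i> * Q t) / 2" for t
  have "0 < e" using near(1)[of 0] by (meson le_less_trans norm_ge_zero)
  then have "has_deg (\<lambda>t. (P0 - \<i> * Q0) / 2) 0" using e by (intro has_deg_const) auto
  \<comment> \<open>P and Q stay so close to P0 and Q0 that A remains in a disc around a nonzero
    constant that does not contain 0.\<close>
  then have "has_deg A 0"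
  proof (rule has_deg_Rouche)
    show "continuous_on UNIV A" unfolding A_def by (intro continuous_intros c) auto
    show "A (t + 2 * pi) = A t" for t by (simp add: A_def c)
    show "norm (A t - (P0 - \<i> * Q0) / 2) < norm ((P0 - \<i> * Q0) / 2)" for t
    proof -
      have d: "A t - (P0 - \<i> * Q0) / 2 = ((P t - P0) - \<i> * (Q t - Q0)) / 2" by (simp add: A_def field_simps)
      have "norm (A t - (P0 - \<i> * Q0) / 2) \<le> (norm (P t - P0) + norm (Q t - Q0)) / 2"
        unfolding d using norm_triangle_ineq4[of "P t - P0" "\<i> * (Q t - Q0)"] by (simp add: norm_mult norm_divide)
      also have "\<dots> < e" using near[of t] by simp
      finally show ?thesis using e by (simp add: norm_divide)
    qed
  qed
  from has_deg_mult[OF this v] have "has_deg (\<lambda>t. A t * v t) \<nu>" by simp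
  then show ?thesis
  proof (rule has_deg_Rouche)
    show "continuous_on UNIV (\<lambda>t. Re (v t) *\<^sub>R P t + Im (v t) *\<^sub>R Q t)"
      by (intro continuous_intros c has_deg_continuous[OF v])
    fix t
    show "Re (v (t + 2 * pi)) *\<^sub>R P (t + 2 * pi) + Im (v (t + 2 * pi)) *\<^sub>R Q (t + 2 * pi) = Re (v t) *\<^sub>R P t + Im (v t) *\<^sub>R Q t"
      by (simp only: has_deg_periodic[OF v] c)
    have "(norm ((P t + \<i> * Q t) / 2))\<^sup>2 < (norm (A t))\<^sup>2" using dt[of "P t" "Q t"] pos[of t] unfolding A_def by linarith
    then have "norm ((P t + \<i> * Q t) / 2) < norm (A t)" by (rule power_less_imp_less_base) simp
    then have "norm ((P t + \<i> * Q t) / 2 * cnj (v t)) < norm (A t * v t)"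
      unfolding norm_mult using has_deg_nonzero[OF v, of t] by simp
    then show "norm (Re (v t) *\<^sub>R P t + Im (v t) *\<^sub>R Q t - A t * v t) < norm (A t * v t)"
      unfolding eq A_def by simp
  qed
qed

text \<open>Conjugating v and reversing Q leaves the combination unchanged and flips the sign of the
  determinant.\<close>

lemma has_deg_frame_neg:
  fixes P Q v :: "real \<Rightarrow> complex"
  assumes v: "has_deg v \<nu>"
    and c: "continuous_on UNIV P" "continuous_on UNIV Q" "\<And>t. P (t + 2 * pi) = P t" "\<And>t. Q (t + 2 * pi) = Q t"
    and near: "\<And>t. norm (P t - P0) < e" "\<And>t. norm (Q t - Q0) < e" and e: "e \<le> norm (P0 + \<i> * Q0) / 2"
    and neg: "\<And>t. Im (cnj (P t) * Q t) < 0"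
  shows "has_deg (\<lambda>t. Re (v t) *\<^sub>R P t + Im (v t) *\<^sub>R Q t) (- \<nu>)"
proof -
  have "has_deg (\<lambda>t. Re (cnj (v t)) *\<^sub>R P t + Im (cnj (v t)) *\<^sub>R (- Q t)) (- \<nu>)"
    using has_deg_cnj[OF v] c(1)
  proof (rule has_deg_frame)
    show "continuous_on UNIV (\<lambda>t. - Q t)" by (intro continuous_intros c)
    show "norm (- Q t - - Q0) < e" for t using near(2)[of t] by (simp add: norm_minus_commute)
    show "0 < Im (cnj (P t) * - Q t)" for t using neg[of t] by simp
  qed (use c near e in simp_all)
  then show ?thesis by simp
qed

text \<open>Write L w = \<alpha> w + \<beta> cnj w. Injectivity forces |\<alpha>| \<noteq>
  |\<beta>|, and the larger coefficient decides whether the image of a small circle turns forwards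
  or backwards.\<close>

lemma diffeo_degree:
  assumes W: "open W" "z \<in> W" "continuous_on W \<psi>" and L: "(\<psi> has_derivative L) (at z)" "inj L"
  shows "\<exists>n\<in>{1, -1}. \<exists>\<rho>>0. \<forall>r. 0 < r \<and> r < \<rho> \<longrightarrow> has_deg (\<lambda>t. \<psi> (z + polar r t) - \<psi> z) n"
proof -
  define \<alpha> \<beta> where "\<alpha> = (L 1 - \<i> * L \<i>) / 2" and "\<beta> = (L 1 + \<i> * L \<i>) / 2"
  have lin: "linear L" using L has_derivative_linear by blast
  have Lw: "L w = \<alpha> * w + \<beta> * cnj w" for w
    unfolding linear_complex_decomp[OF lin, of w] \<alpha>_def \<beta>_def by (simp add: complex_eq_iff field_simps)
  have ne: "norm \<alpha> \<noteq> norm \<beta>"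
  proof
    assume eq: "norm \<alpha> = norm \<beta>"
    have "\<exists>w. w \<noteq> 0 \<and> L w = 0"
    proof (cases "\<alpha> = 0")
      case True
      then show ?thesis using eq Lw by (intro exI[of _ 1]) auto
    next
      case False
      \<comment> \<open>A unit vector at which the two terms of L cancel.\<close>
      define w where "w = csqrt (- \<beta> / \<alpha>)"
      have "\<beta> \<noteq> 0" using eq False by auto
      then have n: "(norm w)\<^sup>2 = 1" using eq False by (simp add: w_def norm_power[symmetric] norm_divide)
      then have w0: "w \<noteq> 0" by auto
      have "w * cnj w = 1" using n by (metis complex_norm_square of_real_1)
      then have c: "cnj w = 1 / w" using w0 by (simp add: field_simps)
      have "\<alpha> * w\<^sup>2 + \<beta> = 0" using False by (simp add: w_def)
      then have "L w = 0" unfolding Lw c using w0 by (simp add: field_simps power2_eq_square)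
      then show ?thesis using w0 by blast
    qed
    then show False using L(2) lin by (metis injD linear_0)
  qed
  \<comment> \<open>Half the gap between the coefficients: a linearisation error below 2 e r leaves
    the dominant term ahead on the circle of radius r.\<close>
  define e where "e = \<bar>norm \<alpha> - norm \<beta>\<bar> / 2"
  have e: "e > 0" using ne by (simp add: e_def)
  obtain d1 where d1: "d1 > 0" "ball z d1 \<subseteq> W" using W by (meson openE)
  obtain d2 where d2: "d2 > 0" "\<And>y. norm (y - z) < d2 \<Longrightarrow> norm (\<psi> y - \<psi> z - L (y - z)) \<le> e * norm (y - z)"
    using L(1) e unfolding has_derivative_at_alt by blast
  define \<rho> where "\<rho> = min d1 d2"
  have \<rho>: "\<rho> > 0" using d1 d2 by (simp add: \<rho>_def)
  have cont: "continuous_on UNIV (\<lambda>t. \<psi> (z + polar r t) - \<psi> z)" if "0 < r" "r < \<rho>" for r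
  proof (intro continuous_intros continuous_on_compose2[OF W(3)])
    show "(\<lambda>t. z + polar r t) ` UNIV \<subseteq> W" using that d1(2) by (auto simp: \<rho>_def dist_norm)
  qed
  have bd: "norm (\<psi> (z + y) - \<psi> z - L y) < 2 * e * norm y" if "y \<noteq> 0" "norm y < \<rho>" for y
  proof -
    have "norm (\<psi> (z + y) - \<psi> z - L y) \<le> e * norm y" using d2(2)[of "z + y"] that by (simp add: \<rho>_def)
    also have "\<dots> < 2 * e * norm y" using e that by simp
    finally show ?thesis .
  qed
  have core: "has_deg (\<lambda>t. \<psi> (z + polar r t) - \<psi> z) n"
    if r: "0 < r" "r < \<rho>" and a: "norm a - norm b = 2 * e" and u: "has_deg u n" "\<And>t. norm (u t) = r"
      and Lu: "\<And>t. L (polar r t) = a * u t + b * cnj (u t)" for r n u and a b :: complex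
  proof (rule has_deg_Rouche)
    have "0 < norm a" using a e norm_ge_zero[of b] by linarith
    then show "has_deg (\<lambda>t. a * u t) n"
      using has_deg_mult[OF has_deg_const u(1), of a] by simp
    show "norm (\<psi> (z + polar r t) - \<psi> z - a * u t) < norm (a * u t)" for t
    proof -
      have "norm (polar r t) = r" using r by simp
      then have n1: "norm (\<psi> (z + polar r t) - \<psi> z - L (polar r t)) < 2 * e * r"
        using bd[of "polar r t"] r by (metis less_irrefl norm_zero)
      have n2: "norm (b * cnj (u t)) = norm b * r" using u by (simp add: norm_mult)
      have d: "\<psi> (z + polar r t) - \<psi> z - a * u t = (\<psi> (z + polar r t) - \<psi> z - L (polar r t)) + b * cnj (u t)"
        unfolding Lu by simp
      have "norm (\<psi> (z + polar r t) - \<psi> z - a * u t) < 2 * e * r + norm b * r"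
        unfolding d using n1 n2 norm_triangle_ineq[of "\<psi> (z + polar r t) - \<psi> z - L (polar r t)" "b * cnj (u t)"] by linarith
      also have "\<dots> = norm (a * u t)" unfolding a[symmetric] by (simp add: norm_mult u left_diff_distrib)
      finally show ?thesis .
    qed
  qed (use cont[OF r] in auto)
  show ?thesis
  proof (cases "norm \<alpha> > norm \<beta>")
    case True
    have "has_deg (\<lambda>t. \<psi> (z + polar r t) - \<psi> z) 1" if r: "0 < r" "r < \<rho>" for r
      by (rule core[OF r _ has_deg_polar[OF r(1)], of \<alpha> \<beta>]) (use True r Lw in \<open>auto simp: e_def\<close>)
    then show ?thesis using \<rho> by blast
  next
    case False
    have "has_deg (\<lambda>t. \<psi> (z + polar r t) - \<psi> z) (- 1)" if r: "0 < r" "r < \<rho>" for r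
      by (rule core[OF r _ has_deg_cnj[OF has_deg_polar[OF r(1)]], of \<beta> \<alpha>]) (use False r Lw in \<open>auto simp: e_def\<close>)
    then show ?thesis using \<rho> by blast
  qed
qed


section \<open>Isolated umbilics\<close>

text \<open>Defined on the surface, with a1 and a2 fixed vectors of space, so that all charts see
  one and the same map and its local degrees can be compared.\<close>

definition focal :: "'a surface \<Rightarrow> real \<Rightarrow> real^3 \<Rightarrow> real^3 \<Rightarrow> 'a \<Rightarrow> complex" where
  "focal \<Sigma> c a1 a2 p = proj a1 a2 (nrm \<Sigma> p + c *\<^sub>R imm \<Sigma> p)"

text \<open>In the frame, df is - R (s u + h cnj u), with R the projection of the tangent plane and
  |s| \<le> k |h|. The conjugate part dominates, so relative to R the map reverses orientation with
  bounded distortion. The second alternative also records the degrees of loops under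
  \<open>focal\<close>, up to one sign, for the comparison of charts.\<close>

theorem chart_dichotomy:
  fixes \<Sigma> :: "'a surface"
  assumes surf: "immersed_surface \<Sigma>" and c: "(U, \<phi>) \<in> charts \<Sigma>" "z0 \<in> U"
    and k: "0 \<le> k" "k < 1"
    and cond: "\<forall>\<^sub>F z in nhds z0. \<bar>half_trace_at \<Sigma> \<phi> z - c\<bar> \<le> k * norm (hopf_at \<Sigma> \<phi> z)"
    and nd: "\<And>w. proj a1 a2 (dimm \<Sigma> \<phi> z0 w) = 0 \<Longrightarrow> w = 0"
  shows "(\<exists>\<epsilon>>0. ball z0 \<epsilon> \<subseteq> U \<and> (\<forall>z\<in>ball z0 \<epsilon>. hopf_at \<Sigma> \<phi> z = 0)) \<or>
    (\<exists>\<epsilon>>0. \<exists>m\<ge>1. ball z0 \<epsilon> \<subseteq> U \<and> (\<forall>z\<in>ball z0 \<epsilon>. z \<noteq> z0 \<longrightarrow> hopf_at \<Sigma> \<phi> z \<noteq> 0) \<and>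
      (\<forall>r. 0 < r \<and> r < \<epsilon> \<longrightarrow> has_deg (\<lambda>t. hopf_at \<Sigma> \<phi> (z0 + polar r t)) (1 - m)) \<and>
      (\<exists>s\<in>{1, -1}. \<forall>y n. has_deg y n \<and> (\<forall>t. norm (y t) < \<epsilon>) \<longrightarrow>
          has_deg (\<lambda>t. focal \<Sigma> c a1 a2 (\<phi> (z0 + y t)) - focal \<Sigma> c a1 a2 (\<phi> z0)) (s * (n * m))))"
proof -
  note ch = chartD[OF surf c(1)]
  note sh = chart_shape_at[OF surf c(1)]
  note cc = chart_continuous[OF surf c(1)]
  define h s where "h z = hopf_at \<Sigma> \<phi> z" and "s z = half_trace_at \<Sigma> \<phi> z - c" for z
  define l m d where "l z = norm (dimm \<Sigma> \<phi> z 1)" and "m z = shear (dimm \<Sigma> \<phi> z)" and "d z = norm (perp (dimm \<Sigma> \<phi> z))" for z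
  define P Q where "P z = proj a1 a2 (frame1 (dimm \<Sigma> \<phi> z))" and "Q z = proj a1 a2 (frame2 (dimm \<Sigma> \<phi> z))" for z
  define R where "R z u = Re u *\<^sub>R P z + Im u *\<^sub>R Q z" for z u
  define \<Delta> where "\<Delta> z = Im (cnj (P z) * Q z)" for z
  define f where "f z = focal \<Sigma> c a1 a2 (\<phi> z)" for z
  have ld: "l z > 0" "d z > 0" if "z \<in> U" for z
    using shape_at.l_pos[OF sh[OF that]] shape_at.d_pos[OF sh[OF that]] by (auto simp: l_def d_def)
  have cPQ: "continuous_on U P" "continuous_on U Q" "continuous_on U \<Delta>"
    unfolding P_def Q_def \<Delta>_def
    by (intro continuous_intros bounded_linear.continuous_on[OF bounded_linear_proj] cc)+
  have chs: "continuous_on U h" "continuous_on U s" unfolding h_def s_def by (intro continuous_intros cc)+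
  have clmd: "continuous_on U l" "continuous_on U m" "continuous_on U d"
    unfolding l_def m_def d_def by (intro continuous_intros cc)+
  have det: "Im (cnj (R z u) * R z v) = \<Delta> z * Im (cnj u * v)" for z u v
    unfolding R_def \<Delta>_def by (rule det_pairing)
  have R_inj: "u = 0" if "\<Delta> z \<noteq> 0" "R z u = 0" for z u
  proof -
    have "0 = \<Delta> z * Im (cnj u * (\<i> * u))" using det[of z u "\<i> * u"] that by simp
    then have "Im (cnj u * (\<i> * u)) = 0" using that by simp
    moreover have "Im (cnj u * (\<i> * u)) = (norm u)\<^sup>2" unfolding cmod_power2 by (simp add: power2_eq_square)
    ultimately show ?thesis by simp
  qed
  have fsm: "smooth_on U f"
  proof -
    have "smooth_on U (\<lambda>z. (nrm \<Sigma> \<circ> \<phi>) z + c *\<^sub>R (imm \<Sigma> \<circ> \<phi>) z)"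
      by (intro smooth_on_add ch smooth_on_bounded_linear_compose[OF _ bounded_linear_scaleR_right])
    from smooth_on_bounded_linear_compose[OF ch(1) bounded_linear_proj this]
    show ?thesis unfolding f_def focal_def by simp
  qed
  have fD: "(f has_derivative (\<lambda>w. proj a1 a2 (dnrm \<Sigma> \<phi> z w + c *\<^sub>R dimm \<Sigma> \<phi> z w))) (at z)" if "z \<in> U" for z
  proof -
    have "((\<lambda>z. (nrm \<Sigma> \<circ> \<phi>) z + c *\<^sub>R (imm \<Sigma> \<circ> \<phi>) z) has_derivative (\<lambda>w. dnrm \<Sigma> \<phi> z w + c *\<^sub>R dimm \<Sigma> \<phi> z w)) (at z)"
      by (intro derivative_intros chart_has_derivative[OF surf c(1) that])
    from bounded_linear.has_derivative[OF bounded_linear_proj this] show ?thesis unfolding f_def focal_def by simp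
  qed
  have pE: "proj a1 a2 (Re v *\<^sub>R frame1 (dimm \<Sigma> \<phi> z) + Im v *\<^sub>R frame2 (dimm \<Sigma> \<phi> z)) = R z v" for z v
    unfolding R_def P_def Q_def by (simp add: linear_add[OF linear_proj] linear_scale[OF linear_proj])
  have dfB: "frechet_derivative f (at z) (frame_coord (dimm \<Sigma> \<phi> z) u) = - R z (of_real (s z) * u + h z * cnj u)"
    if z: "z \<in> U" for z u
  proof -
    let ?B = "frame_coord (dimm \<Sigma> \<phi> z) u"
    have "frechet_derivative f (at z) ?B = proj a1 a2 (dnrm \<Sigma> \<phi> z ?B + c *\<^sub>R dimm \<Sigma> \<phi> z ?B)"
      using frechet_derivative_at[OF fD[OF z]] by metis
    also have "dnrm \<Sigma> \<phi> z ?B + c *\<^sub>R dimm \<Sigma> \<phi> z ?B = - (- dnrm \<Sigma> \<phi> z ?B - c *\<^sub>R dimm \<Sigma> \<phi> z ?B)" by simp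
    also have "- dnrm \<Sigma> \<phi> z ?B - c *\<^sub>R dimm \<Sigma> \<phi> z ?B =
        Re (of_real (s z) * u + h z * cnj u) *\<^sub>R frame1 (dimm \<Sigma> \<phi> z) + Im (of_real (s z) * u + h z * cnj u) *\<^sub>R frame2 (dimm \<Sigma> \<phi> z)"
      unfolding shape_at.shape_B[OF sh[OF z]] shape_at.D_B[OF sh[OF z]] s_def h_def by (simp add: algebra_simps)
    also have "proj a1 a2 (- \<dots>) = - R z (of_real (s z) * u + h z * cnj u)"
      unfolding linear_neg[OF linear_proj] pE ..
    finally show ?thesis .
  qed
  have df1: "D1 f z = - R z (of_real (l z) * (of_real (s z) + h z))" if "z \<in> U" for z
    using dfB[OF that, of "of_real (l z)"] shape_at.B_l[OF sh[OF that]] by (simp add: l_def algebra_simps)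
  have df2: "D2 f z = - R z (of_real (s z) * Complex (m z) (d z) + h z * cnj (Complex (m z) (d z)))" if "z \<in> U" for z
    using dfB[OF that, of "Complex (m z) (d z)"] shape_at.B_md[OF sh[OF that]] by (simp add: m_def d_def)
  have Jf: "Im (cnj (D1 f z) * D2 f z) = \<Delta> z * (l z * d z * ((s z)\<^sup>2 - (norm (h z))\<^sup>2))" if "z \<in> U" for z
  proof -
    have "Im (cnj (D1 f z) * D2 f z) = Im (cnj (R z (of_real (l z) * (of_real (s z) + h z))) *
        R z (of_real (s z) * Complex (m z) (d z) + h z * cnj (Complex (m z) (d z))))"
      unfolding df1[OF that] df2[OF that] by simp
    also have "\<dots> = \<Delta> z * Im (cnj (of_real (l z) * (of_real (s z) + h z)) * (of_real (s z) * Complex (m z) (d z) + h z * cnj (Complex (m z) (d z))))"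
      by (rule det)
    also have "Im (cnj (of_real (l z) * (of_real (s z) + h z)) * (of_real (s z) * Complex (m z) (d z) + h z * cnj (Complex (m z) (d z))))
        = l z * d z * ((s z)\<^sup>2 - (norm (h z))\<^sup>2)"
      unfolding cmod_power2 by (simp add: algebra_simps power2_eq_square)
    finally show ?thesis .
  qed
  \<comment> \<open>G |h|^2 bounds |df|^2, while the Jacobian has absolute value T (|h|^2 - s^2)
    with T as defined below. G and T are continuous, so near z0 they are controlled by their values
    at z0.\<close>
  define G where "G z = (norm (P z) + norm (Q z))\<^sup>2 * (4 * ((l z)\<^sup>2 + (norm (Complex (m z) (d z)))\<^sup>2))" for z
  have R_norm: "norm (R z u) \<le> (norm (P z) + norm (Q z)) * norm u" for z u
  proof -
    have "norm (R z u) \<le> \<bar>Re u\<bar> * norm (P z) + \<bar>Im u\<bar> * norm (Q z)"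
      unfolding R_def by (rule norm_triangle_le) simp
    also have "\<dots> \<le> norm u * norm (P z) + norm u * norm (Q z)"
      by (intro add_mono mult_right_mono abs_Re_le_cmod abs_Im_le_cmod) auto
    finally show ?thesis by (simp add: algebra_simps)
  qed
  have Gf: "(norm (D1 f z))\<^sup>2 + (norm (D2 f z))\<^sup>2 \<le> G z * (norm (h z))\<^sup>2" if z: "z \<in> U" and sh': "\<bar>s z\<bar> \<le> norm (h z)" for z
  proof -
    have R: "(norm (R z (of_real (s z) * u + h z * cnj v)))\<^sup>2 \<le> (norm (P z) + norm (Q z))\<^sup>2 * (4 * (norm u)\<^sup>2) * (norm (h z))\<^sup>2"
      if "norm u = norm v" for u v
    proof -
      have "norm (of_real (s z) * u + h z * cnj v) \<le> \<bar>s z\<bar> * norm u + norm (h z) * norm u"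
        using norm_triangle_ineq[of "of_real (s z) * u" "h z * cnj v"] that by (simp add: norm_mult)
      also have "\<dots> \<le> norm (h z) * norm u + norm (h z) * norm u" using sh' by (intro add_mono mult_right_mono) auto
      finally have "norm (R z (of_real (s z) * u + h z * cnj v)) \<le> (norm (P z) + norm (Q z)) * (2 * norm u * norm (h z))"
        by (intro order_trans[OF R_norm] mult_left_mono) auto
      then have "(norm (R z (of_real (s z) * u + h z * cnj v)))\<^sup>2 \<le> ((norm (P z) + norm (Q z)) * (2 * norm u * norm (h z)))\<^sup>2"
        by (intro power_mono) auto
      then show ?thesis by (simp add: power_mult_distrib mult_ac)
    qed
    have "of_real (l z) * (of_real (s z) + h z) = of_real (s z) * of_real (l z) + h z * cnj (of_real (l z))"
      by (simp add: algebra_simps)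
    then have "(norm (D1 f z))\<^sup>2 \<le> (norm (P z) + norm (Q z))\<^sup>2 * (4 * (l z)\<^sup>2) * (norm (h z))\<^sup>2"
      using R[of "of_real (l z)" "of_real (l z)"] unfolding df1[OF z] norm_minus_cancel by simp
    moreover have "(norm (D2 f z))\<^sup>2 \<le> (norm (P z) + norm (Q z))\<^sup>2 * (4 * (norm (Complex (m z) (d z)))\<^sup>2) * (norm (h z))\<^sup>2"
      using R[of "Complex (m z) (d z)" "Complex (m z) (d z)"] unfolding df2[OF z] norm_minus_cancel by simp
    ultimately show ?thesis unfolding G_def by (simp only: distrib_left distrib_right)
  qed
  have \<Delta>0: "\<Delta> z0 \<noteq> 0"
  proof
    assume z: "\<Delta> z0 = 0"
    have "\<exists>u. u \<noteq> 0 \<and> R z0 u = 0"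
    proof (cases "P z0 = 0")
      case True
      then show ?thesis by (intro exI[of _ 1]) (simp add: R_def)
    next
      case False
      define x where "x = Re (cnj (P z0) * Q z0)"
      have "cnj (P z0) * Q z0 = of_real x"
        using z unfolding \<Delta>_def x_def by (intro complex_eqI) (simp_all del: times_complex.sel)
      then have "P z0 * (cnj (P z0) * Q z0) = of_real x * P z0" by (simp add: mult.commute)
      then have "of_real ((norm (P z0))\<^sup>2) * Q z0 = of_real x * P z0"
        by (simp only: complex_norm_square mult.assoc)
      then have "R z0 (Complex (- x) ((norm (P z0))\<^sup>2)) = 0" by (simp add: R_def scaleR_conv_of_real)
      then show ?thesis using False
        by (intro exI[of _ "Complex (- x) ((norm (P z0))\<^sup>2)"]) (auto simp: complex_eq_iff)
    qed
    then obtain u where u: "u \<noteq> 0" "R z0 u = 0" by blast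
    then have "proj a1 a2 (dimm \<Sigma> \<phi> z0 (frame_coord (dimm \<Sigma> \<phi> z0) u)) = 0"
      using pE[of u z0] by (simp add: shape_at.D_B[OF sh[OF c(2)]])
    then have "frame_coord (dimm \<Sigma> \<phi> z0) u = 0" by (rule nd)
    then show False using u shape_at.B_eq_0[OF sh[OF c(2)]] by simp
  qed
  define T where "T z = \<bar>\<Delta> z\<bar> * (l z * d z)" for z
  have T0: "T z0 > 0" using \<Delta>0 ld[OF c(2)] by (simp add: T_def)
  \<comment> \<open>The closeness required by \<open>has_deg_frame\<close> or
    \<open>has_deg_frame_neg\<close>; the combination that matters is nonzero because \<Delta> z0
    is.\<close>
  define e where "e = (if \<Delta> z0 > 0 then norm (P z0 - \<i> * Q z0) / 2 else norm (P z0 + \<i> * Q z0) / 2)"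
  have e: "e > 0"
  proof -
    have "(norm (p - \<i> * q))\<^sup>2 - (norm (p + \<i> * q))\<^sup>2 = 4 * Im (cnj p * q)" for p q :: complex
      unfolding cmod_power2 by (simp add: field_simps power2_eq_square)
    from this[of "P z0" "Q z0"]
    have eq: "(norm (P z0 - \<i> * Q z0))\<^sup>2 - (norm (P z0 + \<i> * Q z0))\<^sup>2 = 4 * \<Delta> z0" unfolding \<Delta>_def .
    show ?thesis
    proof (cases "\<Delta> z0 > 0")
      case True
      then have "0 < (norm (P z0 - \<i> * Q z0))\<^sup>2" using eq zero_le_power2[of "norm (P z0 + \<i> * Q z0)"] by linarith
      then show ?thesis using True by (simp add: e_def)
    next
      case False
      then have "0 < (norm (P z0 + \<i> * Q z0))\<^sup>2" using \<Delta>0 eq zero_le_power2[of "norm (P z0 - \<i> * Q z0)"] by linarith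
      then show ?thesis using False by (simp add: e_def)
    qed
  qed
  have lim: "(F \<longlongrightarrow> F z0) (nhds z0)" if "continuous_on U F" for F :: "complex \<Rightarrow> 'b::topological_space"
    using that c(2) ch(1) by (metis continuous_on_eq_continuous_at isCont_def tendsto_at_iff_tendsto_nhds)
  have ev: "\<forall>\<^sub>F z in nhds z0. \<bar>s z\<bar> \<le> k * norm (h z) \<and> z \<in> U \<and> G z < G z0 + 1 \<and> T z0 / 2 < T z \<and>
      0 < \<Delta> z * \<Delta> z0 \<and> dist (P z) (P z0) < e \<and> dist (Q z) (Q z0) < e"
  proof (intro eventually_conj)
    show "\<forall>\<^sub>F z in nhds z0. \<bar>s z\<bar> \<le> k * norm (h z)" using cond by (simp add: s_def h_def)
    show "\<forall>\<^sub>F z in nhds z0. z \<in> U" using ch(1) c(2) by (rule eventually_nhds_in_open)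
    have "continuous_on U G" unfolding G_def Complex_eq by (intro continuous_intros cPQ clmd)
    then show "\<forall>\<^sub>F z in nhds z0. G z < G z0 + 1" by (intro order_tendstoD(2)[OF lim]) auto
    have "continuous_on U T" unfolding T_def by (intro continuous_intros cPQ clmd)
    then show "\<forall>\<^sub>F z in nhds z0. T z0 / 2 < T z" using T0 by (intro order_tendstoD(1)[OF lim]) auto
    have "continuous_on U (\<lambda>z. \<Delta> z * \<Delta> z0)" by (intro continuous_intros cPQ)
    then show "\<forall>\<^sub>F z in nhds z0. 0 < \<Delta> z * \<Delta> z0"
      using \<Delta>0 by (intro order_tendstoD(1)[OF lim[of "\<lambda>z. \<Delta> z * \<Delta> z0"]]) (auto simp: zero_less_mult_iff)
    show "\<forall>\<^sub>F z in nhds z0. dist (P z) (P z0) < e" "\<forall>\<^sub>F z in nhds z0. dist (Q z) (Q z0) < e"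
      using tendstoD[OF lim[OF cPQ(1)] e] tendstoD[OF lim[OF cPQ(2)] e] by auto
  qed
  then obtain \<epsilon>1 where \<epsilon>1: "\<epsilon>1 > 0" and b: "\<And>z. dist z z0 < \<epsilon>1 \<Longrightarrow> \<bar>s z\<bar> \<le> k * norm (h z) \<and> z \<in> U \<and> G z < G z0 + 1 \<and> T z0 / 2 < T z \<and>
      0 < \<Delta> z * \<Delta> z0 \<and> dist (P z) (P z0) < e \<and> dist (Q z) (Q z0) < e"
    unfolding eventually_nhds_metric by blast
  have sh_le: "\<bar>s z\<bar> \<le> norm (h z)" if "dist z z0 < \<epsilon>1" for z
  proof -
    have "k * norm (h z) \<le> 1 * norm (h z)" using k by (intro mult_right_mono) auto
    then show ?thesis using b[OF that] by linarith
  qed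
  have h0_iff: "D1 f z = 0 \<longleftrightarrow> h z = 0" if z: "dist z z0 < \<epsilon>1" for z
  proof
    assume "D1 f z = 0"
    then have "R z (of_real (l z) * (of_real (s z) + h z)) = 0" using df1 b[OF z] by simp
    moreover have "\<Delta> z \<noteq> 0" using b[OF z] by auto
    ultimately have "of_real (l z) * (of_real (s z) + h z) = 0" by (rule R_inj[rotated])
    then have "of_real (s z) + h z = 0" using ld[of z] b[OF z] by simp
    then have "h z = - of_real (s z)" by (simp add: add_eq_0_iff)
    then have "norm (h z) = \<bar>s z\<bar>" by simp
    then have "norm (h z) \<le> k * norm (h z)" using b[OF z] by simp
    then have "(1 - k) * norm (h z) \<le> 0" by (simp add: algebra_simps)
    then show "h z = 0" using k by (simp add: mult_le_0_iff)
  next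
    assume "h z = 0"
    then show "D1 f z = 0" using df1[of z] sh_le[OF z] b[OF z] by (simp add: R_def)
  qed
  \<comment> \<open>The Jacobian of f never has the sign of \<Delta>. Conjugating exactly when
    \<Delta> z0 > 0 makes the Jacobian of \<open>ft\<close> nonnegative.\<close>
  define cj where "cj = (if \<Delta> z0 > 0 then cnj else (\<lambda>w. w))"
  have cj: "bounded_linear cj" "\<And>w. norm (cj w) = norm w" "\<And>w. cj w = 0 \<longleftrightarrow> w = 0"
    by (auto simp: cj_def bounded_linear_cnj)
  have J_cj: "Im (cnj (cj u) * cj v) = (if \<Delta> z0 > 0 then - 1 else 1) * Im (cnj u * v)" for u v
    by (simp add: cj_def)
  define ft where "ft z = cj (f (z0 + z) + - f z0)" for z
  have inU: "z0 + z \<in> U" "dist (z0 + z) z0 < \<epsilon>1" if "norm z < \<epsilon>1" for z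
    using b[of "z0 + z"] that by (auto simp: dist_norm)
  have Dft: "frechet_derivative ft (at z) w = cj (frechet_derivative f (at (z0 + z)) w)" if "norm z < \<epsilon>1" for z w
  proof -
    have "((\<lambda>z. f (z0 + z)) has_derivative frechet_derivative f (at (z0 + z))) (at z)"
      unfolding has_derivative_shift by (rule smooth_on_has_derivative[OF fsm inU(1)[OF that]])
    from has_derivative_add[OF this has_derivative_const[of "- f z0"]]
    have "((\<lambda>z. f (z0 + z) + - f z0) has_derivative frechet_derivative f (at (z0 + z))) (at z)" by simp
    from bounded_linear.has_derivative[OF cj(1) this]
    have "(ft has_derivative (\<lambda>w. cj (frechet_derivative f (at (z0 + z)) w))) (at z)" unfolding ft_def .
    from frechet_derivative_at[OF this] show ?thesis by metis
  qed
  \<comment> \<open>The bound s^2 \<le> k^2 |h|^2 leaves the factor 1 - k^2 in the Jacobian, T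
    exceeds half its value at z0, and G is below its value there plus 1.\<close>
  define K where "K = (G z0 + 1) / ((1 - k\<^sup>2) * (T z0 / 2))"
  have k2: "1 - k\<^sup>2 > 0" using k by (simp add: power_less_one_iff abs_square_less_1)
  have G0: "G z \<ge> 0" for z unfolding G_def by (intro mult_nonneg_nonneg add_nonneg_nonneg) auto
  have K: "K > 0" using k2 T0 G0[of z0] by (simp add: K_def)
  interpret q: smooth_qr ft \<epsilon>1 K
  proof
    show "\<epsilon>1 > 0" "K > 0" by fact+
    have "smooth_on (ball 0 \<epsilon>1) (\<lambda>z. f (z0 + z))"
      by (rule smooth_on_shift[OF fsm]) (use inU in auto)
    from smooth_on_add[OF open_ball this smooth_on_const]
    have "smooth_on (ball 0 \<epsilon>1) (\<lambda>z. f (z0 + z) + - f z0)" .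
    from smooth_on_bounded_linear_compose[OF open_ball cj(1) this]
    show "smooth_on (ball 0 \<epsilon>1) ft" unfolding ft_def .
    show "ft 0 = 0" by (simp add: ft_def cj)
    fix z :: complex assume z: "norm z < \<epsilon>1"
    let ?z = "z0 + z"
    note bz = b[OF inU(2)[OF z]]
    have "(norm (D1 ft z))\<^sup>2 + (norm (D2 ft z))\<^sup>2 \<le> G ?z * (norm (h ?z))\<^sup>2"
      unfolding Dft[OF z] cj(2) using Gf[OF inU(1)[OF z] sh_le[OF inU(2)[OF z]]] .
    also have "\<dots> \<le> (G z0 + 1) * (norm (h ?z))\<^sup>2" using bz by (intro mult_right_mono) auto
    also have "\<dots> = K * ((T z0 / 2) * ((1 - k\<^sup>2) * (norm (h ?z))\<^sup>2))" using k2 T0 by (simp add: K_def)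
    also have "\<dots> \<le> K * (T ?z * ((norm (h ?z))\<^sup>2 - (s ?z)\<^sup>2))"
    proof (intro mult_left_mono mult_mono)
      have "(s ?z)\<^sup>2 \<le> (k * norm (h ?z))\<^sup>2" using bz by (metis abs_ge_zero power2_abs power_mono)
      then show "(1 - k\<^sup>2) * (norm (h ?z))\<^sup>2 \<le> (norm (h ?z))\<^sup>2 - (s ?z)\<^sup>2"
        by (simp add: algebra_simps)
    qed (use bz T0 k2 K in auto)
    also have "T ?z * ((norm (h ?z))\<^sup>2 - (s ?z)\<^sup>2) = Im (cnj (D1 ft z) * D2 ft z)"
      unfolding Dft[OF z] J_cj Jf[OF inU(1)[OF z]] T_def
      using bz by (auto simp: zero_less_mult_iff algebra_simps)
    finally show "(norm (D1 ft z))\<^sup>2 + (norm (D2 ft z))\<^sup>2 \<le> K * Im (cnj (D1 ft z) * D2 ft z)" .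
  qed
  from q.local_structure show ?thesis
  proof (elim disjE exE conjE)
    fix \<epsilon> :: real assume \<epsilon>: "\<epsilon> > 0" "\<forall>z. norm z < \<epsilon> \<longrightarrow> ft z = 0"
    define \<epsilon>' where "\<epsilon>' = min \<epsilon> \<epsilon>1"
    have "h z = 0" if "z \<in> ball z0 \<epsilon>'" for z
    proof -
      define w where "w = z - z0"
      have w: "norm w < \<epsilon>" "norm w < \<epsilon>1" "z0 + w = z" using that by (auto simp: w_def \<epsilon>'_def dist_norm norm_minus_commute)
      have "((\<lambda>_. 0) has_derivative (\<lambda>_. 0)) (at w)" by simp
      then have "(ft has_derivative (\<lambda>_. 0)) (at w)"
        by (rule has_derivative_transform_within_open[of _ _ _ _ "ball 0 \<epsilon>"]) (use \<epsilon> w in auto)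
      then have "D1 ft w = 0" using frechet_derivative_at by metis
      then have "D1 f z = 0" using Dft[OF w(2)] w(3) by (simp add: cj)
      then show "h z = 0" using h0_iff[of z] w by (simp add: dist_norm w_def)
    qed
    moreover have "ball z0 \<epsilon>' \<subseteq> U" using b by (auto simp: \<epsilon>'_def dist_commute)
    ultimately show ?thesis using \<epsilon> \<epsilon>1 unfolding h_def by (intro disjI1 exI[of _ \<epsilon>']) (auto simp: \<epsilon>'_def)
  next
    fix \<epsilon> :: real and M :: int
    assume \<epsilon>: "\<epsilon> > 0" "\<epsilon> \<le> \<epsilon>1" and M: "M \<ge> 1" and ne: "\<forall>z. z \<noteq> 0 \<and> norm z < \<epsilon> \<longrightarrow> D1 ft z \<noteq> 0"
      and loops: "\<forall>y n. has_deg y n \<and> (\<forall>t. norm (y t) < \<epsilon>) \<longrightarrow> has_deg (\<lambda>t. ft (y t)) (n * M)"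
      and deg: "\<forall>r. 0 < r \<and> r < \<epsilon> \<longrightarrow> has_deg (\<lambda>t. D1 ft (polar r t)) (M - 1)"
    have hne: "h z \<noteq> 0" if "z \<in> ball z0 \<epsilon>" "z \<noteq> z0" for z
    proof -
      have w: "norm (z - z0) < \<epsilon>" using that by (simp add: dist_norm norm_minus_commute)
      then have "D1 ft (z - z0) \<noteq> 0" using ne that by simp
      then have "D1 f z \<noteq> 0" using Dft[of "z - z0"] w \<epsilon> by (simp add: cj)
      then show ?thesis using h0_iff[of z] w \<epsilon> by (simp add: dist_norm)
    qed
    have hdeg: "has_deg (\<lambda>t. h (z0 + polar r t)) (1 - M)" if r: "0 < r" "r < \<epsilon>" for r
    proof -
      define y where "y t = z0 + polar r t" for t
      have yd: "dist (y t) z0 < \<epsilon>1" "y t \<in> ball z0 \<epsilon>" "y t \<noteq> z0" for t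
      proof -
        have n: "norm (polar r t) = r" using r by simp
        then show "dist (y t) z0 < \<epsilon>1" "y t \<in> ball z0 \<epsilon>" using r \<epsilon> by (auto simp: y_def dist_norm)
        show "y t \<noteq> z0"
        proof
          assume "y t = z0"
          then have "polar r t = 0" by (simp add: y_def)
          then show False using n r(1) by (simp only: norm_zero)
        qed
      qed
      note by' = b[OF yd(1)]
      have yU: "y t \<in> U" for t using by' by blast
      have yc: "continuous_on UNIV y" unfolding y_def by (intro continuous_intros)
      have yp: "y (t + 2 * pi) = y t" for t by (simp add: y_def)
      have cont: "continuous_on UNIV (\<lambda>t. F (y t))" if "continuous_on U F" for F :: "complex \<Rightarrow> 'b::topological_space"
        by (rule continuous_on_compose2[OF that yc]) (use yU in auto)
      \<comment> \<open>The degree of h is at first unknown. Following it through s + h, the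
        positive factor l, the frame R and the conjugation to a derivative of \<open>ft\<close>
        identifies it as 1 - M.\<close>
      obtain \<nu> where \<nu>: "has_deg (\<lambda>t. h (y t)) \<nu>"
        using has_deg_exists[OF cont[OF chs(1)] hne[OF yd(2,3)]] yp by metis
      have 1: "has_deg (\<lambda>t. of_real (s (y t)) + h (y t)) \<nu>"
        using \<nu>
      proof (rule has_deg_Rouche)
        show "continuous_on UNIV (\<lambda>t. of_real (s (y t)) + h (y t) :: complex)" by (intro continuous_intros cont chs)
        show "norm (of_real (s (y t)) + h (y t) - h (y t)) < norm (h (y t))" for t
        proof -
          have "k * norm (h (y t)) < 1 * norm (h (y t))"
            using k hne[OF yd(2,3)[of t]] by (intro mult_strict_right_mono) auto
          then show ?thesis using by'[of t] by simp
        qed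
      qed (simp add: yp)
      have 2: "has_deg (\<lambda>t. of_real (l (y t)) * (of_real (s (y t)) + h (y t))) \<nu>"
        using 1
      proof (rule has_deg_scale_pos)
        show "continuous_on UNIV (\<lambda>t. of_real (l (y t)) * (of_real (s (y t)) + h (y t)) :: complex)"
          by (intro continuous_intros cont chs clmd)
      qed (use ld yU yp in auto)
      have "has_deg (\<lambda>t. R (y t) (of_real (l (y t)) * (of_real (s (y t)) + h (y t)))) (if \<Delta> z0 > 0 then \<nu> else - \<nu>)"
      proof (cases "\<Delta> z0 > 0")
        case True
        have "has_deg (\<lambda>t. R (y t) (of_real (l (y t)) * (of_real (s (y t)) + h (y t)))) \<nu>"
          unfolding R_def
          by (rule has_deg_frame[OF 2 cont[OF cPQ(1)] cont[OF cPQ(2)], of "P z0" e "Q z0"])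
            (use by' True in \<open>auto simp: yp dist_norm e_def \<Delta>_def zero_less_mult_iff simp del: times_complex.sel\<close>)
        then show ?thesis using True by simp
      next
        case False
        have "has_deg (\<lambda>t. R (y t) (of_real (l (y t)) * (of_real (s (y t)) + h (y t)))) (- \<nu>)"
          unfolding R_def
          by (rule has_deg_frame_neg[OF 2 cont[OF cPQ(1)] cont[OF cPQ(2)], of "P z0" e "Q z0"])
            (use by' False in \<open>auto simp: yp dist_norm e_def \<Delta>_def zero_less_mult_iff simp del: times_complex.sel\<close>)
        then show ?thesis using False by simp
      qed
      from has_deg_mult[OF has_deg_const this, of "-1"]
      have "has_deg (\<lambda>t. D1 f (y t)) (if \<Delta> z0 > 0 then \<nu> else - \<nu>)" using df1[OF yU] by simp
      then have "has_deg (\<lambda>t. cj (D1 f (y t))) (- \<nu>)"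
        using has_deg_cnj by (auto simp: cj_def split: if_splits)
      moreover have "has_deg (\<lambda>t. cj (D1 f (y t))) (M - 1)"
      proof (rule has_deg_cong)
        show "has_deg (\<lambda>t. D1 ft (polar r t)) (M - 1)" using deg r by blast
        show "D1 ft (polar r t) = cj (D1 f (y t))" for t using Dft[of "polar r t" 1] r \<epsilon> by (simp add: y_def)
      qed
      ultimately have "M - 1 = - \<nu>" using has_deg_unique by blast
      then have "\<nu> = 1 - M" by simp
      then show ?thesis using \<nu> by (simp add: y_def)
    qed
    have "\<exists>\<sigma>\<in>{1, -1}. \<forall>y n. has_deg y n \<and> (\<forall>t. norm (y t) < \<epsilon>) \<longrightarrow> has_deg (\<lambda>t. f (z0 + y t) - f z0) (\<sigma> * (n * M))"
    proof (cases "\<Delta> z0 > 0")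
      case True
      have "has_deg (\<lambda>t. f (z0 + y t) - f z0) (- 1 * (n * M))" if "has_deg y n" "\<And>t. norm (y t) < \<epsilon>" for y n
      proof -
        have "has_deg (\<lambda>t. ft (y t)) (n * M)" using loops that by blast
        from has_deg_cnj[OF this] show ?thesis using True by (simp add: ft_def cj_def)
      qed
      then show ?thesis by blast
    next
      case False
      have "has_deg (\<lambda>t. f (z0 + y t) - f z0) (1 * (n * M))" if "has_deg y n" "\<And>t. norm (y t) < \<epsilon>" for y n
      proof -
        have "has_deg (\<lambda>t. ft (y t)) (n * M)" using loops that by blast
        then show ?thesis using False by (simp add: ft_def cj_def)
      qed
      then show ?thesis by blast
    qed
    moreover have "ball z0 \<epsilon> \<subseteq> U" using b \<epsilon> by (auto simp: dist_commute)
    ultimately show ?thesis using \<epsilon> M hne hdeg unfolding h_def f_def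
      by (intro disjI2 exI[of _ \<epsilon>] conjI exI[of _ M]) auto
  qed
qed

section \<open>Independence of the chart, and the local and global dichotomies\<close>

context
  fixes \<Sigma> :: "'a surface"
  assumes surf: "immersed_surface \<Sigma>"
begin

text \<open>A small circle in the first chart becomes a loop of degree n = 1 or n = -1 in the
  second. F runs through the same loop in both descriptions, so s1 m1 = s2 n m2, and positivity of
  m1 and m2 removes the signs.\<close>

lemma umbilic_index_unique:
  assumes c1: "(U, \<phi>) \<in> charts \<Sigma>" "z1 \<in> U" and c2: "(V, \<xi>) \<in> charts \<Sigma>" "z2 \<in> V" and eq: "\<phi> z1 = \<xi> z2"
    and e: "\<epsilon>1 > 0" "\<epsilon>2 > 0" and m: "m1 \<ge> 1" "m2 \<ge> 1" and s: "s1 \<in> {1, -1}" "s2 \<in> {1, -1 :: int}"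
    and l1: "\<And>y n. has_deg y n \<Longrightarrow> (\<And>t. norm (y t) < \<epsilon>1) \<Longrightarrow> has_deg (\<lambda>t. F (\<phi> (z1 + y t)) - F (\<phi> z1)) (s1 * (n * m1))"
    and l2: "\<And>y n. has_deg y n \<Longrightarrow> (\<And>t. norm (y t) < \<epsilon>2) \<Longrightarrow> has_deg (\<lambda>t. F (\<xi> (z2 + y t)) - F (\<xi> z2)) (s2 * (n * m2))"
  shows "m1 = m2"
proof -
  obtain \<psi> W L where W: "open W" "z1 \<in> W" "continuous_on W \<psi>" "\<psi> z1 = z2"
    "\<And>z. z \<in> W \<Longrightarrow> \<psi> z \<in> V \<and> \<xi> (\<psi> z) = \<phi> z" "(\<psi> has_derivative L) (at z1)" "inj L"
    using transition[OF surf c1 c2 eq] by metis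
  obtain n \<rho> where n: "n \<in> {1, -1}" and \<rho>: "\<rho> > 0"
    "\<And>r. 0 < r \<Longrightarrow> r < \<rho> \<Longrightarrow> has_deg (\<lambda>t. \<psi> (z1 + polar r t) - \<psi> z1) n"
    using diffeo_degree[OF W(1-3,6,7)] by blast
  have "isCont \<psi> z1" using W by (simp add: continuous_on_eq_continuous_at)
  then obtain d where d: "d > 0" "\<And>z. dist z z1 < d \<Longrightarrow> dist (\<psi> z) (\<psi> z1) < \<epsilon>2"
    using e unfolding continuous_at_eps_delta by meson
  obtain d' where d': "d' > 0" "ball z1 d' \<subseteq> W" using W by (meson openE)
  define r where "r = min (min \<rho> d) (min d' \<epsilon>1) / 2"
  have r: "0 < r" "r < \<rho>" "r < d" "r < d'" "r < \<epsilon>1" using \<rho> d d' e by (auto simp: r_def min_def)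
  have 1: "has_deg (\<lambda>t. F (\<phi> (z1 + polar r t)) - F (\<phi> z1)) (s1 * (1 * m1))"
    using r by (intro l1 has_deg_polar) auto
  have "has_deg (\<lambda>t. F (\<xi> (z2 + (\<psi> (z1 + polar r t) - z2))) - F (\<xi> z2)) (s2 * (n * m2))"
  proof (rule l2)
    show "has_deg (\<lambda>t. \<psi> (z1 + polar r t) - z2) n" using \<rho>(2)[OF r(1,2)] W(4) by simp
    show "norm (\<psi> (z1 + polar r t) - z2) < \<epsilon>2" for t
      using d(2)[of "z1 + polar r t"] r W(4) by (simp add: dist_norm)
  qed
  then have 2: "has_deg (\<lambda>t. F (\<phi> (z1 + polar r t)) - F (\<phi> z1)) (s2 * (n * m2))"
  proof (rule has_deg_cong)
    fix t
    have "z1 + polar r t \<in> W" using d' r by (auto simp: dist_norm)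
    then show "F (\<xi> (z2 + (\<psi> (z1 + polar r t) - z2))) - F (\<xi> z2) = F (\<phi> (z1 + polar r t)) - F (\<phi> z1)"
      using W(5) eq by simp
  qed
  have "s1 * m1 = s2 * (n * m2)" using has_deg_unique[OF 1 2] by simp
  then show ?thesis using s n m by auto
qed

text \<open>The index has to be one number for all charts around p: each chart yields its own m, and
  \<open>umbilic_index_unique\<close> identifies them. At p itself the inequality forces c to be the
  common principal curvature.\<close>

lemma umbilic_dichotomy:
  assumes p: "umbilic \<Sigma> p" and \<mu>: "0 \<le> \<mu>" "\<mu> < 1"
    and ev: "\<forall>\<^sub>F q in nhdsin (surf_top \<Sigma>) p.
      ((kappa1 \<Sigma> q + kappa2 \<Sigma> q) / 2 - c)\<^sup>2 \<le> \<mu> * ((kappa1 \<Sigma> q - kappa2 \<Sigma> q) / 2)\<^sup>2"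
  shows "totally_umbilical_around \<Sigma> p \<or> isolated_umbilic_nonpos_index \<Sigma> p"
proof (cases "totally_umbilical_around \<Sigma> p")
  case notumb: False
  have "p \<in> topspace (surf_top \<Sigma>)" using p by (simp add: umbilic_def)
  then obtain U0 \<phi>0 z0 where c0: "(U0, \<phi>0) \<in> charts \<Sigma>" "z0 \<in> U0" "\<phi>0 z0 = p" by (rule chart_exists[OF surf])
  \<comment> \<open>The coordinate vectors of one chart span the tangent plane at p, so a tangent
    vector orthogonal to both vanishes, whichever chart describes it.\<close>
  define a1 a2 where "a1 = dimm \<Sigma> \<phi>0 z0 1" and "a2 = dimm \<Sigma> \<phi>0 z0 \<i>"
  let ?F = "focal \<Sigma> c a1 a2"
  have local: "\<exists>\<epsilon>>0. \<exists>m\<ge>1. ball z \<epsilon> \<subseteq> U \<and> (\<forall>w\<in>ball z \<epsilon>. w \<noteq> z \<longrightarrow> hopf_at \<Sigma> \<phi> w \<noteq> 0) \<and>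
      (\<forall>r. 0 < r \<and> r < \<epsilon> \<longrightarrow> has_deg (\<lambda>t. hopf_at \<Sigma> \<phi> (z + polar r t)) (1 - m)) \<and>
      (\<exists>s\<in>{1, -1}. \<forall>y n. has_deg y n \<and> (\<forall>t. norm (y t) < \<epsilon>) \<longrightarrow>
          has_deg (\<lambda>t. ?F (\<phi> (z + y t)) - ?F (\<phi> z)) (s * (n * m)))"
    if c: "(U, \<phi>) \<in> charts \<Sigma>" "z \<in> U" "\<phi> z = p" for U \<phi> z
  proof -
    have "\<forall>\<^sub>F q in nhdsin (surf_top \<Sigma>) (\<phi> z).
        ((kappa1 \<Sigma> q + kappa2 \<Sigma> q) / 2 - c)\<^sup>2 \<le> \<mu> * ((kappa1 \<Sigma> q - kappa2 \<Sigma> q) / 2)\<^sup>2"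
      using ev c(3) by simp
    from eventually_nhdsin_chartD[OF surf c(1,2) this]
    obtain e where e: "e > 0" "ball z e \<subseteq> U" and
      ball: "\<And>w. w \<in> ball z e \<Longrightarrow> ((kappa1 \<Sigma> (\<phi> w) + kappa2 \<Sigma> (\<phi> w)) / 2 - c)\<^sup>2 \<le> \<mu> * ((kappa1 \<Sigma> (\<phi> w) - kappa2 \<Sigma> (\<phi> w)) / 2)\<^sup>2"
      by blast
    have "\<bar>half_trace_at \<Sigma> \<phi> w - c\<bar> \<le> sqrt \<mu> * norm (hopf_at \<Sigma> \<phi> w)" if w: "w \<in> ball z e" for w
    proof -
      have wU: "w \<in> U" using w e by blast
      have "(half_trace_at \<Sigma> \<phi> w - c)\<^sup>2 \<le> \<mu> * (norm (hopf_at \<Sigma> \<phi> w))\<^sup>2"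
        using ball[OF w] unfolding kappa_chart[OF surf c(1) wU] by simp
      also have "\<dots> = (sqrt \<mu> * norm (hopf_at \<Sigma> \<phi> w))\<^sup>2" using \<mu> by (simp add: power_mult_distrib)
      finally show ?thesis using \<mu> by (metis abs_le_square_iff abs_of_nonneg mult_nonneg_nonneg norm_ge_zero real_sqrt_ge_zero)
    qed
    then have cond: "\<forall>\<^sub>F w in nhds z. \<bar>half_trace_at \<Sigma> \<phi> w - c\<bar> \<le> sqrt \<mu> * norm (hopf_at \<Sigma> \<phi> w)"
      unfolding eventually_nhds_metric using e(1) by (intro exI[of _ e]) (auto simp: dist_commute)
    have nd: "w = 0" if "proj a1 a2 (dimm \<Sigma> \<phi> z w) = 0" for w
    proof -
      obtain L where L: "(inj :: (complex \<Rightarrow> complex) \<Rightarrow> bool) L" "linear L" "dimm \<Sigma> \<phi> z = dimm \<Sigma> \<phi>0 z0 \<circ> L"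
        using transition[OF surf c(1,2) c0(1,2)] c(3) c0(3) has_derivative_linear by metis
      define v where "v = dimm \<Sigma> \<phi>0 z0 (L w)"
      note s0 = chart_shape_at[OF surf c0(1,2)]
      have "v \<bullet> a1 = 0" "v \<bullet> a2 = 0"
        using that unfolding L(3) proj_def v_def by (simp_all add: complex_eq_iff)
      moreover have "v = Re (L w) *\<^sub>R a1 + Im (L w) *\<^sub>R a2"
        unfolding v_def a1_def a2_def by (rule shape_at.D_decomp[OF s0])
      ultimately have "v \<bullet> v = 0" by (metis inner_add_right inner_scaleR_right mult_zero_right add_0)
      then have "L w = 0" using shape_at.D_eq_0[OF s0] by (simp add: v_def)
      then show "w = 0" using L(1,2) by (metis injD linear_0)
    qed
    have k: "0 \<le> sqrt \<mu>" "sqrt \<mu> < 1" using \<mu> by auto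
    show ?thesis
    proof (rule disjE[OF chart_dichotomy[OF surf c(1,2) k cond, of a1 a2]])
      show "w = 0" if "proj a1 a2 (dimm \<Sigma> \<phi> z w) = 0" for w by (rule nd[OF that])
    next
      assume "\<exists>\<epsilon>>0. ball z \<epsilon> \<subseteq> U \<and> (\<forall>w\<in>ball z \<epsilon>. hopf_at \<Sigma> \<phi> w = 0)"
      then obtain \<epsilon> where \<epsilon>: "\<epsilon> > 0" "ball z \<epsilon> \<subseteq> U" "\<forall>w\<in>ball z \<epsilon>. hopf_at \<Sigma> \<phi> w = 0" by blast
      have "\<forall>\<^sub>F q in nhdsin (surf_top \<Sigma>) (\<phi> z). umbilic \<Sigma> q"
        by (rule eventually_nhdsin_chartI[OF surf c(1) \<epsilon>(1,2)]) (use umbilic_chart[OF surf c(1)] \<epsilon> in blast)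
      then show ?thesis using notumb c(3) by (simp add: totally_umbilical_around_def)
    qed
  qed
  from local[OF c0] obtain \<epsilon>0 m0 s0 where \<epsilon>0: "\<epsilon>0 > 0" "ball z0 \<epsilon>0 \<subseteq> U0" and m0: "m0 \<ge> 1"
    and ne0: "\<And>w. w \<in> ball z0 \<epsilon>0 \<Longrightarrow> w \<noteq> z0 \<Longrightarrow> hopf_at \<Sigma> \<phi>0 w \<noteq> 0"
    and s0: "s0 \<in> {1, -1}" "\<And>y n. has_deg y n \<Longrightarrow> (\<And>t. norm (y t) < \<epsilon>0) \<Longrightarrow>
          has_deg (\<lambda>t. ?F (\<phi>0 (z0 + y t)) - ?F (\<phi>0 z0)) (s0 * (n * m0))"
    by blast
  have "\<forall>\<^sub>F q in atin (surf_top \<Sigma>) (\<phi>0 z0). \<not> umbilic \<Sigma> q"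
    by (rule eventually_atin_chartI[OF surf c0(1) \<epsilon>0]) (use umbilic_chart[OF surf c0(1)] ne0 \<epsilon>0 in blast)
  then have iso: "isolated_umbilic \<Sigma> p" using p c0(3) by (simp add: isolated_umbilic_def)
  have "has_rotation_index (principal_line \<Sigma> \<kappa> \<phi>) z (of_int (1 - m0) / 2)"
    if c: "(U, \<phi>) \<in> charts \<Sigma>" "z \<in> U" "\<phi> z = p" and \<kappa>: "\<kappa> \<in> {kappa1 \<Sigma>, kappa2 \<Sigma>}" for U \<phi> z \<kappa>
  proof -
    from local[OF c] obtain \<epsilon> m s where \<epsilon>: "\<epsilon> > 0" "ball z \<epsilon> \<subseteq> U" and m: "m \<ge> 1"
      and deg: "\<And>r. 0 < r \<Longrightarrow> r < \<epsilon> \<Longrightarrow> has_deg (\<lambda>t. hopf_at \<Sigma> \<phi> (z + polar r t)) (1 - m)"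
      and s: "s \<in> {1, -1}" "\<And>y n. has_deg y n \<Longrightarrow> (\<And>t. norm (y t) < \<epsilon>) \<Longrightarrow>
          has_deg (\<lambda>t. ?F (\<phi> (z + y t)) - ?F (\<phi> z)) (s * (n * m))"
      by blast
    have "m = m0"
      by (rule umbilic_index_unique[OF c(1,2) c0(1,2) _ \<epsilon>(1) \<epsilon>0(1) m m0 s(1) s0(1), of ?F])
        (use c c0 s s0 in auto)
    then show ?thesis using rotation_index[OF surf c(1) \<epsilon> deg \<kappa>] by simp
  qed
  then have "has_umbilic_index \<Sigma> p (of_int (1 - m0) / 2)"
    using iso unfolding has_umbilic_index_def by blast
  moreover have "(of_int (1 - m0) :: real) / 2 \<le> 0" using m0 by simp
  ultimately show ?thesis using iso unfolding isolated_umbilic_nonpos_index_def by blast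
qed simp

text \<open>The points with an umbilic neighbourhood form an open set. It is also closed, since an
  umbilic outside it is isolated by the local dichotomy and the non-umbilics form an open set.
  Connectedness leaves the empty set or the whole surface.\<close>

lemma quasi_CMC_dichotomy:
  assumes q: "quasi_CMC \<Sigma>"
  shows "totally_umbilical \<Sigma> \<or> (\<forall>p. umbilic \<Sigma> p \<longrightarrow> isolated_umbilic_nonpos_index \<Sigma> p)"
proof -
  let ?X = "surf_top \<Sigma>"
  obtain c \<mu> where \<mu>: "\<mu> < 1" and le: "\<And>p. p \<in> topspace ?X \<Longrightarrow>
      (mean_curvature \<Sigma> p - c)\<^sup>2 \<le> \<mu> * ((mean_curvature \<Sigma> p)\<^sup>2 - gauss_curvature \<Sigma> p)"
    using q unfolding quasi_CMC_def by blast
  have dich: "totally_umbilical_around \<Sigma> p \<or> isolated_umbilic_nonpos_index \<Sigma> p" if p: "umbilic \<Sigma> p" for p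
  \<comment> \<open>The constant \<mu> may be negative; raising it to 0 weakens the inequality and
    permits the square root taken in the local argument.\<close>
  proof (rule umbilic_dichotomy[OF p, of "max \<mu> 0" c])
    have "((kappa1 \<Sigma> q + kappa2 \<Sigma> q) / 2 - c)\<^sup>2 \<le> max \<mu> 0 * ((kappa1 \<Sigma> q - kappa2 \<Sigma> q) / 2)\<^sup>2" if "q \<in> topspace ?X" for q
    proof -
      have "(mean_curvature \<Sigma> q)\<^sup>2 - gauss_curvature \<Sigma> q = ((kappa1 \<Sigma> q - kappa2 \<Sigma> q) / 2)\<^sup>2"
        unfolding mean_curvature_def gauss_curvature_def by (simp add: power2_eq_square field_simps)
      then have "((kappa1 \<Sigma> q + kappa2 \<Sigma> q) / 2 - c)\<^sup>2 \<le> \<mu> * ((kappa1 \<Sigma> q - kappa2 \<Sigma> q) / 2)\<^sup>2"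
        using le[OF that] by (simp add: mean_curvature_def)
      also have "\<dots> \<le> max \<mu> 0 * ((kappa1 \<Sigma> q - kappa2 \<Sigma> q) / 2)\<^sup>2" by (intro mult_right_mono) auto
      finally show ?thesis .
    qed
    then show "\<forall>\<^sub>F q in nhdsin ?X p. ((kappa1 \<Sigma> q + kappa2 \<Sigma> q) / 2 - c)\<^sup>2 \<le> max \<mu> 0 * ((kappa1 \<Sigma> q - kappa2 \<Sigma> q) / 2)\<^sup>2"
      using p unfolding eventually_nhdsin umbilic_def by (intro disjI2 exI[of _ "topspace ?X"]) auto
  qed (use \<mu> in auto)
  define V where "V = {p \<in> topspace ?X. totally_umbilical_around \<Sigma> p}"
  have Vumb: "umbilic \<Sigma> p" if "p \<in> V" for p
    using that unfolding V_def totally_umbilical_around_def eventually_nhdsin by auto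
  have "openin ?X V"
  proof (subst openin_subopen, intro ballI)
    fix p assume "p \<in> V"
    then obtain S where S: "openin ?X S" "p \<in> S" "\<forall>q\<in>S. umbilic \<Sigma> q"
      unfolding V_def totally_umbilical_around_def eventually_nhdsin by auto
    have "S \<subseteq> V"
      using S openin_subset[OF S(1)] unfolding V_def totally_umbilical_around_def eventually_nhdsin by blast
    then show "\<exists>T. openin ?X T \<and> p \<in> T \<and> T \<subseteq> V" using S by blast
  qed
  moreover have "closedin ?X V"
    unfolding closedin_def
  proof (intro conjI)
    show "V \<subseteq> topspace ?X" by (auto simp: V_def)
    show "openin ?X (topspace ?X - V)"
    proof (subst openin_subopen, intro ballI)
      fix p assume p: "p \<in> topspace ?X - V"
      show "\<exists>T. openin ?X T \<and> p \<in> T \<and> T \<subseteq> topspace ?X - V"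
      proof (cases "umbilic \<Sigma> p")
        case True
        then have "isolated_umbilic \<Sigma> p"
          using dich[OF True] p by (auto simp: V_def isolated_umbilic_nonpos_index_def)
        then obtain T where T: "openin ?X T" "p \<in> T" "\<forall>q\<in>T - {p}. \<not> umbilic \<Sigma> q"
          using p unfolding isolated_umbilic_def eventually_atin by auto
        then have "T \<subseteq> topspace ?X - V" using p Vumb openin_subset[OF T(1)] by blast
        then show ?thesis using T by blast
      next
        case False
        obtain U \<phi> z where c: "(U, \<phi>) \<in> charts \<Sigma>" "z \<in> U" "\<phi> z = p" using chart_exists[OF surf] p by blast
        define W where "W = {w \<in> U. hopf_at \<Sigma> \<phi> w \<in> - {0}}"
        have "open (U \<inter> hopf_at \<Sigma> \<phi> -` (- {0}))"
          using chart_continuous(8)[OF surf c(1)] chartD(1)[OF surf c(1)]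
          by (rule continuous_open_preimage) (intro open_Compl closed_singleton)
        moreover have "W = U \<inter> hopf_at \<Sigma> \<phi> -` (- {0})" by (auto simp: W_def)
        ultimately have W: "open W" by simp
        have "openin ?X (\<phi> ` W)" by (rule chart_open_image[OF surf c(1) W]) (auto simp: W_def)
        moreover have "p \<in> \<phi> ` W" using False c umbilic_chart[OF surf c(1,2)] by (auto simp: W_def)
        moreover have "\<phi> ` W \<subseteq> topspace ?X - V"
        proof -
          have "\<not> umbilic \<Sigma> (\<phi> w)" if "w \<in> W" for w using that umbilic_chart[OF surf c(1)] by (auto simp: W_def)
          then show ?thesis using Vumb chart_in_topspace[OF surf c(1)] by (auto simp: W_def)
        qed
        ultimately show ?thesis by blast
      qed
    qed
  qed
  moreover have "connected_space ?X" using surf by (simp add: immersed_surface_def)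
  ultimately have "V = {} \<or> V = topspace ?X" unfolding connected_space_clopen_in by blast
  then show ?thesis
  proof
    assume "V = {}"
    then show ?thesis using dich by (auto simp: V_def umbilic_def)
  next
    assume "V = topspace ?X"
    then show ?thesis using Vumb by (auto simp: totally_umbilical_def)
  qed
qed

end

theorem theorem4p1:
  fixes \<Sigma> :: "'a surface"
  assumes "immersed_surface \<Sigma>"
  shows "(\<forall>p c \<Lambda>. umbilic \<Sigma> p \<and> c = kappa1 \<Sigma> p \<and> c = kappa2 \<Sigma> p \<and> \<Lambda> < 0 \<and>
            (\<forall>\<^sub>F q in nhdsin (surf_top \<Sigma>) p.
               (kappa1 \<Sigma> q - c)\<^sup>2 + (kappa2 \<Sigma> q - c)\<^sup>2
                 \<le> 2 * \<Lambda> * ((kappa1 \<Sigma> q - c) * (kappa2 \<Sigma> q - c)))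
          \<longrightarrow> totally_umbilical_around \<Sigma> p \<or> isolated_umbilic_nonpos_index \<Sigma> p)
       \<and> (quasi_CMC \<Sigma>
          \<longrightarrow> totally_umbilical \<Sigma> \<or>
              (\<forall>p. umbilic \<Sigma> p \<longrightarrow> isolated_umbilic_nonpos_index \<Sigma> p))"
proof (intro conjI allI impI)
  fix p c \<Lambda>
  assume *: "umbilic \<Sigma> p \<and> c = kappa1 \<Sigma> p \<and> c = kappa2 \<Sigma> p \<and> \<Lambda> < 0 \<and>
            (\<forall>\<^sub>F q in nhdsin (surf_top \<Sigma>) p.
               (kappa1 \<Sigma> q - c)\<^sup>2 + (kappa2 \<Sigma> q - c)\<^sup>2
                 \<le> 2 * \<Lambda> * ((kappa1 \<Sigma> q - c) * (kappa2 \<Sigma> q - c)))"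
  then have \<Lambda>: "\<Lambda> < 0" by blast
  \<comment> \<open>With s = (a + b) / 2 - c and r = (a - b) / 2 the hypothesis reads (1 -
    \<Lambda>) s^2 \<le> (- \<Lambda> - 1) r^2. The maximum covers -1 < \<Lambda> < 0, where the
    quotient is negative.\<close>
  define \<mu> where "\<mu> = max 0 ((- \<Lambda> - 1) / (1 - \<Lambda>))"
  have \<mu>: "0 \<le> \<mu>" "\<mu> < 1" using \<Lambda> by (auto simp: \<mu>_def)
  have conv: "((a + b) / 2 - c)\<^sup>2 \<le> \<mu> * ((a - b) / 2)\<^sup>2"
    if "(a - c)\<^sup>2 + (b - c)\<^sup>2 \<le> 2 * \<Lambda> * ((a - c) * (b - c))" for a b :: real
  proof -
    define s r where "s = (a + b) / 2 - c" and "r = (a - b) / 2"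
    have ab: "a - c = s + r" "b - c = s - r" by (simp_all add: s_def r_def field_simps)
    have "(1 - \<Lambda>) * s\<^sup>2 \<le> (- \<Lambda> - 1) * r\<^sup>2"
      using that unfolding ab by (simp add: power2_eq_square algebra_simps)
    then have "s\<^sup>2 \<le> (- \<Lambda> - 1) / (1 - \<Lambda>) * r\<^sup>2" using \<Lambda> by (simp add: field_simps)
    also have "\<dots> \<le> \<mu> * r\<^sup>2" unfolding \<mu>_def by (intro mult_right_mono) auto
    finally show ?thesis by (simp add: s_def r_def)
  qed
  show "totally_umbilical_around \<Sigma> p \<or> isolated_umbilic_nonpos_index \<Sigma> p"
  proof (rule umbilic_dichotomy[OF assms _ \<mu>])
    show "umbilic \<Sigma> p" using * by blast
    show "\<forall>\<^sub>F q in nhdsin (surf_top \<Sigma>) p. ((kappa1 \<Sigma> q + kappa2 \<Sigma> q) / 2 - c)\<^sup>2 \<le> \<mu> * ((kappa1 \<Sigma> q - kappa2 \<Sigma> q) / 2)\<^sup>2"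
    proof (rule eventually_mono)
      show "\<forall>\<^sub>F q in nhdsin (surf_top \<Sigma>) p.
               (kappa1 \<Sigma> q - c)\<^sup>2 + (kappa2 \<Sigma> q - c)\<^sup>2
                 \<le> 2 * \<Lambda> * ((kappa1 \<Sigma> q - c) * (kappa2 \<Sigma> q - c))"
        using * by blast
    qed (rule conv)
  qed
next
  assume "quasi_CMC \<Sigma>"
  then show "totally_umbilical \<Sigma> \<or> (\<forall>p. umbilic \<Sigma> p \<longrightarrow> isolated_umbilic_nonpos_index \<Sigma> p)"
    by (rule quasi_CMC_dichotomy[OF assms])
qed

end
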